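(* Assume $C$ satisfies (A1)–(A4). There exist $c>0$ and $\beta\in(0,1)$ such that for all $\rho\ge1$, $t_0\in(0,\infty)$, $s_1,s_2\in[t_0,\infty)$ and $x_1,x_2,y\in\rho^{-1}\mathbb Z^d$, $$|p_{Y^\rho}(s_1,x_1,y)-p_{Y^\rho}(s_2,x_2,y)|\le c\,t_0^{-(d+\beta)/\alpha}\big(|s_1-s_2|^{1/\alpha}+|x_1-x_2|\vee(\Theta_1\rho^{-1})\big)^\beta,$$ and more generally for all $y_1,y_2\in\rho^{-1}\mathbb Z^d$, $$|p_{Y^\rho}(s_1,x_1,y_1)-p_{Y^\rho}(s_2,x_2,y_2)|\le c\,t_0^{-(d+\beta)/\alpha}\big(|s_1-s_2|^{1/\alpha}+|x_1-x_2|\vee(\Theta_1\rho^{-1})+|y_1-y_2|\vee(\Theta_1\rho^{-1})\big)^\beta.$$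
   Context: Fix $d\ge1$, $\alpha\in(0,2)$; $\mu$ counting measure. $C:\mathbb Z^d\times\mathbb Z^d\to[0,\infty)$ with: (A1) $C(x,y)=C(y,x)$, $C(x,x)=0$. (A2) $C(x,y)\le\kappa_1|x-y|^{-d-\alpha}$ for $x\ne y$. (A3) There are $N_0\in\mathbb N,\kappa_2>0$ such that for $x\ne y$ in $\mathbb Z^d$ there are $z_0^{(x,y)}=x,\dots,z_l^{(x,y)}=y$, $l\le N_0$, with $C(z_i^{(x,y)},z_{i+1}^{(x,y)})\ge\kappa_2|x-y|^{-d-\alpha}$; and for every $(\zeta,\xi)$ at most $N_0$ pairs $(x,y)$ have $\zeta=z_k^{(x,y)},\xi=z_{k+1}^{(x,y)}$ for some $k$. (A4) There are $\Theta_1,\kappa_3>0$ such that for $x\in\mathbb Z^d$, $r\ge\Theta_1$: $\mu(\{y\in B^1(x,r):C(x,y)\ge\kappa_3|x-y|^{-d-\alpha}\})\ge\frac56\mu(B^1(x,r))$, where $B^1(x,r)=\{y\in\mathbb Z^d:|x-y|<r\}$. $Y$ is the continuous-time Markov chain on $\mathbb Z^d$ jumping from $x$ to $y$ at rate $C(x,y)$; $Y^\rho_t=\rho^{-1}Y_{\rho^\alpha t}$ on $\rho^{-1}\mathbb Z^d$; $p_{Y^\rho}(t,x,y)=\rho^d\mathbb P^x(Y^\rho_t=y)$ is its heat kernel with respect to $\rho^{-d}\mu$. *)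

theory Defs
  imports "HOL-Analysis.Analysis"
begin

definition rvec :: "int^'d \<Rightarrow> real^'d" where
  "rvec x = (\<chi> i. real_of_int (x $ i))"

definition ldist :: "int^'d \<Rightarrow> int^'d \<Rightarrow> real" where
  "ldist x y = norm (rvec x - rvec y)"

definition genQ :: "(int^'d \<Rightarrow> int^'d \<Rightarrow> real) \<Rightarrow> int^'d \<Rightarrow> int^'d \<Rightarrow> real" where
  "genQ C x y = (if x = y then - (\<Sum>\<^sub>\<infinity>z. C x z) else C x y)"

fun genQpow :: "(int^'d \<Rightarrow> int^'d \<Rightarrow> real) \<Rightarrow> nat \<Rightarrow> int^'d \<Rightarrow> int^'d \<Rightarrow> real" where
  "genQpow C 0 x y = (if x = y then 1 else 0)"
| "genQpow C (Suc n) x y = (\<Sum>\<^sub>\<infinity>z. genQpow C n x z * genQ C z y)"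

text \<open>Transition probabilities P^x(Y_t = y) = (exp (t Q))(x,y) of the (bounded-rate)
  continuous-time Markov chain Y with jump rates C.\<close>

definition transP :: "(int^'d \<Rightarrow> int^'d \<Rightarrow> real) \<Rightarrow> real \<Rightarrow> int^'d \<Rightarrow> int^'d \<Rightarrow> real" where
  "transP C t x y = (\<Sum>n. t ^ n / fact n * genQpow C n x y)"

text \<open>Heat kernel of the scaled process Y^rho_t = rho^-1 Y_{rho^alpha t} w.r.t. rho^-d mu,
  evaluated at the points x = k/rho, y = l/rho of rho^-1 Z^d:
  p(t, k/rho, l/rho) = rho^d P^k(Y_{rho^alpha t} = l).\<close>

definition pY :: "(int^'d \<Rightarrow> int^'d \<Rightarrow> real) \<Rightarrow> real \<Rightarrow> real \<Rightarrow> real \<Rightarrow> int^'d \<Rightarrow> int^'d \<Rightarrow> real" where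
  "pY C \<alpha> \<rho> t k l = \<rho> ^ CARD('d) * transP C (\<rho> powr \<alpha> * t) k l"

end

(*
  By scaling it suffices to treat rho = 1.  The semigroup is P t = exp (t Q) in the Banach algebra
  of kernels with bounded row sums.  (A3) compares the Dirichlet form with the isotropic stable-like
  one, which gives a Nash inequality and P t (x, y) <= K t^(-d/alpha); since t -> P t (x, x) is
  convex, this also bounds the time derivative.  Nash's entropy argument turns the on-diagonal bound
  into E^x |Y_t - x|^gamma <= M t^(gamma/alpha) for gamma = alpha/4.

  For spatial regularity split off the jumps of size < R with rate at most kappa3 R^(-d-alpha).  By
  (A4) two nearby points have a positive fraction of common targets for such a jump, so two copies
  started at distance r couple with probability >= e before time A r^alpha.  Iterating, with the
  moment bound controlling the distance of the uncoupled copies, gives for 0 <= f <= 1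
  |P t f x1 - P t f x2| <= N (max (|x1 - x2|, r0) / t^(1/alpha))^beta; apply this to
  f = P (t/2) (., y), normalised by the on-diagonal bound.
*)

theory Submission
  imports Defs
begin

section \<open>The Banach algebra of kernels with bounded row sums\<close>

text \<open>No Markov process is built: path arguments (first jump, coupling, absorption) become
  monotone functions of time, differentiated in the Banach algebra, so neither integrals nor path
  measures occur. The rates are not translation invariant, so jumps by z and by -z need not balance;
  for \<alpha> > 1 the generator applied to a weight of scale R is then only controlled to order
  1/R, not R^(-\<alpha>). Hence the moment bound goes through the symmetric Dirichlet form and the
  entropy instead of the drift. The logarithm is unbounded at small probabilities, which on an
  infinite lattice blocks differentiating the entropy; this forces a regularisation by \<epsilon>
  and a truncation of the weight at level L. The fraction 5/6 of (A4) makes the good targets of two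
  nearly equal balls meet; since lattice balls may grow abruptly, R must be a radius where they do
  not. Coupling gains only a factor 1 - e per scale while uncoupled copies have heavy tails, so
  \<beta> is taken so small that their spread costs less than the gain.\<close>

typedef 'a kern = "{k :: 'a \<Rightarrow> 'a \<Rightarrow> real. \<exists>B. \<forall>x F. finite F \<longrightarrow> (\<Sum>y\<in>F. \<bar>k x y\<bar>) \<le> B}"
  morphisms ent Kern
  by (rule exI[of _ "\<lambda>_ _. 0"]) auto

setup_lifting type_definition_kern

text \<open>An infinite sum defaults to 0 when the family is not summable, so a bound on
  \<open>infsum\<close> alone carries no information. Bounds are therefore stated for all finite
  subsets, in \<open>kern\<close> as well, and converted here.\<close>

lemma summable_on_realI:
  fixes f :: "'a \<Rightarrow> real"
  assumes "\<And>F. finite F \<Longrightarrow> (\<Sum>y\<in>F. \<bar>f y\<bar>) \<le> B"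
  shows "f summable_on UNIV" "(\<lambda>x. \<bar>f x\<bar>) summable_on UNIV" "(\<Sum>\<^sub>\<infinity>y. \<bar>f y\<bar>) \<le> B"
proof -
  show 1: "(\<lambda>x. \<bar>f x\<bar>) summable_on UNIV"
    by (rule nonneg_bdd_above_summable_on) (use assms in \<open>auto intro!: bdd_aboveI\<close>)
  then show "f summable_on UNIV"
    using summable_on_iff_abs_summable_on_real[of f UNIV] by simp
  show "(\<Sum>\<^sub>\<infinity>y. \<bar>f y\<bar>) \<le> B"
    by (rule infsum_le_finite_sums[OF 1]) (use assms in auto)
qed

lemma summable_on_abs_real:
  fixes f :: "'a \<Rightarrow> real"
  assumes "f summable_on A"
  shows "(\<lambda>x. \<bar>f x\<bar>) summable_on A"
  using assms summable_on_iff_abs_summable_on_real[of f A] by simp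

lemma summable_on_real_bound:
  fixes f g :: "'a \<Rightarrow> real"
  assumes "g summable_on A" "\<And>x. x \<in> A \<Longrightarrow> \<bar>f x\<bar> \<le> g x"
  shows "f summable_on A"
proof -
  have "(\<lambda>x. norm (f x)) summable_on A"
    by (rule Infinite_Sum.abs_summable_on_comparison_test[of g]) (use assms summable_on_iff_abs_summable_on_real[of g A] in force)+
  then show ?thesis using summable_on_iff_abs_summable_on_real by blast
qed

lemma abs_infsum_le:
  fixes f :: "'a \<Rightarrow> real"
  assumes "f summable_on A"
  shows "\<bar>infsum f A\<bar> \<le> (\<Sum>\<^sub>\<infinity>x\<in>A. \<bar>f x\<bar>)"
  using norm_infsum_bound[of f A] assms summable_on_iff_abs_summable_on_real[of f A] by simp

lemma infsum_diff_real:
  fixes f g :: "'a \<Rightarrow> real"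
  assumes "f summable_on A" "g summable_on A"
  shows "(\<lambda>x. f x - g x) summable_on A"
    and "(\<Sum>\<^sub>\<infinity>x\<in>A. f x - g x) = infsum f A - infsum g A"
proof -
  have 1: "(\<lambda>x. - g x) summable_on A" using assms(2) by (simp add: summable_on_uminus)
  show "(\<lambda>x. f x - g x) summable_on A" using summable_on_add[OF assms(1) 1] by simp
  show "(\<Sum>\<^sub>\<infinity>x\<in>A. f x - g x) = infsum f A - infsum g A"
    using infsum_add[OF assms(1) 1] by (simp add: infsum_uminus)
qed

lemma ent_bdd: "\<exists>B. \<forall>x F. finite F \<longrightarrow> (\<Sum>y\<in>F. \<bar>ent k x y\<bar>) \<le> B"
  using ent[of k] by simp

lemma ent_summable: "ent k x summable_on UNIV"
  and ent_abs_summable: "(\<lambda>y. \<bar>ent k x y\<bar>) summable_on UNIV"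
proof -
  obtain B where "\<And>x F. finite F \<Longrightarrow> (\<Sum>y\<in>F. \<bar>ent k x y\<bar>) \<le> B"
    using ent_bdd[of k] by blast
  from summable_on_realI[OF this] show "ent k x summable_on UNIV"
    "(\<lambda>y. \<bar>ent k x y\<bar>) summable_on UNIV" by auto
qed

instantiation kern :: (type) real_vector
begin

lift_definition zero_kern :: "'a kern" is "\<lambda>_ _. 0" by auto

lift_definition plus_kern :: "'a kern \<Rightarrow> 'a kern \<Rightarrow> 'a kern" is "\<lambda>k l x y. k x y + l x y"
proof -
  fix k l :: "'a \<Rightarrow> 'a \<Rightarrow> real"
  assume "\<exists>B. \<forall>x F. finite F \<longrightarrow> (\<Sum>y\<in>F. \<bar>k x y\<bar>) \<le> B" "\<exists>B. \<forall>x F. finite F \<longrightarrow> (\<Sum>y\<in>F. \<bar>l x y\<bar>) \<le> B"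
  then obtain B B' where B: "\<And>x F. finite F \<Longrightarrow> (\<Sum>y\<in>F. \<bar>k x y\<bar>) \<le> B" "\<And>x F. finite F \<Longrightarrow> (\<Sum>y\<in>F. \<bar>l x y\<bar>) \<le> B'"
    by blast
  have "(\<Sum>y\<in>F. \<bar>k x y + l x y\<bar>) \<le> B + B'" if "finite F" for x F
  proof -
    have "(\<Sum>y\<in>F. \<bar>k x y + l x y\<bar>) \<le> (\<Sum>y\<in>F. \<bar>k x y\<bar>) + (\<Sum>y\<in>F. \<bar>l x y\<bar>)"
      unfolding sum.distrib[symmetric] by (rule sum_mono) (rule abs_triangle_ineq)
    with B(1)[OF that, of x] B(2)[OF that, of x] show ?thesis by linarith
  qed
  then show "\<exists>B. \<forall>x F. finite F \<longrightarrow> (\<Sum>y\<in>F. \<bar>k x y + l x y\<bar>) \<le> B" by blast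
qed

lift_definition scaleR_kern :: "real \<Rightarrow> 'a kern \<Rightarrow> 'a kern" is "\<lambda>c k x y. c * k x y"
proof -
  fix c :: real and k :: "'a \<Rightarrow> 'a \<Rightarrow> real"
  assume "\<exists>B. \<forall>x F. finite F \<longrightarrow> (\<Sum>y\<in>F. \<bar>k x y\<bar>) \<le> B"
  then obtain B where B: "\<And>x F. finite F \<Longrightarrow> (\<Sum>y\<in>F. \<bar>k x y\<bar>) \<le> B" by blast
  have "(\<Sum>y\<in>F. \<bar>c * k x y\<bar>) \<le> \<bar>c\<bar> * B" if "finite F" for x F
    using mult_left_mono[OF B[OF that], of "\<bar>c\<bar>" x] by (simp add: abs_mult sum_distrib_left)
  then show "\<exists>B. \<forall>x F. finite F \<longrightarrow> (\<Sum>y\<in>F. \<bar>c * k x y\<bar>) \<le> B" by blast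
qed

definition uminus_kern :: "'a kern \<Rightarrow> 'a kern" where "- k = (- 1 :: real) *\<^sub>R (k :: 'a kern)"
definition minus_kern :: "'a kern \<Rightarrow> 'a kern \<Rightarrow> 'a kern" where "k - l = k + (- l :: 'a kern)"
lemma ent_plus [simp]: "ent (k + l) x y = ent k x y + ent l x y" by transfer simp
lemma ent_zero [simp]: "ent 0 x y = 0" by transfer simp
lemma ent_scaleR [simp]: "ent (c *\<^sub>R k) x y = c * ent k x y" by transfer simp
lemma ent_uminus [simp]: "ent (- k) x y = - ent k x y" by (simp add: uminus_kern_def)
lemma ent_minus [simp]: "ent (k - l) x y = ent k x y - ent l x y" by (simp add: minus_kern_def)

lemma kern_eqI: "(\<And>x y. ent k x y = ent l x y) \<Longrightarrow> k = l"
  by (metis ent_inject ext)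

instance
proof
  fix a b :: real and k l m :: "'a kern"
  show "k + l + m = k + (l + m)" "k + l = l + k" "0 + k = k" "- k + k = 0"
    "a *\<^sub>R (k + l) = a *\<^sub>R k + a *\<^sub>R l" "(a + b) *\<^sub>R k = a *\<^sub>R k + b *\<^sub>R k" "a *\<^sub>R b *\<^sub>R k = (a * b) *\<^sub>R k"
    "1 *\<^sub>R k = k"
    by (auto intro!: kern_eqI simp: algebra_simps)
  show "k - l = k + - l" by (rule minus_kern_def)
qed

end

instantiation kern :: (type) real_normed_vector
begin

text \<open>This is the operator norm of the action on bounded functions with the supremum norm,
  hence submultiplicative.\<close>

definition norm_kern :: "'a kern \<Rightarrow> real" where "norm k = (SUP x. \<Sum>\<^sub>\<infinity>y. \<bar>ent k x y\<bar>)"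
definition dist_kern :: "'a kern \<Rightarrow> 'a kern \<Rightarrow> real" where "dist k l = norm (k - l :: 'a kern)"
definition sgn_kern :: "'a kern \<Rightarrow> 'a kern" where "sgn k = inverse (norm k) *\<^sub>R (k :: 'a kern)"
definition uniformity_kern :: "('a kern \<times> 'a kern) filter"
  where "uniformity_kern = (INF e\<in>{0<..}. principal {(x, y). dist x y < e})"
definition open_kern :: "'a kern set \<Rightarrow> bool"
  where "open_kern U = (\<forall>x\<in>U. \<forall>\<^sub>F (x', y) in uniformity. x' = x \<longrightarrow> y \<in> U)"

lemma row_le_norm: "(\<Sum>\<^sub>\<infinity>y. \<bar>ent k x y\<bar>) \<le> norm k"
  unfolding norm_kern_def
proof (rule cSUP_upper)
  obtain B where B: "\<And>x F. finite F \<Longrightarrow> (\<Sum>y\<in>F. \<bar>ent k x y\<bar>) \<le> B"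
    using ent_bdd[of k] by blast
  show "bdd_above (range (\<lambda>x. \<Sum>\<^sub>\<infinity>y. \<bar>ent k x y\<bar>))"
    by (rule bdd_aboveI2[where M = B]) (rule summable_on_realI(3)[OF B])
qed simp

lemma norm_kern_le:
  assumes "\<And>x. (\<Sum>\<^sub>\<infinity>y. \<bar>ent k x y\<bar>) \<le> B"
  shows "norm k \<le> B"
  unfolding norm_kern_def by (rule cSUP_least) (use assms in auto)

lemma ent_le_norm: "\<bar>ent k x y\<bar> \<le> norm k"
proof -
  have "(\<Sum>y\<in>{y}. \<bar>ent k x y\<bar>) \<le> (\<Sum>\<^sub>\<infinity>y. \<bar>ent k x y\<bar>)"
    by (rule finite_sum_le_infsum[OF ent_abs_summable]) auto
  then show ?thesis using row_le_norm[of k x] by simp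
qed

lemma finite_row_le_norm: "finite F \<Longrightarrow> (\<Sum>y\<in>F. \<bar>ent k x y\<bar>) \<le> norm k"
  using finite_sum_le_infsum[OF ent_abs_summable, of F k x] row_le_norm[of k x] by auto

instance
proof
  fix a :: real and k l :: "'a kern"
  show "dist k l = norm (k - l)" by (rule dist_kern_def)
  show "sgn k = k /\<^sub>R norm k" by (rule sgn_kern_def)
  show "uniformity = (INF e\<in>{0<..}. principal {(x, y :: 'a kern). dist x y < e})" by (rule uniformity_kern_def)
  show "open U = (\<forall>x\<in>U. \<forall>\<^sub>F (x', y) in uniformity. x' = x \<longrightarrow> y \<in> U)" for U :: "'a kern set" by (rule open_kern_def)
  show "norm k = 0 \<longleftrightarrow> k = 0"
  proof
    assume "norm k = 0"
    then have "ent k x y = 0" for x y using ent_le_norm[of k x y] by simp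
    then show "k = 0" by (intro kern_eqI) simp
  next
    assume "k = 0"
    then show "norm k = 0" by (simp add: norm_kern_def)
  qed
  show "norm (k + l) \<le> norm k + norm l"
  proof (rule norm_kern_le)
    fix x
    have "(\<Sum>\<^sub>\<infinity>y. \<bar>ent (k + l) x y\<bar>) \<le> (\<Sum>\<^sub>\<infinity>y. \<bar>ent k x y\<bar> + \<bar>ent l x y\<bar>)"
      by (rule infsum_mono[OF ent_abs_summable summable_on_add[OF ent_abs_summable ent_abs_summable]]) simp
    also have "\<dots> = (\<Sum>\<^sub>\<infinity>y. \<bar>ent k x y\<bar>) + (\<Sum>\<^sub>\<infinity>y. \<bar>ent l x y\<bar>)"
      by (rule infsum_add[OF ent_abs_summable ent_abs_summable])
    finally show "(\<Sum>\<^sub>\<infinity>y. \<bar>ent (k + l) x y\<bar>) \<le> norm k + norm l"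
      using row_le_norm[of k x] row_le_norm[of l x] by linarith
  qed
  show "norm (a *\<^sub>R k) = \<bar>a\<bar> * norm k"
  proof (rule antisym)
    have le: "norm (a *\<^sub>R k) \<le> \<bar>a\<bar> * norm k" for a :: real and k :: "'a kern"
    proof (rule norm_kern_le)
      fix x
      have "(\<Sum>\<^sub>\<infinity>y. \<bar>ent (a *\<^sub>R k) x y\<bar>) = \<bar>a\<bar> * (\<Sum>\<^sub>\<infinity>y. \<bar>ent k x y\<bar>)"
        by (simp add: abs_mult infsum_cmult_right')
      then show "(\<Sum>\<^sub>\<infinity>y. \<bar>ent (a *\<^sub>R k) x y\<bar>) \<le> \<bar>a\<bar> * norm k"
        by (simp add: mult_left_mono row_le_norm)
    qed
    then show "norm (a *\<^sub>R k) \<le> \<bar>a\<bar> * norm k" .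
    show "\<bar>a\<bar> * norm k \<le> norm (a *\<^sub>R k)"
    proof (cases "a = 0")
      case True
      then show ?thesis by (simp add: norm_kern_def)
    next
      case False
      have "k = (1 / a) *\<^sub>R (a *\<^sub>R k)" by (rule kern_eqI) (use False in simp)
      then have "norm k \<le> \<bar>1 / a\<bar> * norm (a *\<^sub>R k)" using le by metis
      then show ?thesis using False by (simp add: field_simps)
    qed
  qed
qed

end

text \<open>Fubini for kernels: bounded rows weighted by a summable family form an absolutely
  summable double family. The associative law and the summation by parts for the generator both
  exchange sums on this ground.\<close>

lemma summable_pair:
  fixes a :: "'a \<Rightarrow> real" and f :: "'a \<Rightarrow> 'b \<Rightarrow> real"
  assumes a: "a summable_on UNIV" and f: "\<And>z F. finite F \<Longrightarrow> (\<Sum>w\<in>F. \<bar>f z w\<bar>) \<le> M"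
  shows "(\<lambda>(z, w). a z * f z w) summable_on UNIV"
proof -
  have f2: "(\<lambda>w. \<bar>f z w\<bar>) summable_on UNIV" "(\<Sum>\<^sub>\<infinity>w. \<bar>f z w\<bar>) \<le> M" for z
    using summable_on_realI[OF f] by blast+
  have "(\<lambda>p. norm (case p of (z, w) \<Rightarrow> a z * f z w)) summable_on Sigma UNIV (\<lambda>_. UNIV)"
    unfolding Infinite_Sum.abs_summable_on_Sigma_iff
  proof (intro conjI ballI)
    fix z
    show "(\<lambda>w. norm (case (z, w) of (z, w) \<Rightarrow> a z * f z w)) summable_on UNIV"
      using summable_on_cmult_right[OF f2(1), of "\<bar>a z\<bar>" z] by (simp add: abs_mult)
  next
    have "(\<lambda>z. \<bar>a z\<bar> * (\<Sum>\<^sub>\<infinity>w. \<bar>f z w\<bar>)) summable_on UNIV"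
    proof (rule summable_on_real_bound)
      show "(\<lambda>z. \<bar>a z\<bar> * M) summable_on UNIV"
        by (rule summable_on_cmult_left[OF summable_on_abs_real[OF a]])
      show "\<bar>\<bar>a z\<bar> * (\<Sum>\<^sub>\<infinity>w. \<bar>f z w\<bar>)\<bar> \<le> \<bar>a z\<bar> * M" for z
        using f2(2)[of z] infsum_nonneg[of UNIV "\<lambda>w. \<bar>f z w\<bar>"] by (simp add: abs_mult mult_left_mono)
    qed
    then show "(\<lambda>z. norm (\<Sum>\<^sub>\<infinity>w. norm (case (z, w) of (z, w) \<Rightarrow> a z * f z w))) summable_on UNIV"
      using infsum_nonneg[of UNIV "\<lambda>w. \<bar>f _ w\<bar>"] by (simp add: abs_mult infsum_cmult_right')
  qed
  then show ?thesis
    using summable_on_iff_abs_summable_on_real by auto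
qed

section \<open>Bounded functions and the action of kernels on them\<close>

definition bfun :: "('a \<Rightarrow> real) \<Rightarrow> bool"
  where "bfun g \<longleftrightarrow> (\<exists>M. \<forall>x. \<bar>g x\<bar> \<le> M)"

lemma bfunI: "(\<And>x. \<bar>g x\<bar> \<le> M) \<Longrightarrow> bfun g" by (auto simp: bfun_def)

lemma bfun_unit: "(\<And>x. 0 \<le> g x) \<Longrightarrow> (\<And>x. g x \<le> 1) \<Longrightarrow> bfun g"
  by (rule bfunI[where M = 1]) (simp add: abs_le_iff order_trans[of _ 0])

lemma bfunE: assumes "bfun g" obtains M where "M \<ge> 0" "\<And>x. \<bar>g x\<bar> \<le> M"
proof -
  from assms obtain M where M: "\<And>x. \<bar>g x\<bar> \<le> M" by (auto simp: bfun_def)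
  then have "M \<ge> 0" using abs_ge_zero[of "g undefined"] M[of undefined] by linarith
  with M that show ?thesis by blast
qed

lemma summable_mult_bfun:
  assumes "a summable_on UNIV" "bfun g"
  shows "(\<lambda>y. a y * g y) summable_on UNIV"
proof -
  obtain M where M: "M \<ge> 0" "\<And>x. \<bar>g x\<bar> \<le> M" using bfunE[OF assms(2)] by blast
  show ?thesis
    by (rule summable_on_real_bound[OF summable_on_cmult_left[OF summable_on_abs_real[OF assms(1)], of M]])
       (simp add: abs_mult mult_left_mono M)
qed

lemma abs_infsum_bfun_le:
  fixes a g :: "'a \<Rightarrow> real"
  assumes a: "a summable_on UNIV" and g: "\<And>x. \<bar>g x\<bar> \<le> M"
  shows "\<bar>\<Sum>\<^sub>\<infinity>y. a y * g y\<bar> \<le> (\<Sum>\<^sub>\<infinity>y. \<bar>a y\<bar>) * M"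
proof -
  have s: "(\<lambda>y. a y * g y) summable_on UNIV" by (rule summable_mult_bfun[OF a bfunI[OF g]])
  have "\<bar>\<Sum>\<^sub>\<infinity>y. a y * g y\<bar> \<le> (\<Sum>\<^sub>\<infinity>y. \<bar>a y * g y\<bar>)" by (rule abs_infsum_le[OF s])
  also have "\<dots> \<le> (\<Sum>\<^sub>\<infinity>y. \<bar>a y\<bar> * M)"
    by (rule infsum_mono[OF summable_on_abs_real[OF s] summable_on_cmult_left[OF summable_on_abs_real[OF a]]])
       (simp add: abs_mult mult_left_mono g)
  also have "\<dots> = (\<Sum>\<^sub>\<infinity>y. \<bar>a y\<bar>) * M" by (rule infsum_cmult_left')
  finally show ?thesis .
qed

text \<open>For a Markov kernel this is the expectation of \<open>g\<close> under the row of
  \<open>x\<close>. It is meant for bounded \<open>g\<close>, for which the sum converges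
  absolutely.\<close>

definition kapp :: "'a kern \<Rightarrow> ('a \<Rightarrow> real) \<Rightarrow> 'a \<Rightarrow> real"
  where "kapp k g x = (\<Sum>\<^sub>\<infinity>y. ent k x y * g y)"

lemma kapp_summable: "bfun g \<Longrightarrow> (\<lambda>y. ent k x y * g y) summable_on UNIV"
  by (rule summable_mult_bfun[OF ent_summable])

lemma kapp_bound:
  assumes "\<And>x. \<bar>g x\<bar> \<le> M"
  shows "\<bar>kapp k g x\<bar> \<le> norm k * M"
proof -
  have "M \<ge> 0" using order_trans[OF abs_ge_zero assms] .
  then show ?thesis
    using abs_infsum_bfun_le[OF ent_summable, of g M k x] assms mult_right_mono[OF row_le_norm[of k x], of M]
    by (auto simp: kapp_def)
qed

lemma bfun_kapp: "bfun g \<Longrightarrow> bfun (kapp k g)"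
  by (metis bfunE bfunI kapp_bound)

lemma kapp_plus: "bfun g \<Longrightarrow> kapp (k + l) g x = kapp k g x + kapp l g x"
  unfolding kapp_def by (simp add: distrib_right infsum_add kapp_summable)

lemma kapp_scaleR: "kapp (c *\<^sub>R k) g x = c * kapp k g x"
  unfolding kapp_def by (simp add: mult.assoc infsum_cmult_right')

text \<open>Lets derivatives in the Banach algebra pass to real functions of time, to which
  monotonicity and mean value arguments apply.\<close>

lemma bounded_linear_kapp:
  assumes "bfun g"
  shows "bounded_linear (\<lambda>k. kapp k g x)"
proof -
  obtain M where M: "\<And>x. \<bar>g x\<bar> \<le> M" using bfunE[OF assms] by metis
  show ?thesis
    by (rule bounded_linear_intro[where K = M])
       (use kapp_bound[OF M] in \<open>auto simp: kapp_plus[OF assms] kapp_scaleR\<close>)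
qed

lemma bfun_indicator: "bfun (\<lambda>x. if P x then 1 else 0)"
  by (rule bfunI[where M = 1]) auto

lemma infsum_single:
  fixes f :: "'a \<Rightarrow> real"
  shows "(\<Sum>\<^sub>\<infinity>z. f z * (if z = y then 1 else 0)) = f y"
    and "(\<Sum>\<^sub>\<infinity>z. (if z = y then 1 else 0) * f z) = f y"
    and "(\<Sum>\<^sub>\<infinity>z. (if y = z then 1 else 0) * f z) = f y"
proof -
  have "infsum (\<lambda>z. f z * (if z = y then 1 else 0)) UNIV = infsum f {y}"
    by (rule infsum_cong_neutral) auto
  then show "(\<Sum>\<^sub>\<infinity>z. f z * (if z = y then 1 else 0)) = f y" by simp
  have "infsum (\<lambda>z. (if z = y then 1 else 0) * f z) UNIV = infsum f {y}"
    by (rule infsum_cong_neutral) auto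
  then show "(\<Sum>\<^sub>\<infinity>z. (if z = y then 1 else 0) * f z) = f y" by simp
  have "infsum (\<lambda>z. (if y = z then 1 else 0) * f z) UNIV = infsum f {y}"
    by (rule infsum_cong_neutral) auto
  then show "(\<Sum>\<^sub>\<infinity>z. (if y = z then 1 else 0) * f z) = f y" by simp
qed

lemma kapp_indicator: "kapp k (\<lambda>z. if z = y then 1 else 0) x = ent k x y"
  unfolding kapp_def by (rule infsum_single)

lemma bounded_linear_ent: "bounded_linear (\<lambda>k. ent k x y)"
  using bounded_linear_kapp[OF bfun_indicator, of "\<lambda>z. z = y" x] by (simp add: kapp_indicator)

section \<open>Product, unit and completeness\<close>

instantiation kern :: (type) real_normed_algebra_1
begin

lift_definition one_kern :: "'a kern" is "\<lambda>x y. if x = y then 1 else 0"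
proof -
  have "(\<Sum>y\<in>F. \<bar>if x = y then 1 else 0 :: real\<bar>) \<le> 1" if "finite F" for x :: 'a and F
    using that by (simp add: sum.delta' if_distrib cong: if_cong)
  then show "\<exists>B. \<forall>x F. finite F \<longrightarrow> (\<Sum>y\<in>F. \<bar>if x = (y::'a) then 1 else 0 :: real\<bar>) \<le> B"
    by blast
qed

text \<open>Besides the norm inequality, this is what puts the product kernel into the set on which
  \<open>Kern\<close> is meaningful, so it has to precede the definition of the product.\<close>

lemma times_kern_aux:
  assumes "finite F"
  shows "(\<Sum>y\<in>F. \<bar>\<Sum>\<^sub>\<infinity>z. ent k x z * ent l z y\<bar>) \<le> norm k * norm l"
proof -
  have b: "bfun (\<lambda>z. \<bar>ent l z y\<bar>)" for y
    by (rule bfunI[where M = "norm l"]) (simp add: ent_le_norm)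
  have s: "(\<lambda>z. \<bar>ent k x z\<bar> * \<bar>ent l z y\<bar>) summable_on UNIV" for y
    by (rule summable_mult_bfun[OF ent_abs_summable b])
  have b2: "bfun (\<lambda>z. ent l z y)" for y
    by (rule bfunI[where M = "norm l"]) (simp add: ent_le_norm)
  have "(\<Sum>y\<in>F. \<bar>\<Sum>\<^sub>\<infinity>z. ent k x z * ent l z y\<bar>) \<le> (\<Sum>y\<in>F. \<Sum>\<^sub>\<infinity>z. \<bar>ent k x z\<bar> * \<bar>ent l z y\<bar>)"
  proof (rule sum_mono)
    fix y
    show "\<bar>\<Sum>\<^sub>\<infinity>z. ent k x z * ent l z y\<bar> \<le> (\<Sum>\<^sub>\<infinity>z. \<bar>ent k x z\<bar> * \<bar>ent l z y\<bar>)"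
      using abs_infsum_le[OF summable_mult_bfun[OF ent_summable b2], of k x y] by (simp add: abs_mult)
  qed
  also have "\<dots> = (\<Sum>\<^sub>\<infinity>z. \<Sum>y\<in>F. \<bar>ent k x z\<bar> * \<bar>ent l z y\<bar>)"
    using assms
  proof (induction F)
    case (insert y F)
    have "(\<lambda>z. \<Sum>y\<in>F. \<bar>ent k x z\<bar> * \<bar>ent l z y\<bar>) summable_on UNIV"
      using insert(1) by (induction F) (auto intro!: summable_on_add s)
    with insert show ?case by (simp add: infsum_add[OF s])
  qed simp
  also have "\<dots> \<le> (\<Sum>\<^sub>\<infinity>z. \<bar>ent k x z\<bar> * norm l)"
  proof (rule infsum_mono)
    show "(\<lambda>z. \<Sum>y\<in>F. \<bar>ent k x z\<bar> * \<bar>ent l z y\<bar>) summable_on UNIV"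
      using assms by (induction F) (auto intro!: summable_on_add s)
    show "(\<lambda>z. \<bar>ent k x z\<bar> * norm l) summable_on UNIV"
      by (rule summable_on_cmult_left[OF ent_abs_summable])
    show "(\<Sum>y\<in>F. \<bar>ent k x z\<bar> * \<bar>ent l z y\<bar>) \<le> \<bar>ent k x z\<bar> * norm l" for z
      unfolding sum_distrib_left[symmetric] by (rule mult_left_mono[OF finite_row_le_norm[OF assms]]) simp
  qed
  also have "\<dots> = (\<Sum>\<^sub>\<infinity>z. \<bar>ent k x z\<bar>) * norm l" by (rule infsum_cmult_left')
  also have "\<dots> \<le> norm k * norm l" by (rule mult_right_mono[OF row_le_norm]) simp
  finally show ?thesis .
qed

definition times_kern :: "'a kern \<Rightarrow> 'a kern \<Rightarrow> 'a kern"
  where "k * l = Kern (\<lambda>x y. \<Sum>\<^sub>\<infinity>z. ent k x z * ent l z y)"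

lemma ent_times: "ent (k * l) x y = (\<Sum>\<^sub>\<infinity>z. ent k x z * ent l z y)"
proof -
  have "(\<lambda>x y. \<Sum>\<^sub>\<infinity>z. ent k x z * ent l z y) \<in> {k. \<exists>B. \<forall>x F. finite F \<longrightarrow> (\<Sum>y\<in>F. \<bar>k x y\<bar>) \<le> B}"
    using times_kern_aux[of _ k _ l] by blast
  then show ?thesis by (simp add: times_kern_def Kern_inverse)
qed

lemma ent_one: "ent 1 x y = (if x = y then 1 else 0)" by transfer simp

lemma bfun_ent: "bfun (\<lambda>z. ent l z y)"
  by (rule bfunI[where M = "norm l"]) (simp add: ent_le_norm)

text \<open>Stated for arbitrary bounded \<open>g\<close>: with a column of a third kernel it is
  associativity, in general it makes the action multiplicative.\<close>

lemma kapp_mult_aux: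
  fixes g :: "'a \<Rightarrow> real" and k l :: "'a kern"
  assumes "bfun g"
  shows "(\<Sum>\<^sub>\<infinity>y. (\<Sum>\<^sub>\<infinity>z. ent k x z * ent l z y) * g y) = (\<Sum>\<^sub>\<infinity>z. ent k x z * (\<Sum>\<^sub>\<infinity>y. ent l z y * g y))"
proof -
  obtain M where M: "M \<ge> 0" "\<And>x. \<bar>g x\<bar> \<le> M" using bfunE[OF assms] by blast
  have "(\<lambda>(z, y). ent k x z * (ent l z y * g y)) summable_on UNIV"
  proof (rule summable_pair[OF ent_summable])
    fix z and F :: "'a set" assume "finite F"
    have "(\<Sum>y\<in>F. \<bar>ent l z y * g y\<bar>) \<le> (\<Sum>y\<in>F. \<bar>ent l z y\<bar> * M)"
      by (rule sum_mono) (simp add: abs_mult mult_left_mono M)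
    also have "\<dots> \<le> norm l * M"
      using mult_right_mono[OF finite_row_le_norm[OF \<open>finite F\<close>, of l z] M(1)] by (simp add: sum_distrib_right)
    finally show "(\<Sum>y\<in>F. \<bar>ent l z y * g y\<bar>) \<le> norm l * M" .
  qed
  then have "(\<Sum>\<^sub>\<infinity>z. \<Sum>\<^sub>\<infinity>y. ent k x z * (ent l z y * g y)) = (\<Sum>\<^sub>\<infinity>y. \<Sum>\<^sub>\<infinity>z. ent k x z * (ent l z y * g y))"
    by (intro infsum_swap_banach) simp
  moreover have "(\<Sum>\<^sub>\<infinity>z. ent k x z * (ent l z y * g y)) = (\<Sum>\<^sub>\<infinity>z. ent k x z * ent l z y) * g y" for y
    by (simp only: mult.assoc[symmetric] infsum_cmult_left')
  ultimately show ?thesis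
    by (simp add: infsum_cmult_right')
qed

lemma kapp_times: "bfun g \<Longrightarrow> kapp (k * l) g x = kapp k (kapp l g) x"
  unfolding kapp_def ent_times by (rule kapp_mult_aux)

lemma norm_one_kern: "norm (1 :: 'a kern) = 1"
proof -
  have "(\<Sum>\<^sub>\<infinity>y. \<bar>ent (1::'a kern) x y\<bar>) = 1" for x
    using infsum_single(3)[of x "\<lambda>_. 1"] by (simp add: ent_one if_distrib[of abs] cong: if_cong)
  then show ?thesis by (simp add: norm_kern_def)
qed

instance
proof
  fix a :: real and k l m :: "'a kern"
  show "k * l * m = k * (l * m)"
    using kapp_mult_aux[OF bfun_ent, of k _ l] by (intro kern_eqI) (simp add: ent_times)
  show "(k + l) * m = k * m + l * m"
    by (intro kern_eqI) (simp add: ent_times distrib_right infsum_add summable_mult_bfun[OF ent_summable bfun_ent])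
  show "k * (l + m) = k * l + k * m"
    by (intro kern_eqI) (simp add: ent_times distrib_left infsum_add summable_mult_bfun[OF ent_summable bfun_ent])
  show "a *\<^sub>R k * l = a *\<^sub>R (k * l)"
    by (intro kern_eqI) (simp add: ent_times mult.assoc infsum_cmult_right')
  show "k * a *\<^sub>R l = a *\<^sub>R (k * l)"
    by (intro kern_eqI) (simp add: ent_times mult.left_commute infsum_cmult_right')
  show "1 * k = k" by (intro kern_eqI) (simp add: ent_times ent_one infsum_single)
  show "k * 1 = k" by (intro kern_eqI) (simp add: ent_times ent_one infsum_single)
  show "norm (k * l) \<le> norm k * norm l"
    by (rule norm_kern_le) (use summable_on_realI(3)[OF times_kern_aux] in \<open>simp add: ent_times\<close>)
  show "norm (1 :: 'a kern) = 1" by (rule norm_one_kern)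
  then show "(0 :: 'a kern) \<noteq> 1" by (metis norm_zero zero_neq_one)
qed

end

text \<open>Entries converge because they are bounded linear in the kernel. Finite row sums of
  differences pass to the limit with the same bound, which gives both membership of the limit and
  convergence in norm.\<close>

instance kern :: (type) banach
proof
  fix X :: "nat \<Rightarrow> 'a kern" assume X: "Cauchy X"
  have "Cauchy (\<lambda>n. ent (X n) x y)" for x y
    by (rule bounded_linear.Cauchy[OF bounded_linear_ent X])
  then have "\<exists>l. (\<lambda>n. ent (X n) x y) \<longlonglongrightarrow> l" for x y
    by (simp add: Cauchy_convergent convergentD)
  then obtain l where l: "\<And>x y. (\<lambda>n. ent (X n) x y) \<longlonglongrightarrow> l x y" by metis
  have fin: "(\<Sum>y\<in>F. \<bar>l x y - ent (X n) x y\<bar>) \<le> e"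
    if "finite F" "\<And>m. m \<ge> N \<Longrightarrow> norm (X m - X n) \<le> e" for F x n e N
  proof (rule tendsto_upperbound)
    show "(\<lambda>m. \<Sum>y\<in>F. \<bar>ent (X m) x y - ent (X n) x y\<bar>) \<longlonglongrightarrow> (\<Sum>y\<in>F. \<bar>l x y - ent (X n) x y\<bar>)"
      by (intro tendsto_intros l)
    show "\<forall>\<^sub>F m in sequentially. (\<Sum>y\<in>F. \<bar>ent (X m) x y - ent (X n) x y\<bar>) \<le> e"
      using eventually_ge_at_top[of N]
    proof eventually_elim
      case (elim m)
      then show ?case using finite_row_le_norm[OF that(1), of "X m - X n" x] that(2)[of m] by simp
    qed
  qed simp
  obtain N where N: "\<And>m n. m \<ge> N \<Longrightarrow> n \<ge> N \<Longrightarrow> norm (X m - X n) < 1"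
    using CauchyD[OF X, of 1] by auto
  have "(\<Sum>y\<in>F. \<bar>l x y\<bar>) \<le> 1 + norm (X N)" if "finite F" for F x
  proof -
    have "(\<Sum>y\<in>F. \<bar>l x y\<bar>) \<le> (\<Sum>y\<in>F. \<bar>l x y - ent (X N) x y\<bar>) + (\<Sum>y\<in>F. \<bar>ent (X N) x y\<bar>)"
      unfolding sum.distrib[symmetric] by (rule sum_mono) linarith
    then show ?thesis
      using fin[OF that, of N N 1 x] N finite_row_le_norm[OF that, of "X N" x] by (smt (verit) order.refl)
  qed
  then have "ent (Kern l) = l" by (intro Kern_inverse) blast
  then have eK: "ent (Kern l) x y = l x y" for x y by simp
  have "X \<longlonglongrightarrow> Kern l"
  proof (rule LIMSEQ_I)
    fix r :: real assume "r > 0"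
    then obtain N where N: "\<And>m n. m \<ge> N \<Longrightarrow> n \<ge> N \<Longrightarrow> norm (X m - X n) < r / 2"
      using CauchyD[OF X, of "r / 2"] by auto
    have "norm (X n - Kern l) < r" if "n \<ge> N" for n
    proof -
      have "norm (Kern l - X n) \<le> r / 2"
      proof (rule norm_kern_le)
        fix x
        show "(\<Sum>\<^sub>\<infinity>y. \<bar>ent (Kern l - X n) x y\<bar>) \<le> r / 2"
          by (rule summable_on_realI(3))
             (use fin[of _ N n "r/2" x] N that in \<open>auto simp: eK less_imp_le\<close>)
      qed
      then show ?thesis using \<open>r > 0\<close> by (simp add: norm_minus_commute)
    qed
    then show "\<exists>no. \<forall>n\<ge>no. norm (X n - Kern l) < r" by blast
  qed
  then show "convergent X" by (rule convergentI)
qed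

section \<open>Differentiating the exponential semigroup\<close>

lemma has_real_derivative_kapp_exp:
  assumes "bfun g"
  shows "((\<lambda>t. kapp (exp (t *\<^sub>R Q)) g x) has_real_derivative kapp (exp (t *\<^sub>R Q) * Q) g x) (at t within T)"
  unfolding has_real_derivative_iff_has_vector_derivative
  by (rule bounded_linear.has_vector_derivative[OF bounded_linear_kapp[OF assms] exp_scaleR_has_vector_derivative_right])

lemma has_real_derivative_ent_exp:
  "((\<lambda>t. ent (exp (t *\<^sub>R Q)) x y) has_real_derivative ent (exp (t *\<^sub>R Q) * Q) x y) (at t within T)"
  unfolding has_real_derivative_iff_has_vector_derivative
  by (rule bounded_linear.has_vector_derivative[OF bounded_linear_ent exp_scaleR_has_vector_derivative_right])

lemma exp_scaleR_commute: "exp (t *\<^sub>R Q) * Q = Q * exp (t *\<^sub>R (Q :: 'a kern))"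
proof (cases "t = 0")
  case False
  then show ?thesis using exp_times_arg_commute[of "t *\<^sub>R Q"] by simp
qed simp

lemma exp_scaleR_add: "exp ((s + t) *\<^sub>R Q) = exp (s *\<^sub>R Q) * exp (t *\<^sub>R (Q :: 'a kern))"
  by (simp add: scaleR_add_left exp_add_commuting)

section \<open>Symmetric Markov semigroups with bounded rates\<close>

lemma ent_exp_sums:
  "(\<lambda>n. t ^ n / fact n * ent (Q ^ n) x y) sums ent (exp (t *\<^sub>R (Q :: 'a kern))) x y"
proof -
  have "(\<lambda>n. (t *\<^sub>R Q) ^ n /\<^sub>R fact n) sums exp (t *\<^sub>R Q)" by (rule exp_converges)
  from bounded_linear.sums[OF bounded_linear_ent this, of x y] show ?thesis
    by (simp add: scaleR_power field_simps)
qed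

lemma summable_single: "(\<lambda>z. if z = y then 1 else 0 :: real) summable_on UNIV"
proof -
  have "(\<lambda>z. if z = y then 1 else 0 :: real) summable_on UNIV \<longleftrightarrow> (\<lambda>_. 1 :: real) summable_on {y}"
    by (rule summable_on_cong_neutral) auto
  then show ?thesis by simp
qed

lemma ent_power_nonneg:
  assumes "\<And>x y. 0 \<le> ent Q x y"
  shows "0 \<le> ent (Q ^ n) x y"
proof (induction n arbitrary: x y)
  case 0 then show ?case by (simp add: ent_one)
next
  case (Suc n) then show ?case by (auto simp: ent_times assms intro!: infsum_nonneg)
qed

lemma ent_exp_nonneg:
  assumes "\<And>x y. 0 \<le> ent Q x y" "0 \<le> t"
  shows "0 \<le> ent (exp (t *\<^sub>R Q)) x y"
  by (rule sums_le[OF _ sums_zero ent_exp_sums]) (simp add: ent_power_nonneg assms)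

lemma ent_power_sym:
  assumes "\<And>x y. ent Q x y = ent Q y x"
  shows "ent (Q ^ n) x y = ent (Q ^ n) y x"
proof (induction n arbitrary: x y)
  case 0 then show ?case by (auto simp: ent_one)
next
  case (Suc n)
  have "ent (Q ^ n * Q) x y = ent (Q * Q ^ n) y x"
    unfolding ent_times by (rule infsum_cong) (metis Suc assms mult.commute)
  then show ?case by (simp add: power_commutes)
qed

lemma ent_exp_sym:
  assumes "\<And>x y. ent Q x y = ent Q y x"
  shows "ent (exp (t *\<^sub>R Q)) x y = ent (exp (t *\<^sub>R Q)) y x"
  using sums_unique2[OF ent_exp_sums[of t Q x y]] ent_exp_sums[of t Q y x]
  by (simp add: ent_power_sym[OF assms, of _ x y])

text \<open>The time derivative is the exponential applied to \<open>kapp Q g\<close>, which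
  vanishes. For the constant function this is conservation of probability.\<close>

lemma kapp_exp_fixed:
  assumes "\<And>x. kapp Q g x = 0" and g: "bfun g"
  shows "kapp (exp (t *\<^sub>R Q)) g x = g x"
proof -
  have "kapp (exp (t *\<^sub>R Q) * Q) g x = 0" for t
    using assms by (simp add: kapp_times kapp_def[of "exp _"])
  then have "\<forall>t. ((\<lambda>t. kapp (exp (t *\<^sub>R Q)) g x) has_real_derivative 0) (at t)"
    using has_real_derivative_kapp_exp[OF g, of Q x] by simp
  then have "kapp (exp (t *\<^sub>R Q)) g x = kapp (exp (0 *\<^sub>R Q)) g x"
    using DERIV_isconst_all by blast
  also have "\<dots> = g x"
    by (simp add: kapp_def ent_one infsum_single)
  finally show ?thesis .
qed

lemma kapp_nonneg:
  assumes "\<And>y. 0 \<le> ent k x y" "\<And>y. 0 \<le> g y"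
  shows "0 \<le> kapp k g x"
  unfolding kapp_def by (rule infsum_nonneg) (simp add: assms)

lemma kapp_mono:
  assumes "\<And>y. 0 \<le> ent k x y" "bfun g" "bfun h" "\<And>y. g y \<le> h y"
  shows "kapp k g x \<le> kapp k h x"
  unfolding kapp_def
  by (rule infsum_mono) (auto intro!: kapp_summable mult_left_mono assms)

lemma kapp_add: "bfun g \<Longrightarrow> bfun h \<Longrightarrow> kapp k (\<lambda>y. g y + h y) x = kapp k g x + kapp k h x"
  unfolding kapp_def by (simp add: distrib_left infsum_add kapp_summable)

lemma kapp_cmult: "kapp k (\<lambda>y. c * g y) x = c * kapp k g x"
  unfolding kapp_def by (simp add: mult.left_commute infsum_cmult_right')

lemma bfun_add: "bfun g \<Longrightarrow> bfun h \<Longrightarrow> bfun (\<lambda>y. g y + h y)"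
  unfolding bfun_def by (meson abs_triangle_ineq add_mono order_trans)

lemma bfun_cmult: "bfun g \<Longrightarrow> bfun (\<lambda>y. c * g y)"
  unfolding bfun_def by (metis abs_ge_zero abs_mult mult_left_mono)

lemma bfun_const: "bfun (\<lambda>_. c)" unfolding bfun_def by blast

lemma bfun_uminus: "bfun g \<Longrightarrow> bfun (\<lambda>y. - g y)"
  using bfun_cmult[of g "-1"] by simp

lemma bfun_diff: "bfun g \<Longrightarrow> bfun h \<Longrightarrow> bfun (\<lambda>y. g y - h y)"
  using bfun_add[of g "\<lambda>y. - h y"] bfun_uminus[of h] by simp

lemma kapp_one_minus:
  assumes "kapp k (\<lambda>_. 1) x = 1" "bfun g"
  shows "kapp k (\<lambda>y. 1 - g y) x = 1 - kapp k g x"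
  using kapp_add[OF bfun_const[of 1] bfun_uminus[OF assms(2)], of k x] kapp_cmult[of k "-1" g x] assms(1)
  by simp

lemma summable_bfun: "a summable_on UNIV \<Longrightarrow> bfun (a :: 'a \<Rightarrow> real)"
proof (rule bfunI)
  fix x assume a: "a summable_on UNIV"
  have "(\<Sum>y\<in>{x}. \<bar>a y\<bar>) \<le> (\<Sum>\<^sub>\<infinity>y. \<bar>a y\<bar>)"
    by (rule finite_sum_le_infsum[OF summable_on_abs_real[OF a]]) auto
  then show "\<bar>a x\<bar> \<le> (\<Sum>\<^sub>\<infinity>y. \<bar>a y\<bar>)" by simp
qed

text \<open>Kept apart from the stable-like assumptions because it is instantiated twice: for the
  given rates and, in the coupling, for the rates left after some of the jumps have been split
  off.\<close>

locale conductance =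
  fixes C :: "'a \<Rightarrow> 'a \<Rightarrow> real" and \<Lambda> :: real
  assumes C_nonneg: "0 \<le> C x y"
    and C_sym: "C x y = C y x"
    and C_diag: "C x x = 0"
    and C_bound: "finite F \<Longrightarrow> (\<Sum>y\<in>F. C x y) \<le> \<Lambda>"
begin

definition rate :: "'a \<Rightarrow> real" where "rate x = (\<Sum>\<^sub>\<infinity>y. C x y)"
definition gen :: "'a kern" where "gen = Kern (\<lambda>x y. if x = y then - rate x else C x y)"
definition P :: "real \<Rightarrow> 'a kern" where "P t = exp (t *\<^sub>R gen)"

lemma C_abs_bound: "finite F \<Longrightarrow> (\<Sum>y\<in>F. \<bar>C x y\<bar>) \<le> \<Lambda>"
  using C_bound by (simp add: C_nonneg)

lemma C_summable: "C x summable_on UNIV"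
  by (rule summable_on_realI(1)[OF C_abs_bound])

lemma rate_nonneg: "0 \<le> rate x"
  unfolding rate_def by (rule infsum_nonneg) (simp add: C_nonneg)

lemma rate_le: "rate x \<le> \<Lambda>"
proof -
  have "(\<Sum>\<^sub>\<infinity>y. \<bar>C x y\<bar>) \<le> \<Lambda>" by (rule summable_on_realI(3)[OF C_abs_bound])
  then show ?thesis by (simp add: C_nonneg rate_def)
qed

lemma Lam_nonneg: "0 \<le> \<Lambda>"
  using C_bound[of "{}"] by simp

lemma ent_gen: "ent gen x y = (if x = y then - rate x else C x y)"
proof -
  have "(\<Sum>y\<in>F. \<bar>if x = y then - rate x else C x y\<bar>) \<le> \<Lambda> + \<Lambda>" if "finite F" for F x
  proof -
    have "(\<Sum>y\<in>F. \<bar>if x = y then - rate x else C x y\<bar>) \<le> (\<Sum>y\<in>F. (if x = y then rate x else 0) + C x y)"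
      by (rule sum_mono) (auto simp: rate_nonneg C_nonneg)
    also have "\<dots> \<le> \<Lambda> + \<Lambda>"
      unfolding sum.distrib by (rule add_mono[OF _ C_bound[OF that]])
        (use that rate_le[of x] Lam_nonneg in \<open>simp add: sum.delta'\<close>)
    finally show ?thesis .
  qed
  then have "(\<lambda>x y. if x = y then - rate x else C x y) \<in> {k. \<exists>B. \<forall>x F. finite F \<longrightarrow> (\<Sum>y\<in>F. \<bar>k x y\<bar>) \<le> B}"
    by blast
  then show ?thesis by (simp add: gen_def Kern_inverse)
qed

lemma kapp_gen:
  assumes "bfun g"
  shows "kapp gen g x = (\<Sum>\<^sub>\<infinity>y. C x y * (g y - g x))"
    and "(\<lambda>y. C x y * (g y - g x)) summable_on UNIV"
proof -
  have 1: "(\<lambda>y. C x y * g y) summable_on UNIV" by (rule summable_mult_bfun[OF C_summable assms])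
  have 2: "(\<lambda>y. C x y * g x) summable_on UNIV" by (rule summable_on_cmult_left[OF C_summable])
  have 3: "(\<lambda>y. rate x * g x * (if y = x then 1 else 0)) summable_on UNIV"
    by (rule summable_on_cmult_right[OF summable_single])
  show "(\<lambda>y. C x y * (g y - g x)) summable_on UNIV"
    using infsum_diff_real(1)[OF 1 2] by (simp add: right_diff_distrib)
  have "kapp gen g x = (\<Sum>\<^sub>\<infinity>y. C x y * g y - rate x * g x * (if y = x then 1 else 0))"
    unfolding kapp_def by (rule infsum_cong) (auto simp: ent_gen C_diag)
  also have "\<dots> = (\<Sum>\<^sub>\<infinity>y. C x y * g y) - rate x * g x"
    using infsum_diff_real(2)[OF 1 3] by (simp only: infsum_cmult_right') (simp add: infsum_single(1)[of "\<lambda>_. 1", simplified])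
  also have "\<dots> = (\<Sum>\<^sub>\<infinity>y. C x y * (g y - g x))"
    using infsum_diff_real(2)[OF 1 2] by (simp add: right_diff_distrib infsum_cmult_left' rate_def)
  finally show "kapp gen g x = (\<Sum>\<^sub>\<infinity>y. C x y * (g y - g x))" .
qed

lemma gen_sym: "ent gen x y = ent gen y x"
  by (auto simp: ent_gen C_sym)

lemma P_sym: "ent (P t) x y = ent (P t) y x"
  unfolding P_def by (rule ent_exp_sym[OF gen_sym])

lemma P_one: "kapp (P t) (\<lambda>_. 1) x = 1"
  unfolding P_def by (rule kapp_exp_fixed) (simp_all add: kapp_gen bfun_const)

lemma P_add: "P (s + t) = P s * P t" unfolding P_def by (rule exp_scaleR_add)

lemma P_0: "P 0 = 1" by (simp add: P_def)

lemma P_commute: "P t * gen = gen * P t" unfolding P_def by (rule exp_scaleR_commute)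

lemma P_nonneg:
  assumes "0 \<le> t"
  shows "0 \<le> ent (P t) x y"
proof -
  \<comment> \<open>Uniformisation: adding \<open>\<Lambda>\<close> on the diagonal makes all
    entries nonnegative, and the multiple of the unit splits off as a positive scalar factor of the
    exponential.\<close>
  define K where "K = gen + \<Lambda> *\<^sub>R 1"
  have K: "0 \<le> ent K x y" for x y
    using rate_le[of x] by (auto simp: K_def ent_gen ent_one C_nonneg)
  have "t *\<^sub>R gen = t *\<^sub>R K + (- t * \<Lambda>) *\<^sub>R 1" by (simp add: K_def scaleR_right_distrib)
  then have "P t = exp (t *\<^sub>R K) * exp ((- t * \<Lambda>) *\<^sub>R 1)"
    unfolding P_def by (simp only:) (rule exp_add_commuting, simp)
  moreover have "exp ((- t * \<Lambda>) *\<^sub>R (1 :: 'a kern)) = exp (- t * \<Lambda>) *\<^sub>R 1"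
    using exp_of_real[of "- t * \<Lambda>", where ?'a = "'a kern"] by (simp add: of_real_def)
  ultimately have "P t = exp (- t * \<Lambda>) *\<^sub>R exp (t *\<^sub>R K)" by simp
  then show ?thesis using ent_exp_nonneg[OF K assms, of x y] by simp
qed

lemma P_le_1: assumes "0 \<le> t" shows "ent (P t) x y \<le> 1"
proof -
  have "kapp (P t) (\<lambda>z. if z = y then 1 else 0) x \<le> kapp (P t) (\<lambda>_. 1) x"
    by (rule kapp_mono) (auto simp: P_nonneg assms bfun_const bfun_indicator)
  then show ?thesis by (simp add: kapp_indicator P_one)
qed

lemma P_sum: "(\<Sum>\<^sub>\<infinity>y. ent (P t) x y) = 1"
  using P_one[of t x] by (simp add: kapp_def)

lemma DERIV_kapp_P:
  "bfun g \<Longrightarrow> ((\<lambda>t. kapp (P t) g x) has_real_derivative kapp (P t) (kapp gen g) x) (at t within T)"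
  unfolding P_def using has_real_derivative_kapp_exp[of g gen x t T] by (simp add: kapp_times)

lemma P_bounds:
  assumes "0 \<le> t" "\<And>y. 0 \<le> g y" "\<And>y. g y \<le> 1"
  shows "0 \<le> kapp (P t) g x" "kapp (P t) g x \<le> 1"
proof -
  have b: "bfun g" by (rule bfun_unit) (use assms in auto)
  show "0 \<le> kapp (P t) g x" by (rule kapp_nonneg) (auto simp: P_nonneg assms)
  have "kapp (P t) g x \<le> kapp (P t) (\<lambda>_. 1) x"
    by (rule kapp_mono) (auto simp: P_nonneg assms bfun_const b)
  then show "kapp (P t) g x \<le> 1" by (simp add: P_one)
qed

section \<open>Dirichlet form and reduction to the diagonal\<close>

text \<open>Twice the Dirichlet form: the sum runs over ordered pairs, so each bond counts twice.
  This explains the factors 1/2 below.\<close>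

definition energy :: "('a \<Rightarrow> real) \<Rightarrow> ('a \<Rightarrow> real) \<Rightarrow> real"
  where "energy p g = (\<Sum>\<^sub>\<infinity>(z, w). C z w * ((p z - p w) * (g z - g w)))"

text \<open>Summation by parts. The one-sided double sum converges absolutely since \<open>p\<close>
  is summable and \<open>g\<close> bounded; adding its image under exchange of the coordinates,
  equal to it by the symmetry of \<open>C\<close>, produces the energy.\<close>

lemma dirichlet:
  fixes p g :: "'a \<Rightarrow> real"
  assumes p: "p summable_on UNIV" and g: "bfun g"
  shows "(\<lambda>(z, w). C z w * ((p z - p w) * (g z - g w))) summable_on UNIV"
    and "(\<Sum>\<^sub>\<infinity>z. p z * kapp gen g z) = - (1/2) * energy p g"
proof -
  obtain M where M: "M \<ge> 0" "\<And>x. \<bar>g x\<bar> \<le> M" using bfunE[OF g] by blast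
  have s1: "(\<lambda>(z, w). p z * (C z w * (g w - g z))) summable_on UNIV"
  proof (rule summable_pair[OF p])
    fix z and F :: "'a set" assume "finite F"
    have gg: "\<bar>g w - g z\<bar> \<le> 2 * M" for w using M(2)[of w] M(2)[of z] by linarith
    have "(\<Sum>w\<in>F. \<bar>C z w * (g w - g z)\<bar>) \<le> (\<Sum>w\<in>F. C z w * (2 * M))"
      by (rule sum_mono) (simp add: abs_mult C_nonneg gg mult_left_mono)
    also have "\<dots> \<le> \<Lambda> * (2 * M)"
      unfolding sum_distrib_right[symmetric] by (rule mult_right_mono[OF C_bound[OF \<open>finite F\<close>]]) (simp add: M)
    finally show "(\<Sum>w\<in>F. \<bar>C z w * (g w - g z)\<bar>) \<le> \<Lambda> * (2 * M)" .
  qed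
  have bij: "bij_betw prod.swap (UNIV :: ('a \<times> 'a) set) UNIV" by simp
  have eq: "(\<lambda>q. (\<lambda>(z, w). p z * (C z w * (g w - g z))) (prod.swap q)) = (\<lambda>(z, w). p w * (C z w * (g z - g w)))"
    by (auto simp: fun_eq_iff C_sym)
  have s2: "(\<lambda>(z, w). p w * (C z w * (g z - g w))) summable_on UNIV"
    using summable_on_reindex_bij_betw[OF bij, of "\<lambda>(z, w). p z * (C z w * (g w - g z))"] s1 eq by simp
  have i2: "(\<Sum>\<^sub>\<infinity>(z, w). p w * (C z w * (g z - g w))) = (\<Sum>\<^sub>\<infinity>(z, w). p z * (C z w * (g w - g z)))"
    using infsum_reindex_bij_betw[OF bij, of "\<lambda>(z, w). p z * (C z w * (g w - g z))"] eq by simp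
  have eq2: "(\<lambda>(z, w). C z w * ((p z - p w) * (g z - g w))) =
     (\<lambda>q. - 1 * ((\<lambda>(z, w). p z * (C z w * (g w - g z))) q + (\<lambda>(z, w). p w * (C z w * (g z - g w))) q))"
    by (auto simp: fun_eq_iff algebra_simps)
  show "(\<lambda>(z, w). C z w * ((p z - p w) * (g z - g w))) summable_on UNIV"
    unfolding eq2 by (intro summable_on_cmult_right summable_on_add s1 s2)
  have "energy p g = - 1 * ((\<Sum>\<^sub>\<infinity>(z, w). p z * (C z w * (g w - g z))) + (\<Sum>\<^sub>\<infinity>(z, w). p w * (C z w * (g z - g w))))"
    unfolding energy_def eq2 infsum_cmult_right' infsum_add[OF s1 s2] by simp
  also have "\<dots> = - 2 * (\<Sum>\<^sub>\<infinity>(z, w). p z * (C z w * (g w - g z)))" unfolding i2 by simp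
  also have "(\<Sum>\<^sub>\<infinity>(z, w). p z * (C z w * (g w - g z))) = (\<Sum>\<^sub>\<infinity>z. \<Sum>\<^sub>\<infinity>w. p z * (C z w * (g w - g z)))"
    using infsum_Sigma'_banach[of "\<lambda>z w. p z * (C z w * (g w - g z))" UNIV "\<lambda>_. UNIV"] s1 by simp
  also have "\<dots> = (\<Sum>\<^sub>\<infinity>z. p z * kapp gen g z)"
    by (simp add: infsum_cmult_right' kapp_gen[OF g])
  finally show "(\<Sum>\<^sub>\<infinity>z. p z * kapp gen g z) = - (1/2) * energy p g" by simp
qed

lemma energy_nonneg: "0 \<le> energy p p"
  unfolding energy_def by (rule infsum_nonneg) (auto simp: C_nonneg)

lemma ent_P_add: "ent (P (s + t)) x y = (\<Sum>\<^sub>\<infinity>z. ent (P s) x z * ent (P t) y z)"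
  unfolding P_add ent_times by (simp add: P_sym[of t _ y])

text \<open>Splitting time evenly and using symmetry turns the time derivative of the kernel into an
  energy of half-time rows, which has a sign on the diagonal.\<close>

lemma ent_P_gen: "ent (P (2 * t) * gen) x y = - (1/2) * energy (ent (P t) x) (ent (P t) y)"
proof -
  have "P (2 * t) * gen = P t * (gen * P t)"
    using P_add[of t t] P_commute[of t] by (simp add: mult.assoc)
  then have "ent (P (2 * t) * gen) x y = (\<Sum>\<^sub>\<infinity>z. ent (P t) x z * (\<Sum>\<^sub>\<infinity>w. ent gen z w * ent (P t) w y))"
    by (simp add: ent_times)
  also have "\<dots> = (\<Sum>\<^sub>\<infinity>z. ent (P t) x z * kapp gen (ent (P t) y) z)"
    by (simp add: kapp_def P_sym[of t _ y])
  finally show ?thesis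
    using dirichlet(2)[OF ent_summable summable_bfun[OF ent_summable]] by simp
qed

lemma DERIV_ent_P: "((\<lambda>t. ent (P t) x y) has_real_derivative ent (P t * gen) x y) (at t within T)"
  unfolding P_def by (rule has_real_derivative_ent_exp)

lemma DERIV_ent_P_gen: "((\<lambda>t. ent (P t * gen) x y) has_real_derivative ent (P t * gen * gen) x y) (at t within T)"
proof -
  have "((\<lambda>t. P t * gen) has_vector_derivative P t * gen * gen) (at t within T)"
    unfolding P_def by (rule bounded_linear.has_vector_derivative[OF bounded_linear_mult_left exp_scaleR_has_vector_derivative_right])
  from bounded_linear.has_vector_derivative[OF bounded_linear_ent this] show ?thesis
    by (simp add: has_real_derivative_iff_has_vector_derivative)
qed

text \<open>By symmetry the entry is the sum of squares of row \<open>x\<close> of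
  \<open>gen * P (t / 2)\<close>. As a second derivative in time it gives convexity of the return
  probability.\<close>

lemma ent_P_gen_gen_nonneg: "0 \<le> ent (P t * gen * gen) x x"
proof -
  have "P t * gen * gen = (gen * P (t / 2)) * (P (t / 2) * gen)"
    using P_add[of "t/2" "t/2"] P_commute[of "t/2"] by (simp add: mult.assoc) (metis mult.assoc)
  moreover have "ent (gen * P (t / 2)) x z = ent (P (t / 2) * gen) z x" for z
    unfolding ent_times by (rule infsum_cong) (metis P_sym gen_sym mult.commute)
  ultimately show ?thesis
    by (simp add: ent_times[of "gen * P (t / 2)"] infsum_nonneg)
qed

text \<open>The return probability is a convex function of time, which turns a bound on it into a
  bound on its derivative.\<close>

lemma ent_P_gen_diag_bound:
  assumes "0 < t"
  shows "- ent (P t * gen) x x \<le> 2 / t * ent (P (t / 2)) x x"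
proof -
  have mono: "ent (P s * gen) x x \<le> ent (P t * gen) x x" if "s \<le> t" for s t
    by (rule DERIV_nonneg_imp_nondecreasing[OF that]) (use DERIV_ent_P_gen ent_P_gen_gen_nonneg in blast)
  have "\<exists>z>t/2. z < t \<and> ent (P t) x x - ent (P (t/2)) x x = (t - t/2) * ent (P z * gen) x x"
    by (rule MVT2) (use assms DERIV_ent_P in auto)
  then obtain z where z: "z < t" "ent (P t) x x - ent (P (t/2)) x x = t/2 * ent (P z * gen) x x" by auto
  have "ent (P t) x x - ent (P (t/2)) x x \<le> t/2 * ent (P t * gen) x x"
    unfolding z(2) by (rule mult_left_mono[OF mono]) (use z assms in auto)
  moreover have "0 \<le> ent (P t) x x" using P_nonneg assms by simp
  ultimately have "t / 2 * - ent (P t * gen) x x \<le> ent (P (t/2)) x x" by simp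
  then show ?thesis using assms by (simp add: field_simps)
qed

text \<open>Cauchy-Schwarz for the energy in arithmetic-mean form, for both signs and half-time
  rows. It reduces time derivatives off the diagonal to the diagonal.\<close>

lemma ent_P_gen_bound:
  shows "\<bar>ent (P t * gen) x y\<bar> \<le> (- ent (P t * gen) x x - ent (P t * gen) y y) / 2"
proof -
  define p q where "p = ent (P (t/2)) x" and "q = ent (P (t/2)) y"
  have s: "p summable_on UNIV" "q summable_on UNIV" by (simp_all add: p_def q_def ent_summable)
  have pq: "(\<lambda>(z, w). C z w * ((p z - p w) * (q z - q w))) summable_on UNIV"
    "(\<lambda>(z, w). C z w * ((p z - p w) * (p z - p w))) summable_on UNIV"
    "(\<lambda>(z, w). C z w * ((q z - q w) * (q z - q w))) summable_on UNIV"
    using dirichlet(1) s summable_bfun by blast+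
  have "2 * \<bar>energy p q\<bar> \<le> energy p p + energy q q"
  proof -
    have "2 * energy p q = (\<Sum>\<^sub>\<infinity>a. 2 * (\<lambda>(z, w). C z w * ((p z - p w) * (q z - q w))) a)"
      by (simp only: energy_def infsum_cmult_right')
    also have "\<dots> \<le> energy p p + energy q q"
      unfolding energy_def infsum_add[OF pq(2,3), symmetric]
    proof (rule infsum_mono[OF summable_on_cmult_right[OF pq(1)] summable_on_add[OF pq(2,3)]], clarify)
      fix z w
      have "0 \<le> C z w * ((p z - p w) - (q z - q w))\<^sup>2" by (simp add: C_nonneg)
      then show "2 * (C z w * ((p z - p w) * (q z - q w))) \<le> C z w * ((p z - p w) * (p z - p w)) + C z w * ((q z - q w) * (q z - q w))"
        by (simp add: power2_eq_square algebra_simps)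
    qed
    finally have 1: "2 * energy p q \<le> energy p p + energy q q" .
    have "(-2) * energy p q = (\<Sum>\<^sub>\<infinity>a. (-2) * (\<lambda>(z, w). C z w * ((p z - p w) * (q z - q w))) a)"
      by (simp only: energy_def infsum_cmult_right')
    also have "\<dots> \<le> energy p p + energy q q"
      unfolding energy_def infsum_add[OF pq(2,3), symmetric]
    proof (rule infsum_mono[OF summable_on_cmult_right[OF pq(1)] summable_on_add[OF pq(2,3)]], clarify)
      fix z w
      have "0 \<le> C z w * ((p z - p w) + (q z - q w))\<^sup>2" by (simp add: C_nonneg)
      then show "(-2) * (C z w * ((p z - p w) * (q z - q w))) \<le> C z w * ((p z - p w) * (p z - p w)) + C z w * ((q z - q w) * (q z - q w))"
        by (simp add: power2_eq_square algebra_simps)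
    qed
    finally show ?thesis using 1 by linarith
  qed
  then show ?thesis
    using ent_P_gen[of "t/2" x x] ent_P_gen[of "t/2" y y] ent_P_gen[of "t/2" x y] by (simp add: p_def q_def)
qed

text \<open>The same device with the l2 inner product in place of the energy.\<close>

lemma ent_P_le_diag:
  "ent (P t) x y \<le> (ent (P t) x x + ent (P t) y y) / 2"
proof -
  define p q where "p = ent (P (t/2)) x" and "q = ent (P (t/2)) y"
  have s: "p summable_on UNIV" "q summable_on UNIV" by (simp_all add: p_def q_def ent_summable)
  have pq: "(\<lambda>z. p z * q z) summable_on UNIV" "(\<lambda>z. p z * p z) summable_on UNIV" "(\<lambda>z. q z * q z) summable_on UNIV"
    using summable_mult_bfun summable_bfun s by blast+
  have "2 * (\<Sum>\<^sub>\<infinity>z. p z * q z) \<le> (\<Sum>\<^sub>\<infinity>z. p z * p z) + (\<Sum>\<^sub>\<infinity>z. q z * q z)"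
    unfolding infsum_add[OF pq(2,3), symmetric] infsum_cmult_right'[symmetric]
  proof (rule infsum_mono[OF summable_on_cmult_right[OF pq(1)] summable_on_add[OF pq(2,3)]])
    fix z
    have "0 \<le> (p z - q z)\<^sup>2" by simp
    then show "2 * (p z * q z) \<le> p z * p z + q z * q z" by (simp add: power2_eq_square algebra_simps)
  qed
  then show ?thesis
    using ent_P_add[of "t/2" "t/2" x x] ent_P_add[of "t/2" "t/2" y y] ent_P_add[of "t/2" "t/2" x y]
    by (simp add: p_def q_def)
qed

end

text \<open>Duhamel's formula as a derivative. \<open>Q\<close> adds to \<open>Q'\<close> jumps by
  \<open>J\<close> at rate \<open>l\<close>; the function runs from the full semigroup at
  \<open>s = 0\<close> to the one without added jumps, damped by \<open>exp (- l * t)\<close>, at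
  \<open>s = t\<close>. Bounding the derivative replaces integrating over the time of the first
  added jump.\<close>

lemma duhamel_deriv:
  fixes Q Q' J :: "'a kern"
  assumes Q: "Q = Q' + l *\<^sub>R (J - 1)" and g: "bfun g"
  shows "((\<lambda>s. exp (- l * s) * kapp (exp (s *\<^sub>R Q')) (kapp (exp ((t - s) *\<^sub>R Q)) g) x)
     has_real_derivative - l * exp (- l * s) * kapp (exp (s *\<^sub>R Q')) (kapp J (kapp (exp ((t - s) *\<^sub>R Q)) g)) x) (at s within T)"
proof -
  define A where "A = (\<lambda>s. exp (s *\<^sub>R Q'))"
  define B where "B = (\<lambda>s. exp ((t - s) *\<^sub>R Q))"
  have dA: "(A has_vector_derivative A s * Q') (at s within T)"
    unfolding A_def by (rule exp_scaleR_has_vector_derivative_right)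
  have "((\<lambda>u. exp (u *\<^sub>R Q)) \<circ> (\<lambda>s. t - s) has_vector_derivative (- 1) *\<^sub>R (exp ((t - s) *\<^sub>R Q) * Q)) (at s within T)"
    by (rule vector_diff_chain_within) (auto intro!: derivative_eq_intros exp_scaleR_has_vector_derivative_right)
  then have dB: "(B has_vector_derivative - (Q * B s)) (at s within T)"
    by (simp add: B_def o_def exp_scaleR_commute)
  have "((\<lambda>s. A s * B s) has_vector_derivative A s * - (Q * B s) + A s * Q' * B s) (at s within T)"
    by (rule has_vector_derivative_mult[OF dA dB])
  also have "A s * - (Q * B s) + A s * Q' * B s = l *\<^sub>R (A s * B s) - l *\<^sub>R (A s * (J * B s))"
    unfolding Q by (simp add: algebra_simps)
  finally have d: "((\<lambda>s. kapp (A s * B s) g x) has_real_derivative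
      kapp (l *\<^sub>R (A s * B s) - l *\<^sub>R (A s * (J * B s))) g x) (at s within T)"
    unfolding has_real_derivative_iff_has_vector_derivative
    by (rule bounded_linear.has_vector_derivative[OF bounded_linear_kapp[OF g]])
  have e: "kapp (l *\<^sub>R (A s * B s) - l *\<^sub>R (A s * (J * B s))) g x
     = - l * kapp (A s * (J * B s)) g x + l * kapp (A s * B s) g x"
    by (simp add: diff_conv_add_uminus kapp_plus[OF g] kapp_scaleR scaleR_minus_left[symmetric] del: scaleR_minus_left add_uminus_conv_diff)
  have "((\<lambda>s. exp (- l * s) * kapp (A s * B s) g x) has_real_derivative
     - l * exp (- l * s) * kapp (A s * (J * B s)) g x) (at s within T)"
    by (rule derivative_eq_intros d refl | simp)+ (simp add: e algebra_simps)
  moreover have "kapp (J * B s) g = kapp J (kapp (B s) g)"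
    by (rule ext) (rule kapp_times[OF g])
  ultimately show ?thesis
    by (simp add: A_def B_def kapp_times g bfun_kapp)
qed

section \<open>Counting lattice points\<close>

lemma rvec_diff: "rvec (x - y) = rvec x - rvec y"
  by (simp add: rvec_def vec_eq_iff)

lemma ldist_eq: "ldist x y = norm (rvec (x - y))"
  by (simp add: ldist_def rvec_diff)

lemma ldist_commute: "ldist x y = ldist y x"
  by (simp add: ldist_def norm_minus_commute)

lemma ldist_nonneg [simp]: "0 \<le> ldist x y" by (simp add: ldist_def)

lemma ldist_self [simp]: "ldist x x = 0" by (simp add: ldist_def)

lemma ldist_triangle: "ldist x z \<le> ldist x y + ldist y z"
  unfolding ldist_def using norm_triangle_ineq[of "rvec x - rvec y" "rvec y - rvec z"] by simp

lemma norm_rvec_ge_1: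
  assumes "z \<noteq> 0"
  shows "1 \<le> norm (rvec z)"
proof -
  obtain i where "z $ i \<noteq> 0" using assms by (auto simp: vec_eq_iff)
  then have "1 \<le> \<bar>rvec z $ i\<bar>" by (simp add: rvec_def)
  also have "\<dots> \<le> norm (rvec z)" by (rule component_le_norm_cart)
  finally show ?thesis .
qed

lemma ldist_ge_1: "x \<noteq> y \<Longrightarrow> 1 \<le> ldist x y"
  unfolding ldist_eq by (rule norm_rvec_ge_1) simp

text \<open>The \<open>itself\<close> argument carries the dimension, which the result type does not
  show. The strict inequality matches the balls of (A4).\<close>

definition lvol :: "'d::finite itself \<Rightarrow> real \<Rightarrow> real"
  where "lvol _ R = real (card {z :: int^'d. norm (rvec z) < R})"

lemma card_int_box:
  fixes S :: "int set"
  assumes "finite S"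
  shows "finite {z :: int^'d. \<forall>i. z $ i \<in> S}" "card {z :: int^'d. \<forall>i. z $ i \<in> S} = card S ^ CARD('d)"
proof -
  have eq: "{z :: int^'d. \<forall>i. z $ i \<in> S} = vec_lambda ` (PiE UNIV (\<lambda>_. S))"
  proof (rule set_eqI)
    fix z :: "int^'d"
    show "z \<in> {z. \<forall>i. z $ i \<in> S} \<longleftrightarrow> z \<in> vec_lambda ` (PiE UNIV (\<lambda>_. S))"
      by (auto simp: PiE_def image_iff intro!: bexI[of _ "vec_nth z"])
  qed
  have inj: "inj_on vec_lambda (PiE UNIV (\<lambda>_::'d. S))"
    by (rule inj_onI) (metis vec_lambda_inverse UNIV_I)
  show "finite {z :: int^'d. \<forall>i. z $ i \<in> S}"
    unfolding eq by (rule finite_imageI[OF finite_PiE]) (use assms in auto)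
  show "card {z :: int^'d. \<forall>i. z $ i \<in> S} = card S ^ CARD('d)"
    unfolding eq by (simp add: card_image[OF inj] card_PiE)
qed

lemma finite_ball0: "finite {z :: int^'d. norm (rvec z) < R}"
  and lvol_le: "0 \<le> R \<Longrightarrow> lvol TYPE('d) R \<le> (2 * R + 1) ^ CARD('d)"
proof -
  let ?S = "{- \<lfloor>R\<rfloor>..\<lfloor>R\<rfloor>}"
  have sub: "{z :: int^'d. norm (rvec z) < R} \<subseteq> {z. \<forall>i. z $ i \<in> ?S}"
  proof clarify
    fix z :: "int^'d" and i assume z: "norm (rvec z) < R"
    have "\<bar>rvec z $ i\<bar> < R" using component_le_norm_cart[of "rvec z" i] z by linarith
    then show "z $ i \<in> ?S" by (simp add: rvec_def) linarith
  qed
  note box = card_int_box[of ?S, where ?'d = 'd]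
  show "finite {z :: int^'d. norm (rvec z) < R}"
    by (rule finite_subset[OF sub]) (use box in simp)
  assume R: "0 \<le> R"
  have "lvol TYPE('d) R \<le> real (card ?S ^ CARD('d))"
    unfolding lvol_def using card_mono[OF _ sub] box by simp
  also have "\<dots> \<le> (2 * R + 1) ^ CARD('d)"
  proof -
    have "real (card ?S) \<le> 2 * R + 1" using R by simp
    then show ?thesis by (simp only: of_nat_power) (rule power_mono, simp_all)
  qed
  finally show "lvol TYPE('d) R \<le> (2 * R + 1) ^ CARD('d)" .
qed

lemma ball_eq: "{y. ldist x y < R} = (\<lambda>z. x - z) ` {z :: int^'d. norm (rvec z) < R}"
proof (rule set_eqI)
  fix y
  show "y \<in> {y. ldist x y < R} \<longleftrightarrow> y \<in> (\<lambda>z. x - z) ` {z. norm (rvec z) < R}"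
    by (auto simp: ldist_eq image_iff intro!: exI[of _ "x - y"])
qed

lemma finite_ball: "finite {y :: int^'d. ldist x y < R}"
  unfolding ball_eq by (rule finite_imageI[OF finite_ball0])

lemma card_ball: "real (card {y :: int^'d. ldist x y < R}) = lvol TYPE('d) R"
  unfolding ball_eq lvol_def by (subst card_image) (auto intro!: inj_onI)

lemma lvol_ge:
  assumes "0 < R"
  shows "(R / CARD('d)) ^ CARD('d) \<le> lvol TYPE('d::finite) R"
proof -
  \<comment> \<open>The cube of side \<open>R / d\<close> at the origin lies in the ball because the
    Euclidean norm is at most the l1 norm.\<close>
  define r where "r = R / CARD('d)"
  have r: "r > 0" using assms by (simp add: r_def)
  let ?S = "{0..<\<lceil>r\<rceil>}"
  have sub: "{z. \<forall>i. z $ i \<in> ?S} \<subseteq> {z :: int^'d. norm (rvec z) < R}"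
  proof clarify
    fix z :: "int^'d" assume z: "\<forall>i. z $ i \<in> ?S"
    have "norm (rvec z) \<le> (\<Sum>i\<in>UNIV. \<bar>rvec z $ i\<bar>)" by (rule norm_le_l1_cart)
    also have "\<dots> < (\<Sum>i\<in>(UNIV :: 'd set). r)"
    proof (rule sum_strict_mono)
      fix i :: 'd
      have "0 \<le> z $ i" "z $ i < \<lceil>r\<rceil>" using z by auto
      then show "\<bar>rvec z $ i\<bar> < r" by (simp add: rvec_def) linarith
    qed auto
    also have "\<dots> = R" by (simp add: r_def)
    finally show "norm (rvec z) < R" .
  qed
  note box = card_int_box[of ?S, where ?'d = 'd]
  have "r ^ CARD('d) \<le> real (card ?S ^ CARD('d))"
  proof -
    have "r \<le> real (card ?S)" using r by simp
    then show ?thesis using r by (simp only: of_nat_power) (rule power_mono, simp_all)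
  qed
  also have "\<dots> \<le> lvol TYPE('d) R"
    unfolding lvol_def using card_mono[OF finite_ball0 sub] box by simp
  finally show ?thesis by (simp add: r_def)
qed

lemma lvol_le_powr:
  assumes "1 \<le> R"
  shows "lvol TYPE('d::finite) R \<le> 3 ^ CARD('d) * R powr real CARD('d)"
proof -
  have "lvol TYPE('d) R \<le> (2 * R + 1) ^ CARD('d)" by (rule lvol_le) (use assms in simp)
  also have "\<dots> \<le> (3 * R) ^ CARD('d)" by (rule power_mono) (use assms in auto)
  finally show ?thesis using assms by (simp add: power_mult_distrib powr_realpow)
qed

lemma lvol_ge_powr:
  assumes "0 < R"
  shows "R powr real CARD('d) / real CARD('d) ^ CARD('d) \<le> lvol TYPE('d::finite) R"
  using lvol_ge[OF assms, where ?'d = 'd] assms by (simp add: power_divide powr_realpow)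

lemma lvol_pos: "0 < R \<Longrightarrow> 0 < lvol TYPE('d::finite) R"
  by (rule less_le_trans[OF _ lvol_ge_powr]) auto

section \<open>Dyadic sums of powers of the distance\<close>

text \<open>Each term is at most its value at the inner radius and the shell lies in a ball of
  radius \<open>2 * R\<close>; all powers of \<open>R\<close> except R^(-\<sigma>) cancel, and 3^d
  2^d = 6^d.\<close>

lemma shell_sum:
  assumes "0 < \<sigma>" "1 \<le> R" "finite F"
    and F: "\<And>z :: int^'d. z \<in> F \<Longrightarrow> R \<le> norm (rvec z) \<and> norm (rvec z) < 2 * R"
  shows "(\<Sum>z\<in>F. norm (rvec z) powr (- (real CARD('d) + \<sigma>))) \<le> 6 ^ CARD('d) * R powr (- \<sigma>)"
proof -
  have "(\<Sum>z\<in>F. norm (rvec z) powr (- (real CARD('d) + \<sigma>))) \<le> (\<Sum>z\<in>F. R powr (- (real CARD('d) + \<sigma>)))"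
    by (rule sum_mono) (rule powr_mono2', use assms in auto)
  also have "\<dots> = card F * R powr (- (real CARD('d) + \<sigma>))" by simp
  also have "\<dots> \<le> (3 ^ CARD('d) * (2 * R) powr real CARD('d)) * R powr (- (real CARD('d) + \<sigma>))"
  proof (rule mult_right_mono)
    have "card F \<le> lvol TYPE('d) (2 * R)"
      unfolding lvol_def using F by (auto intro!: card_mono finite_ball0)
    also have "\<dots> \<le> 3 ^ CARD('d) * (2 * R) powr real CARD('d)" by (rule lvol_le_powr) (use assms in simp)
    finally show "card F \<le> 3 ^ CARD('d) * (2 * R) powr real CARD('d)" .
  qed simp
  also have "\<dots> = 3 ^ CARD('d) * 2 ^ CARD('d) * R powr (real CARD('d) + - (real CARD('d) + \<sigma>))"
    using assms by (simp only: powr_add) (simp add: powr_mult powr_realpow)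
  also have "\<dots> = 6 ^ CARD('d) * R powr (- \<sigma>)" by (simp flip: power_mult_distrib)
  finally show ?thesis .
qed

text \<open>A geometric series over dyadic shells, summed by induction on their number; hence the
  outer radius 2^N R. The constant c = 6^d / (1 - 2^(-\<sigma>)) is the fixed point of c = c
  2^(-\<sigma>) + 6^d.\<close>

lemma tail_sum_aux:
  assumes \<sigma>: "0 < \<sigma>" and F: "finite F" "\<And>z :: int^'d. z \<in> F \<Longrightarrow> norm (rvec z) < 2 ^ N * R" and R: "1 \<le> R"
  shows "(\<Sum>z | z \<in> F \<and> R \<le> norm (rvec z). norm (rvec z) powr (- (real CARD('d) + \<sigma>)))
    \<le> 6 ^ CARD('d) / (1 - 2 powr (- \<sigma>)) * R powr (- \<sigma>)"
  using F R
proof (induction N arbitrary: F R)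
  case 0
  have e: "{z \<in> F. R \<le> norm (rvec z)} = {}" using 0(2) by fastforce
  have "2 powr (- \<sigma>) < 2 powr 0" by (rule powr_less_mono) (use \<sigma> in auto)
  then have "0 < 1 - 2 powr (- \<sigma>)" by simp
  then show ?case unfolding e by simp
next
  case (Suc N)
  have "2 powr (- \<sigma>) < 2 powr 0" by (rule powr_less_mono) (use \<sigma> in auto)
  then have p: "0 < 1 - 2 powr (- \<sigma>)" by simp
  have eq: "{z \<in> F. R \<le> norm (rvec z)} = {z \<in> F. 2 * R \<le> norm (rvec z)} \<union> {z \<in> F. R \<le> norm (rvec z) \<and> norm (rvec z) < 2 * R}"
    using Suc.prems(3) by auto
  have "(\<Sum>z | z \<in> F \<and> R \<le> norm (rvec z). norm (rvec z) powr (- (real CARD('d) + \<sigma>)))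
     = (\<Sum>z | z \<in> F \<and> 2 * R \<le> norm (rvec z). norm (rvec z) powr (- (real CARD('d) + \<sigma>)))
      + (\<Sum>z | z \<in> F \<and> R \<le> norm (rvec z) \<and> norm (rvec z) < 2 * R. norm (rvec z) powr (- (real CARD('d) + \<sigma>)))"
    unfolding eq by (rule sum.union_disjoint) (use Suc.prems(1) in auto)
  also have "\<dots> \<le> 6 ^ CARD('d) / (1 - 2 powr (- \<sigma>)) * (2 * R) powr (- \<sigma>) + 6 ^ CARD('d) * R powr (- \<sigma>)"
  proof (rule add_mono)
    show "(\<Sum>z | z \<in> F \<and> 2 * R \<le> norm (rvec z). norm (rvec z) powr (- (real CARD('d) + \<sigma>)))
       \<le> 6 ^ CARD('d) / (1 - 2 powr (- \<sigma>)) * (2 * R) powr (- \<sigma>)"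
      by (rule Suc.IH) (use Suc.prems in \<open>auto simp: mult_ac\<close>)
    show "(\<Sum>z | z \<in> F \<and> R \<le> norm (rvec z) \<and> norm (rvec z) < 2 * R. norm (rvec z) powr (- (real CARD('d) + \<sigma>)))
       \<le> 6 ^ CARD('d) * R powr (- \<sigma>)"
      by (rule shell_sum[OF \<sigma> Suc.prems(3)]) (use Suc.prems(1) in auto)
  qed
  also have "\<dots> = 6 ^ CARD('d) / (1 - 2 powr (- \<sigma>)) * R powr (- \<sigma>)"
  proof -
    have "(2 * R) powr (- \<sigma>) = R powr (- \<sigma>) * 2 powr (- \<sigma>)"
      using Suc.prems(3) by (simp add: powr_mult)
    then show ?thesis using p \<sigma> by (simp add: divide_simps) (simp add: algebra_simps)
  qed
  finally show ?case .
qed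

text \<open>The same recursion inwards. It stops because a nonzero lattice point has norm at least
  1, so no shell is left once \<open>R \<le> 1\<close>. It is used with \<sigma> = 2 - \<alpha>, for
  the truncated second moment of the jumps.\<close>

lemma inner_sum_aux:
  assumes \<sigma>: "0 < \<sigma>" and F: "finite F" "\<And>z :: int^'d. z \<in> F \<Longrightarrow> z \<noteq> 0 \<and> norm (rvec z) < R" and R: "0 < R" "R \<le> 2 ^ N"
  shows "(\<Sum>z\<in>F. norm (rvec z) powr (\<sigma> - real CARD('d))) \<le> 6 ^ CARD('d) / (1 - 2 powr (- \<sigma>)) * R powr \<sigma>"
  using F R
proof (induction N arbitrary: F R)
  case 0
  then have e: "F = {}" using norm_rvec_ge_1 by fastforce
  have "2 powr (- \<sigma>) < 2 powr 0" by (rule powr_less_mono) (use \<sigma> in auto)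
  then have "0 < 1 - 2 powr (- \<sigma>)" by simp
  then show ?case unfolding e by simp
next
  case (Suc N)
  have "2 powr (- \<sigma>) < 2 powr 0" by (rule powr_less_mono) (use \<sigma> in auto)
  then have p: "0 < 1 - 2 powr (- \<sigma>)" by simp
  show ?case
  proof (cases "R \<le> 1")
    case True
    then have e: "F = {}" using norm_rvec_ge_1 Suc.prems(2) by fastforce
    show ?thesis unfolding e using p by simp
  next
    case False
    have eq: "F = {z \<in> F. norm (rvec z) < R/2} \<union> {z \<in> F. R/2 \<le> norm (rvec z)}" by auto
    have "(\<Sum>z\<in>F. norm (rvec z) powr (\<sigma> - real CARD('d)))
       = (\<Sum>z | z \<in> F \<and> norm (rvec z) < R/2. norm (rvec z) powr (\<sigma> - real CARD('d)))
         + (\<Sum>z | z \<in> F \<and> R/2 \<le> norm (rvec z). norm (rvec z) powr (\<sigma> - real CARD('d)))"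
      by (subst eq, rule sum.union_disjoint) (use Suc.prems(1) in auto)
    also have "\<dots> \<le> 6 ^ CARD('d) / (1 - 2 powr (- \<sigma>)) * (R/2) powr \<sigma> + 6 ^ CARD('d) * R powr \<sigma>"
    proof (rule add_mono)
      show "(\<Sum>z | z \<in> F \<and> norm (rvec z) < R/2. norm (rvec z) powr (\<sigma> - real CARD('d)))
         \<le> 6 ^ CARD('d) / (1 - 2 powr (- \<sigma>)) * (R/2) powr \<sigma>"
        by (rule Suc.IH) (use Suc.prems in auto)
      have "(\<Sum>z | z \<in> F \<and> R/2 \<le> norm (rvec z). norm (rvec z) powr (\<sigma> - real CARD('d)))
        \<le> (\<Sum>z | z \<in> F \<and> R/2 \<le> norm (rvec z). R powr \<sigma> * (R/2) powr (- real CARD('d)))"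
      proof (rule sum_mono, clarify)
        fix z assume z: "z \<in> F" "R/2 \<le> norm (rvec z)"
        have "norm (rvec z) powr (\<sigma> - real CARD('d)) = norm (rvec z) powr \<sigma> * norm (rvec z) powr (- real CARD('d))"
          by (simp flip: powr_add)
        also have "\<dots> \<le> R powr \<sigma> * (R/2) powr (- real CARD('d))"
          using z Suc.prems(2)[OF z(1)] Suc.prems(3) \<sigma>
          by (intro mult_mono powr_mono2 powr_mono2') auto
        finally show "norm (rvec z) powr (\<sigma> - real CARD('d)) \<le> R powr \<sigma> * (R/2) powr (- real CARD('d))" .
      qed
      also have "\<dots> = card {z \<in> F. R/2 \<le> norm (rvec z)} * (R powr \<sigma> * (R/2) powr (- real CARD('d)))" by simp
      also have "\<dots> \<le> (3 ^ CARD('d) * R powr real CARD('d)) * (R powr \<sigma> * (R/2) powr (- real CARD('d)))"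
      proof (rule mult_right_mono)
        have "card {z \<in> F. R/2 \<le> norm (rvec z)} \<le> lvol TYPE('d) R"
          unfolding lvol_def using Suc.prems(2) by (auto intro!: card_mono finite_ball0)
        also have "\<dots> \<le> 3 ^ CARD('d) * R powr real CARD('d)" by (rule lvol_le_powr) (use False in simp)
        finally show "card {z \<in> F. R/2 \<le> norm (rvec z)} \<le> 3 ^ CARD('d) * R powr real CARD('d)" .
      qed simp
      also have "\<dots> = 6 ^ CARD('d) * R powr \<sigma>"
      proof -
        have "(R/2) powr (- real CARD('d)) = 2 ^ CARD('d) / R powr real CARD('d)"
          using Suc.prems(3) by (simp add: powr_divide powr_minus_divide powr_realpow)
        moreover have "(3::real) ^ CARD('d) * 2 ^ CARD('d) = 6 ^ CARD('d)" by (simp flip: power_mult_distrib)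
        ultimately show ?thesis using Suc.prems(3) by simp
      qed
      finally show "(\<Sum>z | z \<in> F \<and> R/2 \<le> norm (rvec z). norm (rvec z) powr (\<sigma> - real CARD('d))) \<le> 6 ^ CARD('d) * R powr \<sigma>" .
    qed
    also have "\<dots> = 6 ^ CARD('d) / (1 - 2 powr (- \<sigma>)) * R powr \<sigma>"
    proof -
      have "(R/2) powr \<sigma> = R powr \<sigma> * 2 powr (- \<sigma>)"
        using Suc.prems(3) by (simp add: powr_divide powr_minus_divide)
      then show ?thesis using p \<sigma> by (simp add: divide_simps) (simp add: algebra_simps)
    qed
    finally show ?thesis .
  qed
qed

definition shell_const :: "'d::finite itself \<Rightarrow> real \<Rightarrow> real"
  where "shell_const _ \<sigma> = 6 ^ CARD('d) / (1 - 2 powr (- \<sigma>))"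

lemma shell_const_pos: assumes "0 < \<sigma>" shows "0 < shell_const TYPE('d::finite) \<sigma>"
proof -
  have "2 powr (- \<sigma>) < 2 powr 0" by (rule powr_less_mono) (use assms in auto)
  then show ?thesis by (simp add: shell_const_def)
qed

lemma sum_translate:
  fixes x :: "int^'d"
  shows "(\<Sum>y\<in>F. f (ldist x y)) = (\<Sum>z\<in>(\<lambda>y. x - y) ` F. f (norm (rvec z)))"
  by (subst sum.reindex) (auto intro!: inj_onI simp: ldist_eq)

lemma tail_sum:
  fixes x :: "int^'d"
  assumes "0 < \<sigma>" "finite F" "1 \<le> R" "\<And>y. y \<in> F \<Longrightarrow> R \<le> ldist x y"
  shows "(\<Sum>y\<in>F. ldist x y powr (- (real CARD('d) + \<sigma>))) \<le> shell_const TYPE('d) \<sigma> * R powr (- \<sigma>)"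
proof -
  let ?G = "(\<lambda>y. x - y) ` F"
  have G: "finite ?G" "\<And>z. z \<in> ?G \<Longrightarrow> R \<le> norm (rvec z)" using assms by (auto simp: ldist_eq)
  obtain N :: nat where N: "(\<Sum>z\<in>?G. norm (rvec z)) + 1 < 2 ^ N" using real_arch_pow[of 2] by auto
  have "norm (rvec z) < 2 ^ N * R" if "z \<in> ?G" for z
  proof -
    have "norm (rvec z) \<le> (\<Sum>z\<in>?G. norm (rvec z))" using G(1) that by (intro member_le_sum) auto
    also have "\<dots> < 2 ^ N" using N by simp
    also have "\<dots> \<le> 2 ^ N * R" using assms(3) by simp
    finally show ?thesis .
  qed
  from tail_sum_aux[OF assms(1) G(1) this assms(3)] have
    "(\<Sum>z | z \<in> ?G \<and> R \<le> norm (rvec z). norm (rvec z) powr (- (real CARD('d) + \<sigma>))) \<le> shell_const TYPE('d) \<sigma> * R powr (- \<sigma>)"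
    by (simp add: shell_const_def)
  moreover have "{z. z \<in> ?G \<and> R \<le> norm (rvec z)} = ?G" using G(2) by blast
  ultimately show ?thesis by (simp only: sum_translate[of "\<lambda>r. r powr (- (real CARD('d) + \<sigma>))"])
qed

lemma inner_sum:
  fixes x :: "int^'d"
  assumes "0 < \<sigma>" "finite F" "0 < R" "\<And>y. y \<in> F \<Longrightarrow> y \<noteq> x \<and> ldist x y < R"
  shows "(\<Sum>y\<in>F. ldist x y powr (\<sigma> - real CARD('d))) \<le> shell_const TYPE('d) \<sigma> * R powr \<sigma>"
proof -
  let ?G = "(\<lambda>y. x - y) ` F"
  have G: "finite ?G" "\<And>z. z \<in> ?G \<Longrightarrow> z \<noteq> 0 \<and> norm (rvec z) < R" using assms(2,4) by (fastforce simp: ldist_eq)+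
  obtain N :: nat where N: "R < 2 ^ N" using real_arch_pow[of 2] by auto
  from inner_sum_aux[OF assms(1) G assms(3), of N] N show ?thesis
    by (simp add: shell_const_def sum_translate[of "\<lambda>r. r powr (\<sigma> - real CARD('d))"])
qed

text \<open>By doubling, the volume cannot jump by the factor 3/2 at each of many
  consecutive scales between \<open>R1\<close> and \<open>2 * R1\<close>.\<close>

lemma good_radius:
  obtains \<delta> where "0 < \<delta>" "\<delta> \<le> 1"
    "\<And>R1. 1 \<le> R1 \<Longrightarrow> \<exists>R. R1 \<le> R \<and> R \<le> 2 * R1 \<and> lvol TYPE('d::finite) ((1 + \<delta>) * R) \<le> 3/2 * lvol TYPE('d) R"
proof -
  \<comment> \<open>Doubling constant: the upper volume bound 3^d (2 R1)^d is \<open>K\<close> times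
    the lower bound (R1 / d)^d.\<close>
  define K where "K = (6 * real CARD('d)) ^ CARD('d)"
  obtain N0 :: nat where N0: "K < (3/2) ^ N0" using real_arch_pow[of "3/2"] by auto
  define N where "N = Suc N0"
  have N: "K < (3/2) ^ N" by (rule less_le_trans[OF N0]) (simp add: N_def)
  \<comment> \<open>\<open>N\<close> steps of ratio \<open>q\<close> lead from \<open>R1\<close> to
    \<open>2 * R1\<close>. Growth by more than 3/2 at each of them would exceed \<open>K\<close> in
    total.\<close>
  define q where "q = 2 powr (1 / real N)"
  have q1: "1 < q" unfolding q_def by (simp add: N_def)
  have "q ^ N = q powr real N" using q1 by (simp add: powr_realpow)
  also have "\<dots> = 2" unfolding q_def by (simp only: powr_powr) (simp add: N_def)
  finally have qN: "q ^ N = 2" .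
  have q2: "q \<le> 2" using self_le_power[of q N] q1 unfolding qN by (simp add: N_def)
  show ?thesis
  proof (rule that[of "q - 1"])
    fix R1 :: real assume R1: "1 \<le> R1"
    show "\<exists>R. R1 \<le> R \<and> R \<le> 2 * R1 \<and> lvol TYPE('d) ((1 + (q - 1)) * R) \<le> 3/2 * lvol TYPE('d) R"
    proof (rule ccontr)
      assume neg: "\<not> ?thesis"
      have step: "3/2 * lvol TYPE('d) (q ^ j * R1) < lvol TYPE('d) (q ^ Suc j * R1)" if "j < N" for j
      proof -
        have "q ^ j \<le> 2" using power_increasing[of j N q] that q1 qN by simp
        moreover have "1 \<le> q ^ j" using q1 by simp
        ultimately have "R1 \<le> q ^ j * R1" "q ^ j * R1 \<le> 2 * R1" using R1 by (auto simp: mult_right_mono)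
        with neg have "\<not> lvol TYPE('d) (q * (q ^ j * R1)) \<le> 3/2 * lvol TYPE('d) (q ^ j * R1)" by auto
        then show ?thesis by (simp add: mult.assoc)
      qed
      have grow: "j \<le> N \<Longrightarrow> (3/2) ^ j * lvol TYPE('d) R1 \<le> lvol TYPE('d) (q ^ j * R1)" for j
      proof (induction j)
        case (Suc j)
        then have "3/2 * ((3/2) ^ j * lvol TYPE('d) R1) \<le> 3/2 * lvol TYPE('d) (q ^ j * R1)"
          by (intro mult_left_mono) (auto simp: mult_ac)
        also have "\<dots> \<le> lvol TYPE('d) (q ^ Suc j * R1)" using step[of j] Suc by simp
        finally show ?case by simp
      qed simp
      have l: "0 < lvol TYPE('d) R1" by (rule lvol_pos) (use R1 in simp)
      have "(3/2) ^ N * lvol TYPE('d) R1 \<le> lvol TYPE('d) (2 * R1)" using grow[of N] qN by simp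
      also have "\<dots> \<le> 3 ^ CARD('d) * (2 * R1) powr real CARD('d)" by (rule lvol_le_powr) (use R1 in simp)
      also have "\<dots> = K * (R1 powr real CARD('d) / real CARD('d) ^ CARD('d))"
      proof -
        have "(6::real) ^ CARD('d) = 3 ^ CARD('d) * 2 ^ CARD('d)" by (simp flip: power_mult_distrib)
        then show ?thesis using R1 by (simp add: K_def powr_mult powr_realpow power_mult_distrib)
      qed
      also have "\<dots> \<le> K * lvol TYPE('d) R1"
        by (rule mult_left_mono[OF lvol_ge_powr]) (use R1 in \<open>auto simp: K_def\<close>)
      also have "\<dots> < (3/2) ^ N * lvol TYPE('d) R1" using N l by simp
      finally show False by simp
    qed
  qed (use q1 q2 in auto)
qed

section \<open>On-diagonal upper bound and time regularity\<close>

text \<open>The paths of (A3) are parameters, so that sums over their edges can be formed.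
  Finiteness of the multiplicity set is stated besides its \<open>card\<close>, which is 0 for
  infinite sets. The last assumption names \<open>y \<noteq> x\<close> because
  \<open>0 powr _\<close> is 0, so that the rate condition alone would hold at the centre.\<close>

locale stable_rates =
  fixes C :: "int^'d \<Rightarrow> int^'d \<Rightarrow> real"
    and \<alpha> \<kappa>1 \<kappa>2 \<kappa>3 \<Theta>1 :: real and N0 :: nat
    and len :: "int^'d \<Rightarrow> int^'d \<Rightarrow> nat" and path :: "int^'d \<Rightarrow> int^'d \<Rightarrow> nat \<Rightarrow> int^'d"
  assumes alpha: "0 < \<alpha>" "\<alpha> < 2"
    and rates_nonneg: "0 \<le> C x y"
    and rates_sym: "C x y = C y x"
    and rates_diag: "C x x = 0"
    and rates_upper: "x \<noteq> y \<Longrightarrow> C x y \<le> \<kappa>1 * ldist x y powr (- (real CARD('d) + \<alpha>))"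
    and kappa2: "0 < \<kappa>2"
    and len_le: "x \<noteq> y \<Longrightarrow> len x y \<le> N0"
    and path_ends: "x \<noteq> y \<Longrightarrow> path x y 0 = x" "x \<noteq> y \<Longrightarrow> path x y (len x y) = y"
    and path_rates: "x \<noteq> y \<Longrightarrow> i < len x y \<Longrightarrow>
       \<kappa>2 * ldist x y powr (- (real CARD('d) + \<alpha>)) \<le> C (path x y i) (path x y (Suc i))"
    and path_finite: "finite {(x, y). x \<noteq> y \<and> (\<exists>k < len x y. \<zeta> = path x y k \<and> \<xi> = path x y (Suc k))}"
    and path_card: "card {(x, y). x \<noteq> y \<and> (\<exists>k < len x y. \<zeta> = path x y k \<and> \<xi> = path x y (Suc k))} \<le> N0"
    and Theta: "0 < \<Theta>1" and kappa3: "0 < \<kappa>3"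
    and good_card: "\<Theta>1 \<le> r \<Longrightarrow>
       5/6 * real (card {y. ldist x y < r}) \<le>
       real (card {y. ldist x y < r \<and> y \<noteq> x \<and> \<kappa>3 * ldist x y powr (- (real CARD('d) + \<alpha>)) \<le> C x y})"
begin

definition D :: real where "D = real CARD('d)"
definition K1 :: real where "K1 = max \<kappa>1 1"

lemma D_ge_1: "1 \<le> D" by (simp add: D_def Suc_le_eq)

lemma K1_ge_1: "1 \<le> K1" by (simp add: K1_def)

lemma rates_le: "x \<noteq> y \<Longrightarrow> C x y \<le> K1 * ldist x y powr (- (D + \<alpha>))"
  by (rule order_trans[OF rates_upper]) (auto simp: D_def K1_def intro!: mult_right_mono)

text \<open>With \<gamma> = 0 this bounds total rates, with \<gamma> > 0 moments of large jumps;
  \<gamma> < \<alpha> makes the tail converge.\<close>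

lemma rates_tail:
  assumes "finite F" "1 \<le> R" "0 \<le> \<gamma>" "\<gamma> < \<alpha>"
  shows "(\<Sum>y\<in>{y\<in>F. R \<le> ldist x y}. C x y * ldist x y powr \<gamma>) \<le> K1 * shell_const TYPE('d) (\<alpha> - \<gamma>) * R powr (\<gamma> - \<alpha>)"
proof -
  have "(\<Sum>y\<in>{y\<in>F. R \<le> ldist x y}. C x y * ldist x y powr \<gamma>)
      \<le> (\<Sum>y\<in>{y\<in>F. R \<le> ldist x y}. K1 * ldist x y powr (- (real CARD('d) + (\<alpha> - \<gamma>))))"
  proof (rule sum_mono, clarify)
    fix y assume y: "R \<le> ldist x y"
    then have "x \<noteq> y" using assms by auto
    then have "C x y * ldist x y powr \<gamma> \<le> K1 * ldist x y powr (- (D + \<alpha>)) * ldist x y powr \<gamma>"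
      by (intro mult_right_mono rates_le) auto
    also have "\<dots> = K1 * ldist x y powr (- (real CARD('d) + (\<alpha> - \<gamma>)))"
      by (simp add: D_def mult.assoc flip: powr_add) (simp add: algebra_simps)
    finally show "C x y * ldist x y powr \<gamma> \<le> K1 * ldist x y powr (- (real CARD('d) + (\<alpha> - \<gamma>)))" .
  qed
  also have "\<dots> \<le> K1 * (shell_const TYPE('d) (\<alpha> - \<gamma>) * R powr (- (\<alpha> - \<gamma>)))"
    unfolding sum_distrib_left[symmetric]
    by (rule mult_left_mono[OF tail_sum]) (use assms K1_ge_1 in auto)
  finally show ?thesis by (simp add: mult.assoc)
qed

lemma rates_bound:
  assumes "finite F"
  shows "(\<Sum>y\<in>F. C x y) \<le> K1 * shell_const TYPE('d) \<alpha>"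
proof -
  have "(\<Sum>y\<in>F. C x y) = (\<Sum>y\<in>{y\<in>F. 1 \<le> ldist x y}. C x y * ldist x y powr 0)"
    using assms rates_diag ldist_ge_1[of x] by (intro sum.mono_neutral_cong_right) force+
  also have "\<dots> \<le> K1 * shell_const TYPE('d) (\<alpha> - 0) * 1 powr (0 - \<alpha>)"
    by (rule rates_tail) (use assms alpha in auto)
  finally show ?thesis by simp
qed

end

sublocale stable_rates \<subseteq> conductance C "K1 * shell_const TYPE('d) \<alpha>"
  by unfold_locales (use rates_nonneg rates_sym rates_diag rates_bound in auto)

section \<open>Energy comparison and the Nash inequality\<close>

lemma sum_squares_le:
  fixes a :: "'i \<Rightarrow> real"
  assumes "finite A"
  shows "(\<Sum>i\<in>A. a i)\<^sup>2 \<le> real (card A) * (\<Sum>i\<in>A. (a i)\<^sup>2)"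
  using Cauchy_Schwarz_ineq_sum[of "\<lambda>_. 1" a A] by simp

context stable_rates
begin

text \<open>Telescoping along the path of (A3) and Cauchy-Schwarz over its at most \<open>N0\<close>
  edges, each of which carries a rate comparable to the stable one between the end points.\<close>

lemma path_energy:
  assumes "x \<noteq> y"
  shows "\<kappa>2 * ldist x y powr (- (D + \<alpha>)) * (p x - p y)\<^sup>2
    \<le> N0 * (\<Sum>k<len x y. C (path x y k) (path x y (Suc k)) * (p (path x y k) - p (path x y (Suc k)))\<^sup>2)"
proof -
  define l where "l = len x y"
  define z where "z = path x y"
  have "p x - p y = (\<Sum>k<l. p (z k) - p (z (Suc k)))"
    using path_ends[OF assms] sum_lessThan_telescope'[of "\<lambda>k. p (z k)" l] by (simp add: l_def z_def)
  then have "(p x - p y)\<^sup>2 \<le> real l * (\<Sum>k<l. (p (z k) - p (z (Suc k)))\<^sup>2)"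
    using sum_squares_le[of "{..<l}"] by simp
  also have "\<dots> \<le> real N0 * (\<Sum>k<l. (p (z k) - p (z (Suc k)))\<^sup>2)"
    by (rule mult_right_mono) (auto simp: l_def len_le[OF assms] sum_nonneg)
  finally have "\<kappa>2 * ldist x y powr (- (D + \<alpha>)) * (p x - p y)\<^sup>2
     \<le> \<kappa>2 * ldist x y powr (- (D + \<alpha>)) * (real N0 * (\<Sum>k<l. (p (z k) - p (z (Suc k)))\<^sup>2))"
    by (rule mult_left_mono) (use kappa2 in simp)
  also have "\<dots> = real N0 * (\<Sum>k<l. \<kappa>2 * ldist x y powr (- (D + \<alpha>)) * (p (z k) - p (z (Suc k)))\<^sup>2)"
    by (simp add: sum_distrib_left mult_ac)
  also have "\<dots> \<le> real N0 * (\<Sum>k<l. C (z k) (z (Suc k)) * (p (z k) - p (z (Suc k)))\<^sup>2)"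
    using path_rates[OF assms]
    by (intro mult_left_mono sum_mono mult_right_mono) (auto simp: l_def z_def D_def)
  finally show ?thesis by (simp add: l_def z_def)
qed

text \<open>The three factors \<open>N0\<close> are Cauchy-Schwarz along a path, the number of
  positions at which one path can use a given edge, and the number of pairs whose paths use
  it.\<close>

lemma stable_energy_le:
  assumes p: "p summable_on UNIV" and S: "finite S" "\<And>x y. (x, y) \<in> S \<Longrightarrow> x \<noteq> y"
  shows "(\<Sum>(x, y)\<in>S. (p x - p y)\<^sup>2 * ldist x y powr (- (D + \<alpha>))) \<le> N0 ^ 3 / \<kappa>2 * energy p p"
proof -
  define h where "h = (\<lambda>e. C (fst e) (snd e) * (p (fst e) - p (snd e))\<^sup>2)"
  have h0: "0 \<le> h e" for e by (simp add: h_def C_nonneg)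
  define ln where "ln = (\<lambda>s. len (fst s) (snd s))"
  define ed where "ed = (\<lambda>s k. (path (fst s) (snd s) k, path (fst s) (snd s) (Suc k)))"
  define E where "E = (\<Union>s\<in>S. ed s ` {..<ln s})"
  have E: "finite E" using S by (simp add: E_def)
  have ln: "ln s \<le> N0" if "s \<in> S" for s using len_le S(2)[of "fst s" "snd s"] that by (simp add: ln_def)
  \<comment> \<open>Prepares regrouping by edges: an indicator records which edge is traversed at
    position \<open>k\<close>.\<close>
  have "(\<Sum>s\<in>S. \<Sum>k<ln s. h (ed s k)) = (\<Sum>s\<in>S. \<Sum>k<ln s. \<Sum>e\<in>E. if e = ed s k then h e else 0)"
  proof (intro sum.cong refl)
    fix s k assume sk: "s \<in> S" "k \<in> {..<ln s}"
    then have "ed s k \<in> E" by (auto simp: E_def)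
    then show "h (ed s k) = (\<Sum>e\<in>E. if e = ed s k then h e else 0)"
      using E by (simp add: sum.delta)
  qed
  also have "\<dots> = (\<Sum>s\<in>S. \<Sum>e\<in>E. \<Sum>k<ln s. if e = ed s k then h e else 0)"
    by (intro sum.cong refl sum.swap)
  also have "\<dots> = (\<Sum>e\<in>E. \<Sum>s\<in>S. \<Sum>k<ln s. if e = ed s k then h e else 0)"
    by (rule sum.swap)
  also have "\<dots> \<le> (\<Sum>e\<in>E. real N0 * (real N0 * h e))"
  proof (rule sum_mono)
    fix e assume "e \<in> E"
    define S' where "S' = {s\<in>S. \<exists>k<ln s. e = ed s k}"
    have "(\<Sum>s\<in>S. \<Sum>k<ln s. if e = ed s k then h e else 0) = (\<Sum>s\<in>S'. \<Sum>k<ln s. if e = ed s k then h e else 0)"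
      by (rule sum.mono_neutral_right) (use S in \<open>auto simp: S'_def intro!: sum.neutral\<close>)
    also have "\<dots> \<le> (\<Sum>s\<in>S'. \<Sum>k<ln s. h e)"
      by (intro sum_mono) (simp add: h0)
    also have "\<dots> \<le> (\<Sum>s\<in>S'. real N0 * h e)"
    proof (rule sum_mono)
      fix s assume "s \<in> S'"
      then have "real (ln s) \<le> real N0" using ln by (simp add: S'_def)
      then show "(\<Sum>k<ln s. h e) \<le> real N0 * h e" using h0[of e] by (simp add: mult_right_mono)
    qed
    also have "\<dots> = real (card S') * (real N0 * h e)" by simp
    also have "\<dots> \<le> real N0 * (real N0 * h e)"
    proof (rule mult_right_mono)
      have "S' \<subseteq> {(x, y). x \<noteq> y \<and> (\<exists>k < len x y. fst e = path x y k \<and> snd e = path x y (Suc k))}"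
        using S(2) by (force simp: S'_def ln_def ed_def)
      then have "card S' \<le> N0" using card_mono[OF path_finite] path_card order_trans by blast
      then show "real (card S') \<le> real N0" by simp
    qed (use h0 in simp)
    finally show "(\<Sum>s\<in>S. \<Sum>k<ln s. if e = ed s k then h e else 0) \<le> real N0 * (real N0 * h e)" .
  qed
  also have "\<dots> = real N0 * (real N0 * (\<Sum>e\<in>E. h e))" by (simp add: sum_distrib_left)
  also have "\<dots> \<le> real N0 * (real N0 * energy p p)"
  proof (intro mult_left_mono)
    have heq: "h = (\<lambda>(z, w). C z w * ((p z - p w) * (p z - p w)))" by (auto simp: h_def power2_eq_square)
    show "(\<Sum>e\<in>E. h e) \<le> energy p p"
      unfolding energy_def heq
      by (rule finite_sum_le_infsum[OF dirichlet(1)[OF p summable_bfun[OF p]] E]) (auto simp: C_nonneg)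
  qed auto
  finally have le: "(\<Sum>s\<in>S. \<Sum>k<ln s. h (ed s k)) \<le> real N0 * (real N0 * energy p p)" .
  have "\<kappa>2 * (\<Sum>(x, y)\<in>S. (p x - p y)\<^sup>2 * ldist x y powr (- (D + \<alpha>)))
      = (\<Sum>(x, y)\<in>S. \<kappa>2 * ldist x y powr (- (D + \<alpha>)) * (p x - p y)\<^sup>2)"
    by (simp add: sum_distrib_left case_prod_unfold mult_ac)
  also have "\<dots> \<le> (\<Sum>s\<in>S. real N0 * (\<Sum>k<ln s. h (ed s k)))"
  proof (rule sum_mono, clarify)
    fix x y assume "(x, y) \<in> S"
    from path_energy[OF S(2)[OF this], of p]
    show "\<kappa>2 * ldist x y powr (- (D + \<alpha>)) * (p x - p y)\<^sup>2 \<le> real N0 * (\<Sum>k<ln (x, y). h (ed (x, y) k))"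
      by (simp add: ln_def h_def ed_def)
  qed
  also have "\<dots> \<le> real N0 * (real N0 * (real N0 * energy p p))"
    unfolding sum_distrib_left[symmetric] by (rule mult_left_mono[OF le]) simp
  finally show ?thesis using kappa2 by (simp add: field_simps power3_eq_cube)
qed

text \<open>\<open>p\<close> is compared with its averages over balls of radius \<open>R\<close>:
  these are at most \<open>1 / V\<close> because \<open>p\<close> has mass 1, and the deviation is
  an energy of range below \<open>R\<close>. The radius stays free and is chosen as a function of
  time later; \<open>1 \<le> R\<close> is the lattice scale.\<close>

lemma nash:
  obtains cN where "0 < cN"
    "\<And>p R. p summable_on UNIV \<Longrightarrow> (\<And>x. 0 \<le> p x) \<Longrightarrow> (\<Sum>\<^sub>\<infinity>x. p x) = 1 \<Longrightarrow> 1 \<le> R \<Longrightarrow>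
      (\<Sum>\<^sub>\<infinity>x. p x * p x) \<le> cN * (R powr (- D) + R powr \<alpha> * energy p p)"
proof -
  define dd where "dd = real CARD('d) ^ CARD('d)"
  have dd: "dd > 0" by (simp add: dd_def)
  define cE where "cE = N0 ^ 3 / \<kappa>2"
  have cE: "cE \<ge> 0" using kappa2 by (simp add: cE_def)
  define cN where "cN = dd * (2 + cE)"
  show ?thesis
  proof (rule that[of cN])
    show "0 < cN" using dd cE by (simp add: cN_def)
    fix p :: "int^'d \<Rightarrow> real" and R :: real
    assume p: "p summable_on UNIV" "\<And>x. 0 \<le> p x" "(\<Sum>\<^sub>\<infinity>x. p x) = 1" and R: "1 \<le> R"
    define V where "V = lvol TYPE('d) R"
    have V: "0 < V" unfolding V_def by (rule lvol_pos) (use R in simp)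
    have iV: "1 / V \<le> dd * R powr (- D)"
    proof -
      have "R powr D / dd \<le> V" unfolding V_def dd_def D_def by (rule lvol_ge_powr) (use R in simp)
      then have "1 / V \<le> 1 / (R powr D / dd)" using R dd V by (intro divide_left_mono) auto
      then show ?thesis by (simp add: powr_minus_divide)
    qed
    define B where "B = (\<lambda>x. {y :: int^'d. ldist x y < R})"
    have B: "finite (B x)" "real (card (B x)) = V" for x
      by (simp_all add: B_def V_def finite_ball card_ball)
    have sum1: "(\<Sum>y\<in>F. p y) \<le> 1" if "finite F" for F
      using finite_sum_le_infsum[OF p(1) that] p by auto
    have "(\<Sum>x\<in>F. p x * p x) \<le> cN * (R powr (- D) + R powr \<alpha> * energy p p)" if F: "finite F" for F
    proof -
      define a where "a = (\<lambda>x. (\<Sum>y\<in>B x. p y) / V)"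
      have a: "a x \<le> 1 / V" for x
        unfolding a_def using sum1[OF B(1)] V by (intro divide_right_mono) auto
      have pa: "(p x - a x)\<^sup>2 \<le> (\<Sum>y\<in>B x. (p x - p y)\<^sup>2) / V" for x
      proof -
        have "V * (p x - a x) = (\<Sum>y\<in>B x. p x - p y)"
          using V B(2)[of x] by (simp add: a_def sum_subtractf field_simps)
        then have "(V * (p x - a x))\<^sup>2 \<le> V * (\<Sum>y\<in>B x. (p x - p y)\<^sup>2)"
          using sum_squares_le[OF B(1), of "\<lambda>y. p x - p y" x] B(2)[of x] by simp
        then have "V * (V * (p x - a x)\<^sup>2) \<le> V * (\<Sum>y\<in>B x. (p x - p y)\<^sup>2)"
          by (simp add: power2_eq_square mult_ac)
        then show ?thesis using V by (simp add: field_simps)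
      qed
      have "p x * p x \<le> 2 * (1 / V) * p x + (\<Sum>y\<in>B x. (p x - p y)\<^sup>2) / V" for x
      proof -
        have "p x * p x \<le> 2 * a x * p x + (p x - a x)\<^sup>2" by (simp add: power2_eq_square algebra_simps)
        also have "2 * a x * p x \<le> 2 * (1 / V) * p x" using a[of x] p(2)[of x] by (intro mult_right_mono mult_left_mono) auto
        finally show ?thesis using pa[of x] by linarith
      qed
      then have "(\<Sum>x\<in>F. p x * p x) \<le> (\<Sum>x\<in>F. 2 * (1 / V) * p x + (\<Sum>y\<in>B x. (p x - p y)\<^sup>2) / V)"
        by (rule sum_mono)
      also have "\<dots> = 2 * (1 / V) * (\<Sum>x\<in>F. p x) + (1 / V) * (\<Sum>x\<in>F. \<Sum>y\<in>B x. (p x - p y)\<^sup>2)"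
        by (simp add: sum.distrib sum_distrib_left sum_divide_distrib)
      also have "\<dots> \<le> 2 * (1 / V) * 1 + (1 / V) * (R powr (D + \<alpha>) * (cE * energy p p))"
      proof (intro add_mono mult_left_mono sum1[OF F])
        have "(\<Sum>x\<in>F. \<Sum>y\<in>B x. (p x - p y)\<^sup>2) = (\<Sum>x\<in>F. \<Sum>y\<in>B x - {x}. (p x - p y)\<^sup>2)"
          by (intro sum.cong refl sum.mono_neutral_right) (use B in auto)
        also have "\<dots> \<le> (\<Sum>x\<in>F. \<Sum>y\<in>B x - {x}. R powr (D + \<alpha>) * ((p x - p y)\<^sup>2 * ldist x y powr (- (D + \<alpha>))))"
        proof (intro sum_mono)
          fix x y assume xy: "y \<in> B x - {x}"
          have l: "1 \<le> ldist x y" "ldist x y \<le> R" using xy ldist_ge_1[of x y] by (auto simp: B_def)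
          have "1 = ldist x y powr (D + \<alpha>) * ldist x y powr (- (D + \<alpha>))" using l by (simp flip: powr_add)
          also have "\<dots> \<le> R powr (D + \<alpha>) * ldist x y powr (- (D + \<alpha>))"
            using l alpha D_ge_1 by (intro mult_right_mono powr_mono2) auto
          finally have "(p x - p y)\<^sup>2 * 1 \<le> (p x - p y)\<^sup>2 * (R powr (D + \<alpha>) * ldist x y powr (- (D + \<alpha>)))"
            by (rule mult_left_mono) simp
          then show "(p x - p y)\<^sup>2 \<le> R powr (D + \<alpha>) * ((p x - p y)\<^sup>2 * ldist x y powr (- (D + \<alpha>)))"
            by (simp add: mult_ac)
        qed
        also have "\<dots> = R powr (D + \<alpha>) * (\<Sum>(x, y)\<in>Sigma F (\<lambda>x. B x - {x}). (p x - p y)\<^sup>2 * ldist x y powr (- (D + \<alpha>)))"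
          by (subst sum.Sigma[symmetric]) (use F B in \<open>auto simp: sum_distrib_left\<close>)
        also have "\<dots> \<le> R powr (D + \<alpha>) * (cE * energy p p)"
          unfolding cE_def by (rule mult_left_mono[OF stable_energy_le[OF p(1)]]) (use F B in auto)
        finally show "(\<Sum>x\<in>F. \<Sum>y\<in>B x. (p x - p y)\<^sup>2) \<le> R powr (D + \<alpha>) * (cE * energy p p)" .
      qed (use V in auto)
      also have "\<dots> = (1 / V) * (2 + R powr (D + \<alpha>) * (cE * energy p p))" by (simp only: distrib_left)
      also have "\<dots> \<le> (dd * R powr (- D)) * (2 + R powr (D + \<alpha>) * (cE * energy p p))"
        by (rule mult_right_mono[OF iV]) (use cE energy_nonneg[of p] in simp)
      also have "\<dots> = dd * (2 * R powr (- D) + cE * (R powr \<alpha> * energy p p))"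
      proof -
        have "R powr (- D) * R powr (D + \<alpha>) = R powr \<alpha>" by (simp flip: powr_add)
        then show ?thesis by (simp add: algebra_simps)
      qed
      also have "\<dots> \<le> dd * ((2 + cE) * R powr (- D) + (2 + cE) * (R powr \<alpha> * energy p p))"
        using dd cE energy_nonneg[of p] by (intro mult_left_mono add_mono mult_right_mono) auto
      finally show ?thesis by (simp add: cN_def algebra_simps)
    qed
    then show "(\<Sum>\<^sub>\<infinity>x. p x * p x) \<le> cN * (R powr (- D) + R powr \<alpha> * energy p p)"
      by (intro infsum_le_finite_sums summable_mult_bfun[OF p(1) summable_bfun[OF p(1)]]) auto
  qed
qed

text \<open>Nash's inequality for the half-time row, at the radius with R^\<alpha> = a s, is a
  differential inequality for the return probability u(s). With \<theta> = d/\<alpha> it says that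
  s^(1 + \<theta>) u(s) - B s does not increase from time \<open>t1\<close> on; before
  \<open>t1\<close> the bound u \<le> 1 suffices.\<close>

lemma on_diagonal:
  obtains K where "0 < K" "\<And>t x y. 0 < t \<Longrightarrow> ent (P t) x y \<le> K * t powr (- D / \<alpha>)"
proof -
  obtain cN where cN: "0 < cN" and nash: "\<And>p R. p summable_on UNIV \<Longrightarrow> (\<And>x. 0 \<le> p x) \<Longrightarrow> (\<Sum>\<^sub>\<infinity>x. p x) = 1 \<Longrightarrow> 1 \<le> R \<Longrightarrow>
      (\<Sum>\<^sub>\<infinity>x. p x * p x) \<le> cN * (R powr (- D) + R powr \<alpha> * energy p p)"
    using nash by blast
  define \<theta> where "\<theta> = D / \<alpha>"
  have \<theta>: "\<theta> > 0" using D_ge_1 alpha by (simp add: \<theta>_def)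
  \<comment> \<open>Makes \<open>2 * cN * a * (1 + \<theta>) = 1\<close>, so that the term in u of
    Nash's inequality is exactly the one produced by differentiating s^(1 + \<theta>).
    \<open>B\<close> below is then (1 + \<theta>) cN a^(-\<theta>).\<close>
  define a where "a = 1 / (2 * cN * (1 + \<theta>))"
  have a: "a > 0" using cN \<theta> by (simp add: a_def)
  \<comment> \<open>From this time on the radius (a s)^(1/\<alpha>) is at least 1 and hence
    admissible.\<close>
  define t1 where "t1 = 1 / a"
  have t1: "t1 > 0" using a by (simp add: t1_def)
  define B where "B = a powr (- \<theta> - 1) / 2"
  have B: "B > 0" using a by (simp add: B_def)
  define K where "K = B + t1 powr \<theta>"
  have diag: "ent (P t) x x * t powr \<theta> \<le> K" if t: "0 < t" for t x
  proof (cases "t \<le> t1")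
    case True
    have "ent (P t) x x * t powr \<theta> \<le> 1 * t1 powr \<theta>"
      using P_le_1[of t x x] t True \<theta> by (intro mult_mono powr_mono2) auto
    then show ?thesis using B by (simp add: K_def)
  next
    case False
    define W where "W = (\<lambda>s. s powr (1 + \<theta>) * ent (P s) x x - B * s)"
    have "W t \<le> W t1"
    proof (rule DERIV_nonpos_imp_nonincreasing[of t1 t W])
      show "t1 \<le> t" using False by simp
      fix s assume s: "t1 \<le> s" "s \<le> t"
      then have s0: "s > 0" using t1 by simp
      define u u' where "u = ent (P s) x x" and "u' = ent (P s * gen) x x"
      have dW: "(W has_real_derivative (1 + \<theta>) * s powr \<theta> * u + s powr (1 + \<theta>) * u' - B) (at s)"
        unfolding W_def u_def u'_def
        by (rule derivative_eq_intros refl DERIV_ent_P | use s0 in simp)+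
      define R where "R = (a * s) powr (1 / \<alpha>)"
      have as1: "1 \<le> a * s" using s a by (simp add: t1_def field_simps)
      have R: "1 \<le> R" unfolding R_def by (rule ge_one_powr_ge_zero) (use as1 alpha in auto)
      have Ra: "R powr \<alpha> = a * s" "R powr (- D) = (a * s) powr (- \<theta>)"
        using alpha as1 by (auto simp: R_def powr_powr \<theta>_def)
      define p where "p = ent (P (s/2)) x"
      have uu: "u = (\<Sum>\<^sub>\<infinity>z. p z * p z)" using ent_P_add[of "s/2" "s/2" x x] by (simp add: u_def p_def)
      have uu': "u' = - (1/2) * energy p p" using ent_P_gen[of "s/2" x x] by (simp add: u'_def p_def)
      have "u \<le> cN * (R powr (- D) + R powr \<alpha> * energy p p)"
        unfolding uu by (rule nash) (use R s0 in \<open>auto simp: p_def ent_summable P_nonneg P_sum\<close>)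
      then have "u \<le> cN * ((a * s) powr (- \<theta>) + a * s * (-2 * u'))"
        unfolding Ra uu' by simp
      then have "2 * cN * a * (s * u') \<le> cN * (a * s) powr (- \<theta>) - u" by (simp add: algebra_simps)
      then have "s powr \<theta> * (2 * cN * a * (s * u')) \<le> s powr \<theta> * (cN * (a * s) powr (- \<theta>) - u)"
        by (rule mult_left_mono) simp
      also have "\<dots> = cN * a powr (- \<theta>) - s powr \<theta> * u"
        using a s0 by (simp add: powr_mult powr_minus field_simps)
      finally have "2 * cN * a * (s powr (1 + \<theta>) * u') \<le> cN * a powr (- \<theta>) - s powr \<theta> * u"
        using s0 by (simp add: powr_add mult_ac)
      moreover have "2 * cN * a = 1 / (1 + \<theta>)" using cN \<theta> by (simp add: a_def)
      ultimately have "s powr (1 + \<theta>) * u' / (1 + \<theta>) \<le> cN * a powr (- \<theta>) - s powr \<theta> * u"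
        by (simp only:) simp
      then have "s powr (1 + \<theta>) * u' \<le> (1 + \<theta>) * (cN * a powr (- \<theta>) - s powr \<theta> * u)"
        using \<theta> by (simp only: pos_divide_le_eq) (simp add: mult.commute)
      also have "(1 + \<theta>) * (cN * a powr (- \<theta>) - s powr \<theta> * u) = B - (1 + \<theta>) * s powr \<theta> * u"
      proof -
        have "(1 + \<theta>) * cN = 1 / (2 * a)" using cN \<theta> by (simp add: a_def)
        then have "(1 + \<theta>) * cN * a powr (- \<theta>) = a powr (- \<theta>) / (2 * a)" by simp
        also have "\<dots> = B" using a by (simp add: B_def powr_diff)
        finally show ?thesis by (simp add: algebra_simps)
      qed
      finally have "(1 + \<theta>) * s powr \<theta> * u + s powr (1 + \<theta>) * u' - B \<le> 0" by simp
      with dW show "\<exists>y. (W has_real_derivative y) (at s) \<and> y \<le> 0" by blast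
    qed
    also have "W t1 \<le> t1 powr (1 + \<theta>) * 1"
      unfolding W_def using mult_left_mono[OF P_le_1[of t1 x x], of "t1 powr (1 + \<theta>)"] t1 B
      by (smt (verit) mult_nonneg_nonneg powr_ge_zero)
    finally have "t * (ent (P t) x x * t powr \<theta>) \<le> t * B + t1 * t1 powr \<theta>"
      using t t1 by (simp add: W_def powr_add algebra_simps)
    also have "\<dots> \<le> t * B + t * t1 powr \<theta>" using False by (simp add: mult_right_mono)
    finally have "t * (ent (P t) x x * t powr \<theta>) \<le> t * K" by (simp add: K_def algebra_simps)
    then show ?thesis using t by simp
  qed
  show ?thesis
  proof (rule that[of K])
    show "0 < K" using B t1 by (simp add: K_def add_pos_pos)
    fix t :: real and x y assume t: "0 < t"
    have d: "ent (P t) x x \<le> K * t powr (- D / \<alpha>)" for x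
      using diag[OF t, of x] t by (simp add: \<theta>_def powr_minus field_simps)
    show "ent (P t) x y \<le> K * t powr (- D / \<alpha>)"
      using order_trans[OF ent_P_le_diag[of t x y] divide_right_mono[OF add_mono[OF d[of x] d[of y]], of 2]] by simp
  qed
qed

text \<open>Mean value theorem. On the diagonal the derivative is controlled by convexity and the
  kernel bound at half time, which is where the power of 1/2 in the constant arises; off the
  diagonal by \<open>ent_P_gen_bound\<close>.\<close>

lemma time_regularity:
  obtains K where "0 < K"
    "\<And>t0 s1 s2 x y. 0 < t0 \<Longrightarrow> t0 \<le> s1 \<Longrightarrow> t0 \<le> s2 \<Longrightarrow>
       \<bar>ent (P s1) x y - ent (P s2) x y\<bar> \<le> K * t0 powr (- D / \<alpha> - 1) * \<bar>s1 - s2\<bar>"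
proof -
  obtain K where K: "0 < K" and P: "\<And>t x y. 0 < t \<Longrightarrow> ent (P t) x y \<le> K * t powr (- D / \<alpha>)"
    using on_diagonal by blast
  define \<theta> where "\<theta> = D / \<alpha>"
  have \<theta>: "\<theta> > 0" using D_ge_1 alpha by (simp add: \<theta>_def)
  define L where "L = 2 * K * (1/2) powr (- \<theta>)"
  have L: "L > 0" using K by (simp add: L_def)
  have der: "\<bar>ent (P s * gen) x y\<bar> \<le> L * t0 powr (- \<theta> - 1)" if "0 < t0" "t0 \<le> s" for t0 s x y
  proof -
    have d: "- ent (P s * gen) x x \<le> L * t0 powr (- \<theta> - 1)" for x
    proof -
      have "- ent (P s * gen) x x \<le> 2 / s * ent (P (s/2)) x x" by (rule ent_P_gen_diag_bound) (use that in simp)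
      also have "\<dots> \<le> 2 / s * (K * (s/2) powr (- \<theta>))"
        by (rule mult_left_mono) (use P[of "s/2" x x] that in \<open>auto simp: \<theta>_def\<close>)
      also have "\<dots> = L * s powr (- \<theta> - 1)"
        using that powr_mult[of s "1/2" "- \<theta>"] by (simp add: L_def powr_diff field_simps)
      also have "\<dots> \<le> L * t0 powr (- \<theta> - 1)"
        by (rule mult_left_mono[OF powr_mono2']) (use that \<theta> L in auto)
      finally show ?thesis .
    qed
    have "(- ent (P s * gen) x x - ent (P s * gen) y y) / 2 \<le> L * t0 powr (- \<theta> - 1)"
      using add_mono[OF d[of x] d[of y]] by simp
    then show ?thesis by (rule order_trans[OF ent_P_gen_bound])
  qed
  have main: "\<bar>ent (P s1) x y - ent (P s2) x y\<bar> \<le> L * t0 powr (- \<theta> - 1) * \<bar>s1 - s2\<bar>"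
    if "0 < t0" "t0 \<le> s1" "s1 < s2" for t0 s1 s2 x y
  proof -
    have "\<exists>z>s1. z < s2 \<and> ent (P s2) x y - ent (P s1) x y = (s2 - s1) * ent (P z * gen) x y"
      by (rule MVT2) (use that DERIV_ent_P in auto)
    then obtain z where z: "z > s1" "ent (P s2) x y - ent (P s1) x y = (s2 - s1) * ent (P z * gen) x y" by blast
    have "\<bar>ent (P s1) x y - ent (P s2) x y\<bar> = (s2 - s1) * \<bar>ent (P z * gen) x y\<bar>"
      using z(2) that by (subst abs_minus_commute) (simp add: abs_mult)
    also have "\<dots> \<le> (s2 - s1) * (L * t0 powr (- \<theta> - 1))"
      by (rule mult_left_mono[OF der]) (use that z in auto)
    finally show ?thesis using that by (simp add: mult_ac)
  qed
  show ?thesis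
  proof (rule that[OF L])
    fix t0 s1 s2 :: real and x y assume s: "0 < t0" "t0 \<le> s1" "t0 \<le> s2"
    consider "s1 < s2" | "s1 = s2" | "s2 < s1" by linarith
    then show "\<bar>ent (P s1) x y - ent (P s2) x y\<bar> \<le> L * t0 powr (- D / \<alpha> - 1) * \<bar>s1 - s2\<bar>"
      by cases (use main[of t0 s1 s2 x y] main[of t0 s2 s1 x y] s in
        \<open>simp_all add: \<theta>_def abs_minus_commute\<close>)
  qed
qed

end

section \<open>A polynomial weight\<close>

text \<open>After division by u + v both summands lie in [0, 1], where r \<le> r^g.\<close>

lemma powr_add_le:
  fixes u v g :: real
  assumes "0 \<le> u" "0 \<le> v" "0 < g" "g \<le> 1"
  shows "(u + v) powr g \<le> u powr g + v powr g"
proof (cases "u + v = 0")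
  case True
  then show ?thesis using assms by simp
next
  case False
  define s where "s = u + v"
  have s: "s > 0" using False assms by (simp add: s_def)
  have le: "r \<le> r powr g" if "0 \<le> r" "r \<le> 1" for r :: real
    using powr_mono'[of g 1 r] that assms by simp
  have "1 = u / s + v / s" using s by (simp add: s_def add_divide_distrib[symmetric])
  also have "\<dots> \<le> (u / s) powr g + (v / s) powr g"
    by (intro add_mono le) (use assms s in \<open>auto simp: s_def\<close>)
  also have "\<dots> = (u powr g + v powr g) / s powr g"
    using assms s by (simp add: powr_divide add_divide_distrib)
  finally show ?thesis using s by (simp add: s_def[symmetric] le_divide_eq)
qed

lemma powr_diff_le:
  fixes u v g :: real
  assumes "1 \<le> v" "v \<le> u" "0 < g" "g \<le> 1"
  shows "u powr g - v powr g \<le> u - v"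
proof -
  have 1: "1 \<le> u / v" using assms by simp
  have "u powr g = v powr g * (u / v) powr g" using assms by (simp add: powr_divide)
  also have "\<dots> \<le> v powr g * (u / v)"
    using powr_mono[of g 1 "u / v"] 1 assms by (intro mult_left_mono) auto
  finally have "u powr g - v powr g \<le> v powr g * (u / v) - v powr g" by simp
  also have "\<dots> = v powr (g - 1) * (u - v)"
    using assms by (simp add: powr_diff field_simps)
  also have "\<dots> \<le> 1 * (u - v)"
    using powr_mono[of "g - 1" 0 v] assms by (intro mult_right_mono) auto
  finally show ?thesis by simp
qed

lemma abs_min_diff: "\<bar>min L a - min L b\<bar> \<le> \<bar>a - b :: real\<bar>"
  by (auto simp: min_def)

section \<open>The weight and its increments under jumps\<close>

context stable_rates
begin

text \<open>The exponent needs \<open>2 * gm < \<alpha>\<close>, so that squared increments of the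
  weight are integrable against large jumps, and must stay below 1 for subadditivity of the
  power.\<close>

definition gm :: real where "gm = \<alpha> / 4"

text \<open>The summand 1 keeps the weight at least 1 and Lipschitz with constant
  \<open>1 / R\<close> down to distance 0.\<close>

definition wt :: "real \<Rightarrow> int^'d \<Rightarrow> int^'d \<Rightarrow> real"
  where "wt R x y = (1 + ldist x y / R) powr gm"

text \<open>Truncation makes the weight bounded, as \<open>kapp\<close> requires, and makes
  \<open>L - wtL L R x y\<close> vanish outside a ball.\<close>

definition wtL :: "real \<Rightarrow> real \<Rightarrow> int^'d \<Rightarrow> int^'d \<Rightarrow> real"
  where "wtL L R x y = min L (wt R x y)"

lemma gm: "0 < gm" "gm \<le> 1/2" "gm < \<alpha>" "2 * gm < \<alpha>"
  using alpha by (auto simp: gm_def)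

lemma wt_ge_1: "0 < R \<Longrightarrow> 1 \<le> wt R x y"
  unfolding wt_def by (rule ge_one_powr_ge_zero) (use gm in auto)

lemma wt_self [simp]: "wt R x x = 1" by (simp add: wt_def)

lemma wtL_bounds: "0 < R \<Longrightarrow> 1 \<le> L \<Longrightarrow> 1 \<le> wtL L R x y" "wtL L R x y \<le> L" "wtL L R x y \<le> wt R x y"
  using wt_ge_1 by (auto simp: wtL_def)

lemma bfun_wtL: "0 < R \<Longrightarrow> 1 \<le> L \<Longrightarrow> bfun (wtL L R x)"
proof (rule bfunI[where M = L])
  fix y assume "0 < R" "1 \<le> L"
  moreover have "wtL L R x y \<le> L" by (simp add: wtL_def)
  ultimately show "\<bar>wtL L R x y\<bar> \<le> L" using wtL_bounds(1)[of R L x y] by linarith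
qed

text \<open>The power bound serves jumps longer than \<open>R\<close>, the Lipschitz bound shorter
  ones. Taking the minimum with \<open>L\<close> is 1-Lipschitz and preserves both.\<close>

lemma wtL_diff:
  assumes R: "0 < R"
  shows "\<bar>wtL L R x y - wtL L R x z\<bar> \<le> (ldist y z / R) powr gm"
    and "\<bar>wtL L R x y - wtL L R x z\<bar> \<le> ldist y z / R"
proof -
  have *: "wt R x y - wt R x z \<le> (ldist y z / R) powr gm \<and> wt R x y - wt R x z \<le> ldist y z / R" for y z
  proof -
    define a b where "a = ldist x y / R" and "b = ldist x z / R"
    have ab: "0 \<le> a" "0 \<le> b" using R by (auto simp: a_def b_def)
    have d: "a \<le> b + ldist y z / R"
      using ldist_triangle[of x y z] R by (simp add: a_def b_def ldist_commute[of z y] field_simps)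
    have d0: "0 \<le> ldist y z / R" using R by simp
    show ?thesis
    proof (cases "a \<le> b")
      case True
      then have "wt R x y \<le> wt R x z" using ab gm by (auto simp: wt_def a_def b_def intro!: powr_mono2)
      then show ?thesis using d0 powr_ge_zero[of "ldist y z / R" gm] by linarith
    next
      case False
      have "(1 + a) powr gm \<le> (1 + b) powr gm + (a - b) powr gm"
        using powr_add_le[of "1 + b" "a - b" gm] gm ab False by simp
      also have "(a - b) powr gm \<le> (ldist y z / R) powr gm"
        by (rule powr_mono2) (use d False gm in auto)
      finally have 1: "wt R x y - wt R x z \<le> (ldist y z / R) powr gm" by (simp add: wt_def a_def b_def)
      have "(1 + a) powr gm - (1 + b) powr gm \<le> a - b"
        using powr_diff_le[of "1 + b" "1 + a" gm] gm ab False by simp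
      then show ?thesis using 1 d by (simp add: wt_def a_def b_def)
    qed
  qed
  have "\<bar>wt R x y - wt R x z\<bar> \<le> (ldist y z / R) powr gm" "\<bar>wt R x y - wt R x z\<bar> \<le> ldist y z / R"
    using *[of y z] *[of z y] by (auto simp: ldist_commute abs_le_iff)
  then show "\<bar>wtL L R x y - wtL L R x z\<bar> \<le> (ldist y z / R) powr gm"
     "\<bar>wtL L R x y - wtL L R x z\<bar> \<le> ldist y z / R"
    using abs_min_diff[of L "wt R x y" "wt R x z"] by (auto simp: wtL_def)
qed

definition grad_const :: real where "grad_const = K1 * shell_const TYPE('d) (2 - \<alpha>) + K1 * shell_const TYPE('d) (\<alpha> / 2)"
definition drift_const :: real where "drift_const = K1 * shell_const TYPE('d) (\<alpha> - gm)"

lemma grad_const_pos: "0 < grad_const"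
  unfolding grad_const_def using K1_ge_1 alpha by (intro add_pos_pos mult_pos_pos shell_const_pos) auto

lemma drift_const_pos: "0 < drift_const"
  unfolding drift_const_def using K1_ge_1 gm by (intro mult_pos_pos shell_const_pos) auto

text \<open>Below \<open>R\<close> the Lipschitz bound leaves a truncated second moment of the
  jumps, of order R^(2 - \<alpha>) because \<alpha> < 2; above \<open>R\<close> the power bound
  leaves a moment of order \<alpha>/2. Both parts scale as R^(-\<alpha>), uniformly in
  \<open>L\<close>.\<close>

lemma gradient_bound:
  assumes R: "1 \<le> R" and F: "finite F"
  shows "(\<Sum>z\<in>F. C y z * (wtL L R x y - wtL L R x z)\<^sup>2) \<le> grad_const * R powr (- \<alpha>)"
proof -
  define F1 F2 where "F1 = {z\<in>F. z \<noteq> y \<and> ldist y z < R}" and "F2 = {z\<in>F. R \<le> ldist y z}"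
  have fin: "finite F1" "finite F2" "F1 \<inter> F2 = {}" using F by (auto simp: F1_def F2_def)
  have "(\<Sum>z\<in>F. C y z * (wtL L R x y - wtL L R x z)\<^sup>2) = (\<Sum>z\<in>F1 \<union> F2. C y z * (wtL L R x y - wtL L R x z)\<^sup>2)"
    by (rule sum.mono_neutral_right) (use F in \<open>auto simp: F1_def F2_def rates_diag\<close>)
  also have "\<dots> = (\<Sum>z\<in>F1. C y z * (wtL L R x y - wtL L R x z)\<^sup>2) + (\<Sum>z\<in>F2. C y z * (wtL L R x y - wtL L R x z)\<^sup>2)"
    by (rule sum.union_disjoint) (use fin in auto)
  also have "(\<Sum>z\<in>F1. C y z * (wtL L R x y - wtL L R x z)\<^sup>2) \<le> K1 * shell_const TYPE('d) (2 - \<alpha>) * R powr (- \<alpha>)"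
  proof -
    have "(\<Sum>z\<in>F1. C y z * (wtL L R x y - wtL L R x z)\<^sup>2) \<le> (\<Sum>z\<in>F1. K1 / R\<^sup>2 * ldist y z powr ((2 - \<alpha>) - real CARD('d)))"
    proof (rule sum_mono)
      fix z assume z: "z \<in> F1"
      then have ld: "1 \<le> ldist y z" "y \<noteq> z" using ldist_ge_1[of y z] by (auto simp: F1_def)
      have "C y z * (wtL L R x y - wtL L R x z)\<^sup>2 \<le> (K1 * ldist y z powr (- (D + \<alpha>))) * (ldist y z / R)\<^sup>2"
      proof (rule mult_mono)
        show "(wtL L R x y - wtL L R x z)\<^sup>2 \<le> (ldist y z / R)\<^sup>2"
          by (rule power2_le_iff_abs_le[THEN iffD2]) (use wtL_diff(2)[of R L x y z] R in auto)
        show "0 \<le> K1 * ldist y z powr (- (D + \<alpha>))" using K1_ge_1 by simp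
      qed (use rates_le[OF ld(2)] in auto)
      also have "\<dots> = K1 / R\<^sup>2 * (ldist y z powr (- (D + \<alpha>)) * ldist y z powr 2)"
        using ld by (simp add: power_divide)
      also have "\<dots> = K1 / R\<^sup>2 * ldist y z powr ((2 - \<alpha>) - real CARD('d))"
        unfolding powr_add[symmetric] by (simp add: D_def algebra_simps)
      finally show "C y z * (wtL L R x y - wtL L R x z)\<^sup>2 \<le> K1 / R\<^sup>2 * ldist y z powr ((2 - \<alpha>) - real CARD('d))" .
    qed
    also have "\<dots> \<le> K1 / R\<^sup>2 * (shell_const TYPE('d) (2 - \<alpha>) * R powr (2 - \<alpha>))"
      unfolding sum_distrib_left[symmetric]
      by (rule mult_left_mono[OF inner_sum]) (use alpha fin R K1_ge_1 in \<open>auto simp: F1_def\<close>)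
    also have "\<dots> = K1 * shell_const TYPE('d) (2 - \<alpha>) * R powr (- \<alpha>)"
      using R by (simp add: powr_diff powr_minus_divide)
    finally show ?thesis .
  qed
  also have "(\<Sum>z\<in>F2. C y z * (wtL L R x y - wtL L R x z)\<^sup>2) \<le> K1 * shell_const TYPE('d) (\<alpha> / 2) * R powr (- \<alpha>)"
  proof -
    have "(\<Sum>z\<in>F2. C y z * (wtL L R x y - wtL L R x z)\<^sup>2) \<le> (\<Sum>z\<in>F2. R powr (- (\<alpha> / 2)) * (C y z * ldist y z powr (\<alpha> / 2)))"
    proof (rule sum_mono)
      fix z assume z: "z \<in> F2"
      have "(wtL L R x y - wtL L R x z)\<^sup>2 \<le> ((ldist y z / R) powr gm)\<^sup>2"
        using wtL_diff(1)[of R L x y z] R by (intro power2_le_iff_abs_le[THEN iffD2]) auto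
      also have "\<dots> = (ldist y z / R) powr (\<alpha> / 2)"
        by (simp add: power2_eq_square gm_def flip: powr_add)
      also have "\<dots> = R powr (- (\<alpha> / 2)) * ldist y z powr (\<alpha> / 2)"
        using R by (simp add: powr_divide powr_minus_divide)
      finally have "C y z * (wtL L R x y - wtL L R x z)\<^sup>2 \<le> C y z * (R powr (- (\<alpha> / 2)) * ldist y z powr (\<alpha> / 2))"
        by (rule mult_left_mono) (rule C_nonneg)
      then show "C y z * (wtL L R x y - wtL L R x z)\<^sup>2 \<le> R powr (- (\<alpha> / 2)) * (C y z * ldist y z powr (\<alpha> / 2))"
        by (simp add: mult_ac)
    qed
    also have "\<dots> \<le> R powr (- (\<alpha> / 2)) * (K1 * shell_const TYPE('d) (\<alpha> - \<alpha> / 2) * R powr (\<alpha> / 2 - \<alpha>))"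
      unfolding sum_distrib_left[symmetric] F2_def
      by (rule mult_left_mono[OF rates_tail]) (use alpha R F in auto)
    also have "\<dots> = K1 * shell_const TYPE('d) (\<alpha> / 2) * (R powr (- (\<alpha> / 2)) * R powr (\<alpha> / 2 - \<alpha>))" by simp
    also have "\<dots> = K1 * shell_const TYPE('d) (\<alpha> / 2) * R powr (- \<alpha>)"
      unfolding powr_add[symmetric] by simp
    finally show ?thesis .
  qed
  finally show ?thesis by (simp add: grad_const_def distrib_right)
qed

text \<open>First-order increments without cancellation, hence no decay in \<open>R\<close>. This
  serves for a priori finiteness and for times up to 1.\<close>

lemma crude_bound:
  assumes R: "1 \<le> R" and F: "finite F"
  shows "(\<Sum>z\<in>F. \<bar>C y z * (wtL L R x z - wtL L R x y)\<bar>) \<le> drift_const"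
proof -
  have "(\<Sum>z\<in>F. \<bar>C y z * (wtL L R x z - wtL L R x y)\<bar>) = (\<Sum>z\<in>{z\<in>F. 1 \<le> ldist y z}. \<bar>C y z * (wtL L R x z - wtL L R x y)\<bar>)"
  proof (rule sum.mono_neutral_right)
    show "\<forall>z\<in>F - {z\<in>F. 1 \<le> ldist y z}. \<bar>C y z * (wtL L R x z - wtL L R x y)\<bar> = 0"
    proof
      fix z assume "z \<in> F - {z\<in>F. 1 \<le> ldist y z}"
      then have "y = z" using ldist_ge_1[of y z] by auto
      then show "\<bar>C y z * (wtL L R x z - wtL L R x y)\<bar> = 0" by simp
    qed
  qed (use F in auto)
  also have "\<dots> \<le> (\<Sum>z\<in>{z\<in>F. 1 \<le> ldist y z}. C y z * ldist y z powr gm)"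
  proof (rule sum_mono)
    fix z
    have "\<bar>wtL L R x z - wtL L R x y\<bar> \<le> (ldist y z / R) powr gm"
      using wtL_diff(1)[of R L x z y] R by (simp add: ldist_commute)
    also have "\<dots> \<le> ldist y z powr gm"
    proof (rule powr_mono2)
      show "ldist y z / R \<le> ldist y z" using mult_left_mono[OF R, of "ldist y z"] R by (simp add: divide_le_eq)
    qed (use R gm in auto)
    finally show "\<bar>C y z * (wtL L R x z - wtL L R x y)\<bar> \<le> C y z * ldist y z powr gm"
      by (simp add: abs_mult C_nonneg mult_left_mono)
  qed
  also have "\<dots> \<le> K1 * shell_const TYPE('d) (\<alpha> - gm) * 1 powr (gm - \<alpha>)"
    by (rule rates_tail) (use F gm in auto)
  finally show ?thesis by (simp add: drift_const_def)
qed

lemma kapp_gen_wtL: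
  assumes "1 \<le> R" "1 \<le> L"
  shows "\<bar>kapp gen (wtL L R x) y\<bar> \<le> drift_const"
proof -
  have b: "bfun (wtL L R x)" using assms by (intro bfun_wtL) auto
  show ?thesis
    unfolding kapp_gen(1)[OF b]
    using order_trans[OF abs_infsum_le[OF kapp_gen(2)[OF b]] summable_on_realI(3)[OF crude_bound[OF assms(1)]]] .
qed

lemma crude_moment:
  assumes "1 \<le> R" "1 \<le> L" "0 \<le> t"
  shows "kapp (P t) (wtL L R x) x \<le> 1 + drift_const * t"
proof -
  have b: "bfun (wtL L R x)" using assms by (intro bfun_wtL) auto
  have "kapp (P t) (wtL L R x) x - drift_const * t \<le> kapp (P 0) (wtL L R x) x - drift_const * 0"
  proof (rule DERIV_nonpos_imp_nonincreasing[of 0 t "\<lambda>t. kapp (P t) (wtL L R x) x - drift_const * t"])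
    fix s assume s: "0 \<le> s" "s \<le> t"
    have "kapp (P s) (kapp gen (wtL L R x)) x \<le> kapp (P s) (\<lambda>_. drift_const) x"
      using kapp_gen_wtL[OF assms(1,2)] s
      by (intro kapp_mono bfun_kapp b bfun_const P_nonneg) (auto simp: abs_le_iff)
    also have "\<dots> = drift_const" using kapp_cmult[of "P s" drift_const "\<lambda>_. 1" x] by (simp add: P_one)
    finally have "kapp (P s) (kapp gen (wtL L R x)) x - drift_const \<le> 0" by simp
    moreover have "((\<lambda>t. kapp (P t) (wtL L R x) x - drift_const * t) has_real_derivative kapp (P s) (kapp gen (wtL L R x)) x - drift_const) (at s)"
      by (rule derivative_eq_intros DERIV_kapp_P b refl | simp)+
    ultimately show "\<exists>y. ((\<lambda>t. kapp (P t) (wtL L R x) x - drift_const * t) has_real_derivative y) (at s) \<and> y \<le> 0" by blast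
  qed (use assms in simp)
  moreover have "kapp (P 0) (wtL L R x) x = 1"
    using assms by (simp add: P_0 kapp_def ent_one infsum_single wtL_def)
  ultimately show ?thesis by simp
qed

text \<open>Monotone convergence in \<open>L\<close>: on a finite set of targets a large enough
  \<open>L\<close> makes the truncation invisible.\<close>

lemma moment_from_truncated:
  assumes R: "0 < R" and t: "0 \<le> t" and B: "\<And>L. 1 \<le> L \<Longrightarrow> kapp (P t) (wtL L R x) x \<le> B"
  shows "(\<lambda>y. ent (P t) x y * wt R x y) summable_on UNIV"
    and "(\<Sum>\<^sub>\<infinity>y. ent (P t) x y * wt R x y) \<le> B"
proof -
  have nn: "0 \<le> ent (P t) x y * wt R x y" for y
    using wt_ge_1[OF R, of x y] P_nonneg[OF t] by simp
  have fin: "(\<Sum>y\<in>F. \<bar>ent (P t) x y * wt R x y\<bar>) \<le> B" if "finite F" for F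
  proof -
    define L where "L = 1 + (\<Sum>y\<in>F. wt R x y)"
    have w0: "0 \<le> wt R x y" for y using wt_ge_1[OF R, of x y] by simp
    have L: "1 \<le> L" using w0 by (simp add: L_def sum_nonneg)
    have eq: "wtL L R x y = wt R x y" if "y \<in> F" for y
      using member_le_sum[OF that _ \<open>finite F\<close>, of "wt R x"] w0 by (simp add: wtL_def L_def)
    have "(\<Sum>y\<in>F. \<bar>ent (P t) x y * wt R x y\<bar>) = (\<Sum>y\<in>F. ent (P t) x y * wtL L R x y)"
      by (rule sum.cong) (use nn eq in auto)
    also have "\<dots> \<le> kapp (P t) (wtL L R x) x"
      unfolding kapp_def
      by (rule finite_sum_le_infsum[OF kapp_summable[OF bfun_wtL[OF R L]] that])
         (use P_nonneg[OF t] w0 L in \<open>auto simp: wtL_def\<close>)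
    also have "\<dots> \<le> B" by (rule B[OF L])
    finally show ?thesis .
  qed
  show "(\<lambda>y. ent (P t) x y * wt R x y) summable_on UNIV" by (rule summable_on_realI(1)[OF fin])
  show "(\<Sum>\<^sub>\<infinity>y. ent (P t) x y * wt R x y) \<le> B"
    using summable_on_realI(3)[OF fin] nn by simp
qed

text \<open>Normalising constant of the reference density in the entropy argument. A single term of
  the exponential series, with \<open>n * gm\<close> at least d + 1, already gives summable
  polynomial decay.\<close>

lemma gaussian_sum:
  obtains Z where "0 < Z"
    "\<And>R F x. 1 \<le> R \<Longrightarrow> finite F \<Longrightarrow> (\<Sum>y\<in>F. exp (- wt R x y)) \<le> Z * R powr D"
proof -
  obtain n :: nat where n: "(D + 1) / gm < n" using reals_Archimedean2 by blast
  then have n: "D + 1 \<le> n * gm" using gm by (simp add: field_simps)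
  have e: "exp (- wt R x y) \<le> fact n * (1 + ldist x y / R) powr (- (D + 1))" if "1 \<le> R" for R x y
  proof -
    have w: "1 \<le> wt R x y" using wt_ge_1 that by simp
    have "wt R x y ^ n / fact n \<le> exp (wt R x y)"
    proof -
      have "(\<Sum>k\<in>{n}. wt R x y ^ k /\<^sub>R fact k) \<le> exp (wt R x y)"
        unfolding exp_def by (rule sum_le_suminf[OF summable_exp_generic]) (use w in auto)
      then show ?thesis by (simp add: field_simps)
    qed
    then have "exp (- wt R x y) \<le> fact n / wt R x y ^ n"
      using w by (simp add: exp_minus field_simps)
    also have "\<dots> = fact n * (1 + ldist x y / R) powr (- (n * gm))"
    proof -
      have "wt R x y ^ n = wt R x y powr real n" using w by (simp add: powr_realpow)
      also have "\<dots> = (1 + ldist x y / R) powr (n * gm)" by (simp add: wt_def powr_powr mult.commute)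
      finally show ?thesis by (simp add: powr_minus_divide)
    qed
    also have "\<dots> \<le> fact n * (1 + ldist x y / R) powr (- (D + 1))"
      by (intro mult_left_mono powr_mono) (use n that in auto)
    finally show ?thesis .
  qed
  define Z where "Z = fact n * (3 ^ CARD('d) + shell_const TYPE('d) 1)"
  show ?thesis
  proof (rule that[of Z])
    show "0 < Z" unfolding Z_def using shell_const_pos[of 1, where ?'d = 'd] by (intro mult_pos_pos add_pos_pos) auto
    fix R :: real and F :: "(int^'d) set" and x :: "int^'d" assume R: "1 \<le> R" and F: "finite F"
    define F1 F2 where "F1 = {y\<in>F. ldist x y < R}" and "F2 = {y\<in>F. R \<le> ldist x y}"
    have fin: "finite F1" "finite F2" "F1 \<inter> F2 = {}" "F = F1 \<union> F2" using F by (auto simp: F1_def F2_def)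
    have "(\<Sum>y\<in>F. exp (- wt R x y)) \<le> (\<Sum>y\<in>F. fact n * (1 + ldist x y / R) powr (- (D + 1)))"
      by (rule sum_mono) (rule e[OF R])
    also have "\<dots> = (\<Sum>y\<in>F1. fact n * (1 + ldist x y / R) powr (- (D + 1))) + (\<Sum>y\<in>F2. fact n * (1 + ldist x y / R) powr (- (D + 1)))"
      unfolding fin(4) by (rule sum.union_disjoint[OF fin(1-3)])
    also have "\<dots> \<le> fact n * (3 ^ CARD('d) * R powr D) + fact n * (R powr (D + 1) * (shell_const TYPE('d) 1 * R powr (- 1)))"
    proof (rule add_mono)
      have "(\<Sum>y\<in>F1. fact n * (1 + ldist x y / R) powr (- (D + 1))) \<le> (\<Sum>y\<in>F1. fact n * 1)"
      proof (intro sum_mono mult_left_mono)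
        fix y
        have "(1 + ldist x y / R) powr (- (D + 1)) \<le> (1 + ldist x y / R) powr 0"
          by (rule powr_mono) (use R D_ge_1 in auto)
        then show "(1 + ldist x y / R) powr (- (D + 1)) \<le> 1" by (simp split: if_splits)
      qed simp
      also have "\<dots> = fact n * real (card F1)" by simp
      also have "real (card F1) \<le> lvol TYPE('d) R"
        unfolding card_ball[of x R, symmetric] by (auto simp: F1_def intro!: card_mono finite_ball)
      also have "\<dots> \<le> 3 ^ CARD('d) * R powr D" unfolding D_def by (rule lvol_le_powr[OF R])
      finally show "(\<Sum>y\<in>F1. fact n * (1 + ldist x y / R) powr (- (D + 1))) \<le> fact n * (3 ^ CARD('d) * R powr D)" by simp
      have "(\<Sum>y\<in>F2. fact n * (1 + ldist x y / R) powr (- (D + 1))) \<le> (\<Sum>y\<in>F2. fact n * (R powr (D + 1) * ldist x y powr (- (D + 1))))"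
      proof (intro sum_mono mult_left_mono)
        fix y assume "y \<in> F2"
        then have l: "0 < ldist x y" using R by (auto simp: F2_def)
        have "(1 + ldist x y / R) powr (- (D + 1)) \<le> (ldist x y / R) powr (- (D + 1))"
          by (rule powr_mono2') (use D_ge_1 l R in auto)
        also have "\<dots> = R powr (D + 1) * ldist x y powr (- (D + 1))"
        proof -
          have "(ldist x y / R) powr (- (D + 1)) = ldist x y powr (- (D + 1)) / R powr (- (D + 1))"
            using l R by (simp only: powr_divide)
          also have "R powr (- (D + 1)) = 1 / R powr (D + 1)" by (rule powr_minus_divide)
          finally show ?thesis by simp
        qed
        finally show "(1 + ldist x y / R) powr (- (D + 1)) \<le> R powr (D + 1) * ldist x y powr (- (D + 1))" .
      qed simp
      also have "\<dots> = fact n * (R powr (D + 1) * (\<Sum>y\<in>F2. ldist x y powr (- (D + 1))))" by (simp add: sum_distrib_left)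
      also have "\<dots> \<le> fact n * (R powr (D + 1) * (shell_const TYPE('d) 1 * R powr (- 1)))"
      proof -
        have "(\<Sum>y\<in>F2. ldist x y powr (- (D + 1))) \<le> shell_const TYPE('d) 1 * R powr (- 1)"
          unfolding D_def by (rule tail_sum) (use F R in \<open>simp_all add: F2_def\<close>)
        then have "R powr (D + 1) * (\<Sum>y\<in>F2. ldist x y powr (- (D + 1))) \<le> R powr (D + 1) * (shell_const TYPE('d) 1 * R powr (- 1))"
          by (rule mult_left_mono) (rule powr_ge_zero)
        then show ?thesis by (rule mult_left_mono) (rule fact_ge_zero)
      qed
      finally show "(\<Sum>y\<in>F2. fact n * (1 + ldist x y / R) powr (- (D + 1))) \<le> fact n * (R powr (D + 1) * (shell_const TYPE('d) 1 * R powr (- 1)))" .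
    qed
    also have "\<dots> = Z * R powr D"
    proof -
      have "R powr (D + 1) * (shell_const TYPE('d) 1 * R powr (- 1)) = shell_const TYPE('d) 1 * (R powr (D + 1) * R powr (- 1))" by simp
      also have "R powr (D + 1) * R powr (- 1) = R powr D" by (simp only: powr_add[symmetric]) simp
      finally show ?thesis by (simp only: Z_def distrib_left distrib_right mult.assoc)
    qed
    finally show "(\<Sum>y\<in>F. exp (- wt R x y)) \<le> Z * R powr D" .
  qed
qed

end

section \<open>Moment bound by Nash's entropy method\<close>

text \<open>A regularisation of \<open>- p ln p\<close> with bounded derivative \<open>- ln (p + \<epsilon>)\<close>.\<close>

definition reg_ent :: "real \<Rightarrow> real \<Rightarrow> real"
  where "reg_ent \<epsilon> p = - (p + \<epsilon>) * ln (p + \<epsilon>) + \<epsilon> * ln \<epsilon> + p"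

lemma reg_ent_0 [simp]: "reg_ent \<epsilon> 0 = 0" by (simp add: reg_ent_def)

text \<open>Second-order Taylor bound, the second derivative being at most 1/\<epsilon> in size. The
  two sides come from ln u \<le> u - 1 at A/B and at B/A.\<close>

lemma reg_ent_taylor:
  assumes "0 < \<epsilon>" "0 \<le> a" "0 \<le> b"
  shows "\<bar>reg_ent \<epsilon> a - reg_ent \<epsilon> b + ln (b + \<epsilon>) * (a - b)\<bar> \<le> (a - b)\<^sup>2 / \<epsilon>"
proof -
  define A B where "A = a + \<epsilon>" and "B = b + \<epsilon>"
  have AB: "0 < A" "0 < B" "\<epsilon> \<le> B" using assms by (auto simp: A_def B_def)
  define X where "X = - A * (ln A - ln B) + (A - B)"
  have eq: "reg_ent \<epsilon> a - reg_ent \<epsilon> b + ln (b + \<epsilon>) * (a - b) = X"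
    unfolding X_def reg_ent_def A_def B_def by (simp add: algebra_simps)
  have "ln (A / B) \<le> A / B - 1" by (rule ln_le_minus_one) (use AB in simp)
  then have "A * (ln A - ln B) \<le> A * (A / B - 1)" using AB by (intro mult_left_mono) (auto simp: ln_div)
  also have "A * (A / B - 1) = (A - B) + (A - B)\<^sup>2 / B" using AB by (simp add: power2_eq_square field_simps)
  also have "(A - B)\<^sup>2 / B \<le> (A - B)\<^sup>2 / \<epsilon>" using AB assms by (intro divide_left_mono) auto
  finally have 1: "- ((A - B)\<^sup>2 / \<epsilon>) \<le> X" by (simp add: X_def)
  have "ln (B / A) \<le> B / A - 1" by (rule ln_le_minus_one) (use AB in simp)
  then have "A * (ln B - ln A) \<le> A * (B / A - 1)" using AB by (intro mult_left_mono) (auto simp: ln_div)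
  also have "\<dots> = B - A" using AB by (simp add: field_simps)
  finally have "X \<le> 0" by (simp add: X_def algebra_simps)
  moreover have "0 \<le> (A - B)\<^sup>2 / \<epsilon>" using assms by simp
  ultimately show ?thesis unfolding eq using 1 by (simp add: A_def B_def abs_le_iff)
qed

lemma reg_ent_lower:
  assumes "0 < \<epsilon>" "0 \<le> p"
  shows "- p * ln (p + \<epsilon>) \<le> reg_ent \<epsilon> p"
proof -
  have "ln ((p + \<epsilon>) / \<epsilon>) \<le> (p + \<epsilon>) / \<epsilon> - 1" by (rule ln_le_minus_one) (use assms in simp)
  then have "\<epsilon> * (ln (p + \<epsilon>) - ln \<epsilon>) \<le> \<epsilon> * ((p + \<epsilon>) / \<epsilon> - 1)"
    using assms by (intro mult_left_mono) (auto simp: ln_div)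
  also have "\<dots> = p" using assms by (simp add: field_simps)
  finally show ?thesis by (simp add: reg_ent_def algebra_simps)
qed

text \<open>Pointwise Gibbs inequality with reference value \<open>q\<close>: summed, it bounds the
  entropy by the mean of - ln q plus the mass of \<open>q\<close>.\<close>

lemma reg_ent_upper:
  assumes "0 < \<epsilon>" "0 \<le> p" "0 < q"
  shows "reg_ent \<epsilon> p \<le> - p * ln q + q"
proof -
  have "ln ((q + \<epsilon>) / (p + \<epsilon>)) \<le> (q + \<epsilon>) / (p + \<epsilon>) - 1" by (rule ln_le_minus_one) (use assms in simp)
  then have "(p + \<epsilon>) * (ln (q + \<epsilon>) - ln (p + \<epsilon>)) \<le> (p + \<epsilon>) * ((q + \<epsilon>) / (p + \<epsilon>) - 1)"
    using assms by (intro mult_left_mono) (auto simp: ln_div)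
  also have "\<dots> = q - p" using assms by (simp add: right_diff_distrib)
  finally have 1: "- (p + \<epsilon>) * ln (p + \<epsilon>) \<le> q - p - (p + \<epsilon>) * ln (q + \<epsilon>)"
    by (simp add: algebra_simps)
  have 2: "p * ln q \<le> p * ln (q + \<epsilon>)" "\<epsilon> * ln \<epsilon> \<le> \<epsilon> * ln (q + \<epsilon>)"
    using assms by (auto intro!: mult_left_mono)
  show ?thesis using 1 2 by (simp add: reg_ent_def algebra_simps)
qed

text \<open>Domination by a multiple of \<open>a\<close> makes the entropy sum of a probability row
  converge.\<close>

lemma reg_ent_abs:
  assumes "0 < \<epsilon>" "0 \<le> a" "a \<le> 1"
  shows "\<bar>reg_ent \<epsilon> a\<bar> \<le> a * (\<bar>ln \<epsilon>\<bar> + 1 / \<epsilon>)"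
proof -
  have "\<bar>reg_ent \<epsilon> a + ln \<epsilon> * a\<bar> \<le> a\<^sup>2 / \<epsilon>" using reg_ent_taylor[OF assms(1,2), of 0] by simp
  also have "\<dots> \<le> a / \<epsilon>" using assms by (intro divide_right_mono) (auto simp: power2_eq_square mult_left_le)
  finally have "\<bar>reg_ent \<epsilon> a\<bar> \<le> a / \<epsilon> + \<bar>ln \<epsilon> * a\<bar>" by linarith
  then show ?thesis using assms by (simp add: abs_mult algebra_simps)
qed

section \<open>Entropy of the law at time t and its production\<close>

context conductance
begin

lemma kapp_P_abs:
  assumes "0 \<le> t" "\<And>y. \<bar>g y\<bar> \<le> B"
  shows "\<bar>kapp (P t) g x\<bar> \<le> B"
proof -
  have b: "bfun g" by (rule bfunI[OF assms(2)])
  have c: "kapp (P t) (\<lambda>_. c) x = c" for c using kapp_cmult[of "P t" c "\<lambda>_. 1" x] by (simp add: P_one)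
  have g: "g y \<le> B" "- B \<le> g y" for y using assms(2)[of y] by auto
  have "kapp (P t) g x \<le> kapp (P t) (\<lambda>_. B) x"
    by (rule kapp_mono[OF P_nonneg[OF assms(1)] b bfun_const g(1)])
  moreover have "kapp (P t) (\<lambda>_. - B) x \<le> kapp (P t) g x"
    by (rule kapp_mono[OF P_nonneg[OF assms(1)] bfun_const b g(2)])
  ultimately
  show ?thesis by (simp add: c abs_le_iff)
qed

text \<open>Testing the l1 norm with the sign of the difference reduces it to the mean value theorem
  for one real function and the contractivity of \<open>P\<close>.\<close>

lemma row_lipschitz:
  assumes "0 \<le> s" "0 \<le> t"
  shows "(\<Sum>\<^sub>\<infinity>y. \<bar>ent (P s) x y - ent (P t) x y\<bar>) \<le> norm gen * \<bar>s - t\<bar>"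
proof -
  define g where "g = (\<lambda>y. sgn (ent (P s) x y - ent (P t) x y))"
  have g: "\<bar>g y\<bar> \<le> 1" for y by (simp add: g_def sgn_real_def)
  then have b: "bfun g" by (rule bfunI)
  have main: "\<bar>kapp (P s) g x - kapp (P t) g x\<bar> \<le> norm gen * \<bar>s - t\<bar>" if st: "0 \<le> s" "s < t" for s t
  proof -
    have "\<exists>z>s. z < t \<and> kapp (P t) g x - kapp (P s) g x = (t - s) * kapp (P z) (kapp gen g) x"
      by (rule MVT2) (use that DERIV_kapp_P[OF b] in auto)
    then obtain z where z: "s < z" "kapp (P t) g x - kapp (P s) g x = (t - s) * kapp (P z) (kapp gen g) x" by blast
    have "\<bar>kapp (P z) (kapp gen g) x\<bar> \<le> norm gen * 1"
      by (rule kapp_P_abs[OF _ kapp_bound[OF g]]) (use z st in simp)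
    then have "(t - s) * \<bar>kapp (P z) (kapp gen g) x\<bar> \<le> (t - s) * norm gen" using st by (intro mult_left_mono) auto
    moreover have "\<bar>kapp (P s) g x - kapp (P t) g x\<bar> = (t - s) * \<bar>kapp (P z) (kapp gen g) x\<bar>"
      using z(2) st by (subst abs_minus_commute) (simp add: abs_mult)
    ultimately show ?thesis using st by (simp add: mult.commute)
  qed
  have "(\<Sum>\<^sub>\<infinity>y. \<bar>ent (P s) x y - ent (P t) x y\<bar>) = (\<Sum>\<^sub>\<infinity>y. ent (P s) x y * g y - ent (P t) x y * g y)"
    by (rule infsum_cong) (simp add: g_def abs_sgn left_diff_distrib[symmetric])
  also have "\<dots> = kapp (P s) g x - kapp (P t) g x"
    unfolding kapp_def by (rule infsum_diff_real(2)[OF kapp_summable[OF b] kapp_summable[OF b]])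
  also have "\<dots> \<le> norm gen * \<bar>s - t\<bar>"
  proof -
    consider "s < t" | "s = t" | "t < s" by linarith
    then show ?thesis
      by cases (use main[of s t] main[of t s] assms in \<open>auto simp: abs_minus_commute abs_le_iff\<close>)
  qed
  finally show ?thesis .
qed

definition Hent :: "real \<Rightarrow> 'a \<Rightarrow> real \<Rightarrow> real"
  where "Hent \<epsilon> x t = (\<Sum>\<^sub>\<infinity>y. reg_ent \<epsilon> (ent (P t) x y))"

lemma Hent_summable:
  assumes "0 < \<epsilon>" "0 \<le> t"
  shows "(\<lambda>y. reg_ent \<epsilon> (ent (P t) x y)) summable_on UNIV"
  by (rule summable_on_real_bound[OF summable_on_cmult_left[OF ent_summable]])
     (rule reg_ent_abs[OF assms(1) P_nonneg[OF assms(2)] P_le_1[OF assms(2)]])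

lemma bfun_log:
  assumes "0 < \<epsilon>" "0 \<le> t"
  shows "bfun (\<lambda>y. - ln (ent (P t) x y + \<epsilon>))"
proof (rule bfunI)
  fix y
  have "ln \<epsilon> \<le> ln (ent (P t) x y + \<epsilon>)" "ln (ent (P t) x y + \<epsilon>) \<le> ln (1 + \<epsilon>)"
    using assms P_nonneg[OF assms(2), of x y] P_le_1[OF assms(2), of x y] by auto
  then show "\<bar>- ln (ent (P t) x y + \<epsilon>)\<bar> \<le> \<bar>ln \<epsilon>\<bar> + \<bar>ln (1 + \<epsilon>)\<bar>" by linarith
qed

text \<open>Differentiation under the infinite sum. The logarithm is frozen at time t, so the linear
  part is \<open>kapp (P s) g x\<close>, whose derivative is known; the increment of the remainder
  \<open>E\<close> is of second order in s - t.\<close>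

lemma DERIV_Hent:
  assumes e: "0 < \<epsilon>" and t: "0 < t"
  shows "(Hent \<epsilon> x has_real_derivative kapp (P t) (kapp gen (\<lambda>y. - ln (ent (P t) x y + \<epsilon>))) x) (at t)"
proof -
  define g where "g = (\<lambda>y. - ln (ent (P t) x y + \<epsilon>))"
  have b: "bfun g" unfolding g_def by (rule bfun_log) (use e t in auto)
  define E where "E = (\<lambda>s. Hent \<epsilon> x s - kapp (P s) g x)"
  define N where "N = norm gen"
  have E: "\<bar>E s - E t\<bar> \<le> N\<^sup>2 * (s - t)\<^sup>2 / \<epsilon>" if s: "0 \<le> s" for s
  proof -
    define r where "r = (\<lambda>y. ent (P s) x y - ent (P t) x y)"
    have rs: "r summable_on UNIV" unfolding r_def by (rule infsum_diff_real(1)[OF ent_summable ent_summable])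
    have rsum: "(\<Sum>\<^sub>\<infinity>y. \<bar>r y\<bar>) \<le> N * \<bar>s - t\<bar>"
      unfolding r_def N_def by (rule row_lipschitz) (use s t in auto)
    have r1: "\<bar>r y\<bar> \<le> N * \<bar>s - t\<bar>" for y
    proof -
      have "(\<Sum>y\<in>{y}. \<bar>r y\<bar>) \<le> (\<Sum>\<^sub>\<infinity>y. \<bar>r y\<bar>)"
        by (rule finite_sum_le_infsum[OF summable_on_abs_real[OF rs]]) auto
      then show ?thesis using rsum by simp
    qed
    define q where "q = (\<lambda>y. reg_ent \<epsilon> (ent (P s) x y) - reg_ent \<epsilon> (ent (P t) x y) - r y * g y)"
    have s1: "(\<lambda>y. reg_ent \<epsilon> (ent (P s) x y) - reg_ent \<epsilon> (ent (P t) x y)) summable_on UNIV"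
      by (rule infsum_diff_real(1)) (use Hent_summable e s t in auto)
    have s2: "(\<lambda>y. r y * g y) summable_on UNIV" by (rule summable_mult_bfun[OF rs b])
    have qs: "q summable_on UNIV" unfolding q_def by (rule infsum_diff_real(1)[OF s1 s2])
    have "infsum q UNIV = (\<Sum>\<^sub>\<infinity>y. reg_ent \<epsilon> (ent (P s) x y) - reg_ent \<epsilon> (ent (P t) x y)) - (\<Sum>\<^sub>\<infinity>y. r y * g y)"
      unfolding q_def by (rule infsum_diff_real(2)[OF s1 s2])
    also have "(\<Sum>\<^sub>\<infinity>y. reg_ent \<epsilon> (ent (P s) x y) - reg_ent \<epsilon> (ent (P t) x y)) = Hent \<epsilon> x s - Hent \<epsilon> x t"
      unfolding Hent_def by (rule infsum_diff_real(2)) (use Hent_summable e s t in auto)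
    also have "(\<Sum>\<^sub>\<infinity>y. r y * g y) = kapp (P s) g x - kapp (P t) g x"
      unfolding kapp_def r_def left_diff_distrib by (rule infsum_diff_real(2)[OF kapp_summable[OF b] kapp_summable[OF b]])
    finally have "E s - E t = infsum q UNIV" by (simp add: E_def)
    also have "\<bar>infsum q UNIV\<bar> \<le> (\<Sum>\<^sub>\<infinity>y. \<bar>q y\<bar>)" by (rule abs_infsum_le[OF qs])
    \<comment> \<open>In the quadratic Taylor remainder one factor is bounded uniformly and the
      other is summed; each contributes one power of |s - t|.\<close>
    also have "\<dots> \<le> (\<Sum>\<^sub>\<infinity>y. \<bar>r y\<bar> * (N * \<bar>s - t\<bar> / \<epsilon>))"
    proof (rule infsum_mono[OF summable_on_abs_real[OF qs] summable_on_cmult_left[OF summable_on_abs_real[OF rs]]])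
      fix y
      have "\<bar>q y\<bar> \<le> (r y)\<^sup>2 / \<epsilon>"
        using reg_ent_taylor[OF e P_nonneg[OF s, of x y] P_nonneg[OF less_imp_le[OF t], of x y]]
        by (simp add: q_def r_def g_def mult.commute)
      also have "\<dots> = \<bar>r y\<bar> * \<bar>r y\<bar> / \<epsilon>" by (simp add: power2_eq_square)
      also have "\<dots> \<le> \<bar>r y\<bar> * (N * \<bar>s - t\<bar>) / \<epsilon>"
        using r1[of y] e by (intro divide_right_mono mult_left_mono) auto
      finally show "\<bar>q y\<bar> \<le> \<bar>r y\<bar> * (N * \<bar>s - t\<bar> / \<epsilon>)" by simp
    qed
    also have "\<dots> = (\<Sum>\<^sub>\<infinity>y. \<bar>r y\<bar>) * (N * \<bar>s - t\<bar> / \<epsilon>)" by (rule infsum_cmult_left')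
    also have "\<dots> \<le> (N * \<bar>s - t\<bar>) * (N * \<bar>s - t\<bar> / \<epsilon>)"
      by (rule mult_right_mono[OF rsum]) (use e in \<open>simp add: N_def\<close>)
    also have "\<dots> = N\<^sup>2 * (s - t)\<^sup>2 / \<epsilon>" by (simp add: power2_eq_square)
    finally show ?thesis .
  qed
  have "((\<lambda>s. (E s - E t) / (s - t)) \<longlongrightarrow> 0) (at t)"
  proof (rule Lim_null_comparison)
    show "((\<lambda>s. N\<^sup>2 / \<epsilon> * \<bar>s - t\<bar>) \<longlongrightarrow> 0) (at t)"
      by (rule tendsto_eq_intros refl | simp)+
    have "\<forall>\<^sub>F s in at t. 0 < s" using t by (intro order_tendstoD(1)[of _ t]) auto
    then show "\<forall>\<^sub>F s in at t. norm ((E s - E t) / (s - t)) \<le> N\<^sup>2 / \<epsilon> * \<bar>s - t\<bar>"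
    proof eventually_elim
      case (elim s)
      show ?case
      proof (cases "s = t")
        case False
        have "(s - t)\<^sup>2 = \<bar>s - t\<bar> * \<bar>s - t\<bar>" by (simp add: power2_eq_square)
        then have "\<bar>E s - E t\<bar> \<le> (N\<^sup>2 / \<epsilon> * \<bar>s - t\<bar>) * \<bar>s - t\<bar>"
          using E[of s] elim by (simp add: mult.assoc)
        then show ?thesis using False by (simp add: divide_le_eq)
      qed simp
    qed
  qed
  then have dE: "(E has_real_derivative 0) (at t)" by (simp add: has_field_derivative_iff)
  have "((\<lambda>s. E s + kapp (P s) g x) has_real_derivative 0 + kapp (P t) (kapp gen g) x) (at t)"
    by (rule DERIV_add[OF dE DERIV_kapp_P[OF b]])
  then show ?thesis by (simp add: E_def g_def)
qed

text \<open>Cauchy--Schwarz: the drift of a test function is controlled by the entropy production.\<close>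

lemma entropy_production:
  assumes p: "p summable_on UNIV" "\<And>y. 0 \<le> p y" "(\<Sum>\<^sub>\<infinity>y. p y) = 1"
    and e: "0 < \<epsilon>" and k: "0 < k"
    and f: "f summable_on UNIV" and \<psi>: "\<psi> = (\<lambda>y. L - f y)"
    and G: "\<And>y F. finite F \<Longrightarrow> (\<Sum>z\<in>F. C y z * (\<psi> y - \<psi> z)\<^sup>2) \<le> G"
    and lg: "bfun (\<lambda>y. - ln (p y + \<epsilon>))"
  shows "- (1/2) * energy p \<psi> \<le> k * (- (1/2) * energy p (\<lambda>y. - ln (p y + \<epsilon>))) + (G + \<epsilon> * energy f f) / (4 * k)"
proof -
  have b\<psi>: "bfun \<psi>" unfolding \<psi> by (rule bfun_diff[OF bfun_const summable_bfun[OF f]])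
  define g where "g = (\<lambda>y. - ln (p y + \<epsilon>))"
  define A1 where "A1 = (\<lambda>(z, w). p z * (C z w * (\<psi> z - \<psi> w)\<^sup>2))"
  define A2 where "A2 = (\<lambda>(z, w). p w * (C z w * (\<psi> z - \<psi> w)\<^sup>2))"
  \<comment> \<open>The weight \<open>s\<close> below contains \<open>2 * \<epsilon>\<close>, which
    is not summable over an infinite state space. This part is paid by the energy of the summable
    \<open>f\<close>, whose increments are those of \<open>\<psi>\<close> up to sign.\<close>
  define A3 where "A3 = (\<lambda>(z, w). C z w * ((f z - f w) * (f z - f w)))"
  define Ep where "Ep = (\<lambda>(z, w). C z w * ((p z - p w) * (\<psi> z - \<psi> w)))"
  define Eg where "Eg = (\<lambda>(z, w). C z w * ((p z - p w) * (g z - g w)))"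
  have G': "(\<Sum>z\<in>F. \<bar>C y z * (\<psi> y - \<psi> z)\<^sup>2\<bar>) \<le> G" if "finite F" for y F
    using G[OF that, of y] by (simp add: C_nonneg)
  have s1: "A1 summable_on UNIV" unfolding A1_def by (rule summable_pair[OF p(1) G'])
  have bij: "bij_betw prod.swap (UNIV :: ('a \<times> 'a) set) UNIV" by simp
  have eq: "(\<lambda>q. A1 (prod.swap q)) = A2"
    by (auto simp: fun_eq_iff A1_def A2_def C_sym power2_commute)
  have s2: "A2 summable_on UNIV" using summable_on_reindex_bij_betw[OF bij, of A1] s1 eq by simp
  have i2: "infsum A2 UNIV = infsum A1 UNIV" using infsum_reindex_bij_betw[OF bij, of A1] eq by simp
  have s3: "A3 summable_on UNIV" unfolding A3_def by (rule dirichlet(1)[OF f summable_bfun[OF f]])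
  have i3: "infsum A3 UNIV = energy f f" by (simp add: A3_def energy_def)
  have sp: "Ep summable_on UNIV" unfolding Ep_def by (rule dirichlet(1)[OF p(1) b\<psi>])
  have sg: "Eg summable_on UNIV" unfolding Eg_def g_def by (rule dirichlet(1)[OF p(1) lg])
  have i1: "infsum A1 UNIV \<le> G"
  proof -
    have "infsum A1 UNIV = (\<Sum>\<^sub>\<infinity>z. \<Sum>\<^sub>\<infinity>w. p z * (C z w * (\<psi> z - \<psi> w)\<^sup>2))"
      using infsum_Sigma'_banach[of "\<lambda>z w. p z * (C z w * (\<psi> z - \<psi> w)\<^sup>2)" UNIV "\<lambda>_. UNIV"] s1 by (simp add: A1_def)
    also have "\<dots> = (\<Sum>\<^sub>\<infinity>z. p z * (\<Sum>\<^sub>\<infinity>w. C z w * (\<psi> z - \<psi> w)\<^sup>2))" by (simp add: infsum_cmult_right')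
    also have "\<dots> \<le> (\<Sum>\<^sub>\<infinity>z. p z * G)"
    proof (rule infsum_mono)
      have Gz: "0 \<le> (\<Sum>\<^sub>\<infinity>w. C z w * (\<psi> z - \<psi> w)\<^sup>2)" "(\<Sum>\<^sub>\<infinity>w. C z w * (\<psi> z - \<psi> w)\<^sup>2) \<le> G" for z
      proof -
        show "0 \<le> (\<Sum>\<^sub>\<infinity>w. C z w * (\<psi> z - \<psi> w)\<^sup>2)" by (rule infsum_nonneg) (simp add: C_nonneg)
        have "(\<Sum>\<^sub>\<infinity>w. \<bar>C z w * (\<psi> z - \<psi> w)\<^sup>2\<bar>) \<le> G" by (rule summable_on_realI(3)[OF G'])
        then show "(\<Sum>\<^sub>\<infinity>w. C z w * (\<psi> z - \<psi> w)\<^sup>2) \<le> G" by (simp add: C_nonneg)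
      qed
      show "(\<lambda>z. p z * (\<Sum>\<^sub>\<infinity>w. C z w * (\<psi> z - \<psi> w)\<^sup>2)) summable_on UNIV"
        by (rule summable_mult_bfun[OF p(1) bfunI[where M = G]]) (use Gz in simp)
      show "(\<lambda>z. p z * G) summable_on UNIV" by (rule summable_on_cmult_left[OF p(1)])
      show "p z * (\<Sum>\<^sub>\<infinity>w. C z w * (\<psi> z - \<psi> w)\<^sup>2) \<le> p z * G" for z
        by (rule mult_left_mono[OF Gz(2) p(2)])
    qed
    also have "\<dots> = G" by (simp add: infsum_cmult_left' p(3))
    finally show ?thesis .
  qed
  have "- energy p \<psi> = (\<Sum>\<^sub>\<infinity>q. (- 1) * Ep q)" unfolding infsum_cmult_right' by (simp add: Ep_def energy_def)
  also have "\<dots> \<le> (\<Sum>\<^sub>\<infinity>q. (- k) * Eg q + (1 / (4 * k)) * (A1 q + A2 q + (2 * \<epsilon>) * A3 q))"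
  proof (rule infsum_mono)
    show "(\<lambda>q. (- 1) * Ep q) summable_on UNIV" by (rule summable_on_cmult_right[OF sp])
    show "(\<lambda>q. (- k) * Eg q + (1 / (4 * k)) * (A1 q + A2 q + (2 * \<epsilon>) * A3 q)) summable_on UNIV"
      by (intro summable_on_add summable_on_cmult_right sg s1 s2 s3)
    fix q :: "'a \<times> 'a"
    obtain z w where q: "q = (z, w)" by (cases q)
    define a b s where "a = p z - p w" and "b = \<psi> z - \<psi> w" and "s = p z + p w + 2 * \<epsilon>"
    have s: "s > 0" using p(2)[of z] p(2)[of w] e by (simp add: s_def)
    \<comment> \<open>Compares the entropy production of one bond with a squared increment divided
      by the mean-like weight \<open>s\<close>; it follows from ln u \<le> u - 1 for the ratio of
      the smaller to the larger value.\<close>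
    have lnb: "a\<^sup>2 / s \<le> - a * (g z - g w)"
    proof -
      have *: "(u - v)\<^sup>2 / (u + v) \<le> (u - v) * (ln u - ln v)" if uv: "0 < u" "0 < v" for u v :: real
      proof -
        have *: "(u - v)\<^sup>2 / (u + v) \<le> (u - v) * (ln u - ln v)" if uv: "0 < v" "v \<le> u" for u v :: real
        proof -
          have "ln (v / u) \<le> v / u - 1" by (rule ln_le_minus_one) (use uv in simp)
          then have "(u - v) / u \<le> ln u - ln v" using uv by (simp add: ln_div diff_divide_distrib)
          then have "(u - v) * ((u - v) / u) \<le> (u - v) * (ln u - ln v)" using uv by (intro mult_left_mono) auto
          moreover have "(u - v)\<^sup>2 / (u + v) \<le> (u - v)\<^sup>2 / u" using uv by (intro divide_left_mono) auto
          ultimately show ?thesis by (simp add: power2_eq_square)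
        qed
        show ?thesis
        proof (cases "v \<le> u")
          case False
          have "(v - u)\<^sup>2 / (v + u) \<le> (v - u) * (ln v - ln u)" by (rule *) (use False uv in auto)
          then show ?thesis by (simp add: power2_commute add.commute algebra_simps)
        qed (use * uv in auto)
      qed
      show ?thesis using *[of "p z + \<epsilon>" "p w + \<epsilon>"] p(2)[of z] p(2)[of w] e
        by (simp add: a_def s_def g_def algebra_simps)
    qed
    \<comment> \<open>Young's inequality with weight \<open>s\<close>, by completing a
      square.\<close>
    have "- (a * b) \<le> k * (a\<^sup>2 / s) + b\<^sup>2 * s / (4 * k)"
    proof -
      have "0 \<le> (2 * k * a + b * s)\<^sup>2 / (4 * k * s)" using k s by simp
      also have "\<dots> = k * (a\<^sup>2 / s) + a * b + b\<^sup>2 * s / (4 * k)"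
        using k s by (simp add: power2_eq_square field_simps)
      finally show ?thesis by simp
    qed
    also have "\<dots> \<le> k * (- a * (g z - g w)) + b\<^sup>2 * s / (4 * k)"
      using lnb k by (intro add_right_mono mult_left_mono) auto
    finally have "C z w * - (a * b) \<le> C z w * (k * (- a * (g z - g w)) + b\<^sup>2 * s / (4 * k))"
      by (rule mult_left_mono) (rule C_nonneg)
    moreover have "b\<^sup>2 = (f z - f w) * (f z - f w)" by (simp add: b_def \<psi> power2_eq_square algebra_simps)
    then have "A3 q = C z w * b\<^sup>2" by (simp add: q A3_def)
    then have "A1 q + A2 q + (2 * \<epsilon>) * A3 q = C z w * (b\<^sup>2 * s)"
      by (simp add: q A1_def A2_def b_def[symmetric] s_def algebra_simps)
    ultimately show "(- 1) * Ep q \<le> (- k) * Eg q + (1 / (4 * k)) * (A1 q + A2 q + (2 * \<epsilon>) * A3 q)"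
      by (simp only:) (simp add: q Ep_def Eg_def a_def b_def algebra_simps)
  qed
  also have "\<dots> = (- k) * energy p g + (1 / (4 * k)) * (infsum A1 UNIV + infsum A1 UNIV + (2 * \<epsilon>) * energy f f)"
  proof -
    have s4: "(\<lambda>q. A1 q + A2 q + (2 * \<epsilon>) * A3 q) summable_on UNIV"
      by (intro summable_on_add summable_on_cmult_right s1 s2 s3)
    have "infsum Eg UNIV = energy p g" by (simp add: Eg_def energy_def)
    then show ?thesis
      by (simp only: infsum_add[OF summable_on_cmult_right[OF sg] summable_on_cmult_right[OF s4]]
        infsum_add[OF summable_on_add[OF s1 s2] summable_on_cmult_right[OF s3]] infsum_add[OF s1 s2]
        infsum_cmult_right' i2 i3)
  qed
  also have "\<dots> \<le> (- k) * energy p g + (1 / (4 * k)) * (G + G + (2 * \<epsilon>) * energy f f)"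
    using i1 k by (intro add_left_mono mult_left_mono[of "_ + _ + _"] add_right_mono add_mono) auto
  also have "\<dots> = (- k) * energy p g + 2 * ((G + \<epsilon> * energy f f) / (4 * k))"
    by (simp add: add_divide_distrib)
  finally have fin: "- energy p \<psi> \<le> - (k * energy p g) + 2 * ((G + \<epsilon> * energy f f) / (4 * k))" by simp
  have "k * (- (1/2) * energy p g) = - (1/2) * (k * energy p g)" by simp
  then show ?thesis unfolding g_def[symmetric] using fin by linarith
qed

end

section \<open>Closing the inequality between moment and entropy\<close>

context stable_rates
begin

lemma wtL_finite:
  assumes "0 < R"
  shows "(\<lambda>y. L - wtL L R x y) summable_on UNIV"
proof -
  have sub: "{y. L - wtL L R x y \<noteq> 0} \<subseteq> {y. ldist x y < R * (\<bar>L\<bar> powr (1 / gm))}"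
  proof clarify
    fix y assume "L - wtL L R x y \<noteq> 0"
    then have "wt R x y < L" by (auto simp: wtL_def min_def split: if_splits)
    then have l: "wt R x y < \<bar>L\<bar>" by simp
    have "(wt R x y) powr (1 / gm) = 1 + ldist x y / R" using gm assms by (simp add: wt_def powr_powr)
    then have "1 + ldist x y / R < \<bar>L\<bar> powr (1 / gm)"
      using powr_less_mono2[OF _ _ l, of "1 / gm"] gm wt_ge_1[OF assms, of x y] by simp
    then have "ldist x y / R < \<bar>L\<bar> powr (1 / gm)" by simp
    then show "ldist x y < R * (\<bar>L\<bar> powr (1 / gm))" using assms by (simp add: divide_less_eq mult.commute)
  qed
  have "(\<lambda>y. L - wtL L R x y) summable_on UNIV \<longleftrightarrow> (\<lambda>y. L - wtL L R x y) summable_on {y. L - wtL L R x y \<noteq> 0}"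
    by (rule summable_on_cong_neutral) auto
  then show ?thesis using finite_subset[OF sub finite_ball] by simp
qed

text \<open>Moment M and entropy H control each other. Gibbs gives H(T) \<le> M(T) + \<theta> ln T +
  Z, the on-diagonal bound gives H(t) \<ge> \<theta> ln t - B0, and entropy production gives M'
  \<le> k H' + G/(4 k) for every k > 0. Taking k = sqrt(t/T)/2 and integrating from 1 to T yields
  M(T) \<le> const + (H(T) - \<theta> ln T)/2, so half of M(T) can be absorbed.\<close>

lemma moment_at:
  obtains M where "\<And>T x. 1 \<le> T \<Longrightarrow>
      (\<lambda>y. ent (P T) x y * wt (T powr (1 / \<alpha>)) x y) summable_on UNIV \<and>
      (\<Sum>\<^sub>\<infinity>y. ent (P T) x y * wt (T powr (1 / \<alpha>)) x y) \<le> M"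
proof -
  obtain K0 where "0 < K0" and P0: "\<And>t x y. 0 < t \<Longrightarrow> ent (P t) x y \<le> K0 * t powr (- D / \<alpha>)"
    using on_diagonal by blast
  define K where "K = max K0 1"
  have K: "1 \<le> K" by (simp add: K_def)
  define \<theta> where "\<theta> = D / \<alpha>"
  have \<theta>: "\<theta> > 0" using D_ge_1 alpha by (simp add: \<theta>_def)
  have Pt: "ent (P t) x y \<le> K * t powr (- \<theta>)" if "0 < t" for t x y
    using order_trans[OF P0[OF that] mult_right_mono[of K0 K "t powr (- D / \<alpha>)"]] by (simp add: K_def \<theta>_def)
  obtain Z where Z: "0 < Z"
    "\<And>R F x. 1 \<le> R \<Longrightarrow> finite F \<Longrightarrow> (\<Sum>y\<in>F. exp (- wt R x y)) \<le> Z * R powr D"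
    using gaussian_sum by blast
  define B0 where "B0 = ln (2 * K)"
  \<comment> \<open>The margin 2\<theta> over the lower entropy bound pays for differentiating
    \<theta> ln t in \<open>\<Phi>\<close>.\<close>
  define B where "B = B0 + 2 * \<theta>"
  define c1 where "c1 = grad_const + 1"
  have c1: "c1 > 0" using grad_const_pos by (simp add: c1_def)
  define M where "M = 2 * (1 + drift_const + (Z + B) / 2 + c1 * 2)"
  show ?thesis
  proof (rule that[of M])
    fix T :: real and x :: "int^'d" assume T: "1 \<le> T"
    define R where "R = T powr (1 / \<alpha>)"
    have R: "1 \<le> R" unfolding R_def by (rule ge_one_powr_ge_zero) (use T alpha in auto)
    have Ra: "R powr (- \<alpha>) = 1 / T" "R powr D = T powr \<theta>"
      using alpha T by (auto simp: R_def powr_powr \<theta>_def powr_minus_divide)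
    have crude: "kapp (P t) (wtL L R x) x \<le> 1 + drift_const * t" if "1 \<le> L" "0 \<le> t" for L t
      by (rule crude_moment[OF R that])
    \<comment> \<open>A priori finiteness from the crude bound, without which the final absorption
      would be void.\<close>
    have Ms: "(\<lambda>y. ent (P T) x y * wt R x y) summable_on UNIV"
      by (rule moment_from_truncated(1)[OF _ _ crude]) (use R T in auto)
    define MT where "MT = (\<Sum>\<^sub>\<infinity>y. ent (P T) x y * wt R x y)"
    have Hup: "Hent \<epsilon> x T \<le> MT + \<theta> * ln T + Z" if e: "0 < \<epsilon>" for \<epsilon>
    proof -
      \<comment> \<open>Reference density at scale \<open>R\<close>, of mass at most
        \<open>Z\<close>; its negative logarithm is the weight plus \<theta> ln T.\<close>
      define q where "q = (\<lambda>y. exp (- wt R x y) * R powr (- D))"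
      have q: "q y > 0" "- ln (q y) = wt R x y + \<theta> * ln T" for y
        using R T alpha by (auto simp: q_def ln_mult ln_powr R_def \<theta>_def)
      have qF: "(\<Sum>y\<in>F. \<bar>q y\<bar>) \<le> Z" if "finite F" for F
      proof -
        have "(\<Sum>y\<in>F. \<bar>q y\<bar>) = (\<Sum>y\<in>F. exp (- wt R x y)) * R powr (- D)"
          by (simp add: q_def sum_distrib_right)
        also have "\<dots> \<le> Z * R powr D * R powr (- D)" by (rule mult_right_mono[OF Z(2)[OF R that]]) simp
        also have "\<dots> = Z" using R by (simp add: powr_minus)
        finally show ?thesis .
      qed
      have qs: "q summable_on UNIV" and qZ: "infsum q UNIV \<le> Z"
        using summable_on_realI[OF qF] q(1) less_imp_le by (auto cong: infsum_cong simp: abs_of_pos)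
      have s1: "(\<lambda>y. ent (P T) x y * wt R x y + ent (P T) x y * (\<theta> * ln T)) summable_on UNIV"
        by (intro summable_on_add Ms summable_on_cmult_left ent_summable)
      have "Hent \<epsilon> x T \<le> (\<Sum>\<^sub>\<infinity>y. (ent (P T) x y * wt R x y + ent (P T) x y * (\<theta> * ln T)) + q y)"
        unfolding Hent_def
      proof (rule infsum_mono[OF Hent_summable[OF e] summable_on_add[OF s1 qs]])
        fix y
        have "reg_ent \<epsilon> (ent (P T) x y) \<le> - ent (P T) x y * ln (q y) + q y"
          by (rule reg_ent_upper[OF e P_nonneg q(1)]) (use T in simp)
        also have "- ent (P T) x y * ln (q y) = ent (P T) x y * - ln (q y)" by simp
        finally show "reg_ent \<epsilon> (ent (P T) x y) \<le> (ent (P T) x y * wt R x y + ent (P T) x y * (\<theta> * ln T)) + q y"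
          unfolding q(2) by (simp add: distrib_left)
      qed (use T in simp)
      also have "\<dots> = (MT + \<theta> * ln T) + infsum q UNIV"
        by (simp add: infsum_add[OF s1 qs] infsum_add[OF Ms summable_on_cmult_left[OF ent_summable]]
            infsum_cmult_left' P_sum MT_def)
      finally show ?thesis using qZ by linarith
    qed
    have trunc: "kapp (P T) (wtL L R x) x \<le> 1 + drift_const + (MT + Z + B) / 2 + c1 * 2" if L: "1 \<le> L" for L
    proof -
      define \<psi> where "\<psi> = wtL L R x"
      define f where "f = (\<lambda>y. L - \<psi> y)"
      have f: "f summable_on UNIV" unfolding f_def \<psi>_def by (rule wtL_finite) (use R in simp)
      have \<psi>f: "\<psi> = (\<lambda>y. L - f y)" by (simp add: f_def)
      have b\<psi>: "bfun \<psi>" unfolding \<psi>_def by (rule bfun_wtL) (use R L in auto)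
      \<comment> \<open>The first bound lets adding \<epsilon> at most double the on-diagonal bound
        for all t \<le> T. The second keeps the \<epsilon>-term of the entropy production below 1/T,
        which is R^(-\<alpha>).\<close>
      define \<epsilon> where "\<epsilon> = min (K * T powr (- \<theta>)) (1 / (T * (energy f f + 1)))"
      have ff: "0 \<le> energy f f" by (rule energy_nonneg)
      have e: "0 < \<epsilon>" using K T ff by (simp add: \<epsilon>_def)
      have eE: "\<epsilon> * energy f f \<le> 1 / T"
      proof -
        have "\<epsilon> * energy f f \<le> (1 / (T * (energy f f + 1))) * energy f f"
          by (rule mult_right_mono[OF _ ff]) (simp add: \<epsilon>_def)
        also have "\<dots> = 1 / T * (energy f f / (energy f f + 1))" by simp
        also have "\<dots> \<le> 1 / T * 1" using T ff by (intro mult_left_mono) (auto simp: divide_le_eq)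
        finally show ?thesis by simp
      qed
      have Hlow: "\<theta> * ln t - B0 \<le> Hent \<epsilon> x t" if t: "1 \<le> t" "t \<le> T" for t
      proof -
        define l where "l = ln (2 * K * t powr (- \<theta>))"
        have l: "l = B0 - \<theta> * ln t" using t K by (simp add: l_def B0_def ln_mult ln_powr)
        have "(\<Sum>\<^sub>\<infinity>y. ent (P t) x y * - l) \<le> Hent \<epsilon> x t"
          unfolding Hent_def
        proof (rule infsum_mono[OF summable_on_cmult_left[OF ent_summable] Hent_summable[OF e]])
          fix y
          have p0: "0 \<le> ent (P t) x y" by (rule P_nonneg) (use t in simp)
          have "\<epsilon> \<le> K * T powr (- \<theta>)" by (simp add: \<epsilon>_def)
          also have "\<dots> \<le> K * t powr (- \<theta>)" using t K \<theta> by (intro mult_left_mono powr_mono2') auto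
          finally have "ent (P t) x y + \<epsilon> \<le> 2 * K * t powr (- \<theta>)" using Pt[of t x y] t by linarith
          then have "ln (ent (P t) x y + \<epsilon>) \<le> l" unfolding l_def using p0 e by simp
          then have "ent (P t) x y * - l \<le> - ent (P t) x y * ln (ent (P t) x y + \<epsilon>)" using p0 by (simp add: mult_left_mono)
          also have "\<dots> \<le> reg_ent \<epsilon> (ent (P t) x y)" by (rule reg_ent_lower[OF e p0])
          finally show "ent (P t) x y * - l \<le> reg_ent \<epsilon> (ent (P t) x y)" .
        qed (use t in simp)
        then show ?thesis by (simp only: infsum_cmult_left' P_sum) (simp add: l)
      qed
      define w where "w = (\<lambda>t. sqrt t / sqrt T)"
      \<comment> \<open>With k = w/2 the error of the entropy production is at most c1 / (2 T w),
        which is c1 w / (2 t) because w^2 = t/T; the derivative of the last term dominates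
        it.\<close>
      define \<Phi> where "\<Phi> = (\<lambda>t. kapp (P t) \<psi> x - w t * (Hent \<epsilon> x t - \<theta> * ln t + B) / 2 - 2 * c1 * w t)"
      have "\<Phi> T \<le> \<Phi> 1"
      proof (rule DERIV_nonpos_imp_nonincreasing[OF T])
        fix t assume t: "1 \<le> t" "t \<le> T"
        define p where "p = ent (P t) x"
        define g where "g = (\<lambda>y. - ln (p y + \<epsilon>))"
        define H' where "H' = kapp (P t) (kapp gen g) x"
        define M' where "M' = kapp (P t) (kapp gen \<psi>) x"
        have bg: "bfun g" unfolding g_def p_def by (rule bfun_log) (use e t in auto)
        have w0: "w t > 0" using t T by (simp add: w_def)
        have ww: "w t * w t = t / T" using t T by (simp add: w_def)
        have dw: "(w has_real_derivative w t / (2 * t)) (at t)"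
        proof -
          have "(w has_real_derivative inverse (sqrt t) / 2 / sqrt T) (at t)"
            unfolding w_def by (rule DERIV_cdivide[OF DERIV_real_sqrt]) (use t in simp)
          moreover have "inverse (sqrt t) = sqrt t / t" using t by (simp add: inverse_eq_divide real_div_sqrt field_simps)
          then have "inverse (sqrt t) / 2 / sqrt T = w t / (2 * t)" by (simp add: w_def)
          ultimately show ?thesis by simp
        qed
        have dH: "(Hent \<epsilon> x has_real_derivative H') (at t)"
          unfolding H'_def g_def p_def by (rule DERIV_Hent) (use e t in auto)
        have dM: "((\<lambda>t. kapp (P t) \<psi> x) has_real_derivative M') (at t)"
          unfolding M'_def by (rule DERIV_kapp_P[OF b\<psi>])
        define H where "H = Hent \<epsilon> x t"
        define X where "X = M' - (w t * (H' - \<theta> / t) + w t / (2 * t) * (H - \<theta> * ln t + B)) / 2 - 2 * c1 * (w t / (2 * t))"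
        have d\<Phi>: "(\<Phi> has_real_derivative X) (at t)"
        proof -
          have "((\<lambda>t. Hent \<epsilon> x t - \<theta> * ln t + B) has_real_derivative H' - \<theta> * (1 / t) + 0) (at t)"
            by (intro DERIV_add DERIV_diff dH DERIV_cmult DERIV_ln_divide DERIV_const) (use t in simp)
          from DERIV_cdivide[OF DERIV_mult'[OF dw this], of 2]
          have "((\<lambda>t. w t * (Hent \<epsilon> x t - \<theta> * ln t + B) / 2) has_real_derivative
             (w t * (H' - \<theta> / t) + w t / (2 * t) * (H - \<theta> * ln t + B)) / 2) (at t)" by (simp add: H_def)
          from DERIV_diff[OF DERIV_diff[OF dM this] DERIV_cmult[OF dw, of "2 * c1"]]
          show ?thesis unfolding \<Phi>_def X_def .
        qed
        have M'e: "M' = - (1/2) * energy p \<psi>"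
          using dirichlet(2)[OF ent_summable b\<psi>] unfolding M'_def p_def kapp_def[of "P t"] by blast
        have H'e: "H' = - (1/2) * energy p g"
          using dirichlet(2)[OF ent_summable bg] unfolding H'_def p_def kapp_def[of "P t"] by blast
        have "M' \<le> (w t / 2) * H' + (grad_const * R powr (- \<alpha>) + \<epsilon> * energy f f) / (4 * (w t / 2))"
          unfolding M'e H'e g_def
        proof (rule entropy_production[OF _ _ _ e _ f \<psi>f])
          show "p summable_on UNIV" "(\<Sum>\<^sub>\<infinity>y. p y) = 1" by (simp_all add: p_def ent_summable P_sum)
          show "0 \<le> p y" for y using t by (simp add: p_def P_nonneg)
          show "0 < w t / 2" using w0 by simp
          show "(\<Sum>z\<in>F. C y z * (\<psi> y - \<psi> z)\<^sup>2) \<le> grad_const * R powr (- \<alpha>)" if "finite F" for y F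
            unfolding \<psi>_def by (rule gradient_bound[OF R that])
          show "bfun (\<lambda>y. - ln (p y + \<epsilon>))" using bg by (simp add: g_def)
        qed
        also have "(grad_const * R powr (- \<alpha>) + \<epsilon> * energy f f) / (4 * (w t / 2)) \<le> (c1 * (1 / T)) / (4 * (w t / 2))"
          using eE w0 by (intro divide_right_mono) (auto simp: Ra c1_def add_divide_distrib)
        also have "\<dots> = c1 * (w t / (2 * t))"
        proof -
          have "1 / (T * w t) = w t / t" using ww w0 t T by (simp add: field_simps)
          moreover have "(c1 * (1 / T)) / (4 * (w t / 2)) = c1 / 2 * (1 / (T * w t))" by simp
          ultimately show ?thesis by simp
        qed
        finally have 1: "M' \<le> (w t / 2) * H' + c1 * (w t / (2 * t))" by simp
        have "w t / (2 * t) * (2 * \<theta>) \<le> w t / (2 * t) * (H - \<theta> * ln t + B)"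
          using Hlow[OF t] w0 t by (intro mult_left_mono) (auto simp: H_def B_def)
        then have 2: "w t * \<theta> / t \<le> w t / (2 * t) * (H - \<theta> * ln t + B)" by simp
        have c: "0 \<le> c1 * (w t / (2 * t))" using c1 w0 t by simp
        have "X \<le> 0"
        proof -
          define a u v c' where "a = w t * H'" and "u = w t * \<theta> / t"
            and "v = w t / (2 * t) * (H - \<theta> * ln t + B)" and "c' = c1 * (w t / (2 * t))"
          have "X = M' - (a - u + v) / 2 - 2 * c'"
            unfolding X_def a_def u_def v_def c'_def by (simp add: right_diff_distrib)
          then have "2 * X = 2 * M' - a + u - v - 4 * c'" by (simp add: field_simps)
          moreover have "M' \<le> a / 2 + c'" using 1 by (simp add: a_def c'_def)
          moreover have "u \<le> v" using 2 unfolding u_def v_def .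
          moreover have "0 \<le> c'" using c by (simp add: c'_def)
          ultimately show ?thesis by linarith
        qed
        with d\<Phi> show "\<exists>y. (\<Phi> has_real_derivative y) (at t) \<and> y \<le> 0" by blast
      qed
      also have "\<Phi> 1 \<le> kapp (P 1) \<psi> x"
      proof -
        have "0 \<le> w 1" using T by (simp add: w_def)
        moreover have "0 \<le> Hent \<epsilon> x 1 - \<theta> * ln 1 + B" using Hlow[of 1] T \<theta> by (simp add: B_def)
        ultimately have "0 \<le> w 1 * (Hent \<epsilon> x 1 - \<theta> * ln 1 + B) / 2" "0 \<le> 2 * c1 * w 1" using c1 by auto
        then show ?thesis by (simp add: \<Phi>_def)
      qed
      also have "\<dots> \<le> 1 + drift_const" using crude[OF L, of 1] by (simp add: \<psi>_def)
      finally have "kapp (P T) \<psi> x \<le> 1 + drift_const + (Hent \<epsilon> x T - \<theta> * ln T + B) / 2 + 2 * c1"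
        using T by (simp add: \<Phi>_def w_def)
      also have "\<dots> \<le> 1 + drift_const + (MT + Z + B) / 2 + c1 * 2" using Hup[OF e] by simp
      finally show ?thesis by (simp add: \<psi>_def)
    qed
    \<comment> \<open>The truncation level tends to infinity on the left only; \<open>MT\<close> is
      finite, so its half can be moved over.\<close>
    have "MT \<le> 1 + drift_const + (MT + Z + B) / 2 + c1 * 2"
      unfolding MT_def by (rule moment_from_truncated(2)) (use R T trunc in \<open>auto simp: MT_def\<close>)
    then have "MT \<le> M" by (simp add: M_def field_simps)
    then show "(\<lambda>y. ent (P T) x y * wt (T powr (1 / \<alpha>)) x y) summable_on UNIV \<and>
      (\<Sum>\<^sub>\<infinity>y. ent (P T) x y * wt (T powr (1 / \<alpha>)) x y) \<le> M"
      using Ms by (simp add: MT_def R_def)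
  qed
qed

text \<open>From time T to all earlier times: for s \<ge> 1 the weight at the larger scale is the
  smaller one, and for s < 1 the crude bound is enough.\<close>

lemma moment:
  obtains M where "1 \<le> M" "\<And>T s x. 1 \<le> T \<Longrightarrow> 0 \<le> s \<Longrightarrow> s \<le> T \<Longrightarrow>
      (\<lambda>y. ent (P s) x y * wt (T powr (1 / \<alpha>)) x y) summable_on UNIV"
    "\<And>T s x. 1 \<le> T \<Longrightarrow> 0 \<le> s \<Longrightarrow> s \<le> T \<Longrightarrow>
      (\<Sum>\<^sub>\<infinity>y. ent (P s) x y * wt (T powr (1 / \<alpha>)) x y) \<le> M"
proof -
  obtain M0 where M0: "\<And>T x. 1 \<le> T \<Longrightarrow>
      (\<lambda>y. ent (P T) x y * wt (T powr (1 / \<alpha>)) x y) summable_on UNIV \<and>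
      (\<Sum>\<^sub>\<infinity>y. ent (P T) x y * wt (T powr (1 / \<alpha>)) x y) \<le> M0"
    using moment_at by blast
  define M where "M = max M0 (1 + drift_const)"
  have main: "(\<lambda>y. ent (P s) x y * wt (T powr (1 / \<alpha>)) x y) summable_on UNIV \<and>
      (\<Sum>\<^sub>\<infinity>y. ent (P s) x y * wt (T powr (1 / \<alpha>)) x y) \<le> M" if T: "1 \<le> T" "0 \<le> s" "s \<le> T" for T s x
  proof (cases "1 \<le> s")
    case True
    have s0: "0 < s powr (1 / \<alpha>)" using True by simp
    have le: "wt (T powr (1 / \<alpha>)) x y \<le> wt (s powr (1 / \<alpha>)) x y" for y
      unfolding wt_def using True T alpha gm
      by (intro powr_mono2 add_left_mono divide_left_mono powr_mono2 mult_pos_pos) auto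
    have w0: "0 \<le> wt (T powr (1 / \<alpha>)) x y" for y by (simp add: wt_def)
    have le2: "ent (P s) x y * wt (T powr (1 / \<alpha>)) x y \<le> ent (P s) x y * wt (s powr (1 / \<alpha>)) x y" for y
      by (rule mult_left_mono[OF le P_nonneg[OF T(2)]])
    have s: "(\<lambda>y. ent (P s) x y * wt (T powr (1 / \<alpha>)) x y) summable_on UNIV"
      by (rule summable_on_real_bound[OF M0[OF True, THEN conjunct1, of x]])
         (use le2 P_nonneg[OF T(2)] w0 in \<open>simp add: abs_mult\<close>)
    have "(\<Sum>\<^sub>\<infinity>y. ent (P s) x y * wt (T powr (1 / \<alpha>)) x y) \<le> (\<Sum>\<^sub>\<infinity>y. ent (P s) x y * wt (s powr (1 / \<alpha>)) x y)"
      by (rule infsum_mono[OF s M0[OF True, THEN conjunct1]]) (rule le2)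
    also have "\<dots> \<le> M0" by (rule M0[OF True, THEN conjunct2])
    also have "\<dots> \<le> M" by (simp add: M_def)
    finally show ?thesis using s by blast
  next
    case False
    have R: "1 \<le> T powr (1 / \<alpha>)" by (rule ge_one_powr_ge_zero) (use T alpha in auto)
    have B: "kapp (P s) (wtL L (T powr (1 / \<alpha>)) x) x \<le> 1 + drift_const" if "1 \<le> L" for L
    proof -
      have "kapp (P s) (wtL L (T powr (1 / \<alpha>)) x) x \<le> 1 + drift_const * s" by (rule crude_moment[OF R that T(2)])
      also have "\<dots> \<le> 1 + drift_const" using False drift_const_pos by simp
      finally show ?thesis .
    qed
    have "(\<lambda>y. ent (P s) x y * wt (T powr (1 / \<alpha>)) x y) summable_on UNIV"
         "(\<Sum>\<^sub>\<infinity>y. ent (P s) x y * wt (T powr (1 / \<alpha>)) x y) \<le> 1 + drift_const"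
      using moment_from_truncated[OF less_le_trans[OF zero_less_one R] T(2) B] by auto
    then show ?thesis by (simp add: M_def)
  qed
  show ?thesis
  proof (rule that[of M])
    show "1 \<le> M" using drift_const_pos by (simp add: M_def)
  qed (use main in auto)
qed

end

section \<open>Coupling by one large jump\<close>

context stable_rates
begin

text \<open>Markov's inequality for the weight, which is at least (\<rho>/R)^gm at distance
  \<rho>.\<close>

lemma tail_prob:
  assumes M: "\<And>T s x. 1 \<le> T \<Longrightarrow> 0 \<le> s \<Longrightarrow> s \<le> T \<Longrightarrow>
      (\<lambda>y. ent (P s) x y * wt (T powr (1 / \<alpha>)) x y) summable_on UNIV"
    "\<And>T s x. 1 \<le> T \<Longrightarrow> 0 \<le> s \<Longrightarrow> s \<le> T \<Longrightarrow>
      (\<Sum>\<^sub>\<infinity>y. ent (P s) x y * wt (T powr (1 / \<alpha>)) x y) \<le> M"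
    and T: "1 \<le> T" "0 \<le> s" "s \<le> T" and \<rho>: "0 < \<rho>"
    and A: "\<And>y. y \<in> A \<Longrightarrow> \<rho> \<le> ldist x y"
  shows "kapp (P s) (\<lambda>y. if y \<in> A then 1 else 0) x \<le> M * (T powr (1 / \<alpha>) / \<rho>) powr gm"
proof -
  define R where "R = T powr (1 / \<alpha>)"
  have R: "0 < R" using T by (simp add: R_def)
  have "kapp (P s) (\<lambda>y. if y \<in> A then 1 else 0) x \<le> (\<Sum>\<^sub>\<infinity>y. ent (P s) x y * wt R x y * (R / \<rho>) powr gm)"
    unfolding kapp_def
  proof (rule infsum_mono[OF kapp_summable[OF bfun_indicator]])
    show "(\<lambda>y. ent (P s) x y * wt R x y * (R / \<rho>) powr gm) summable_on UNIV"
      unfolding R_def by (rule summable_on_cmult_left[OF M(1)[OF T]])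
    fix y
    show "ent (P s) x y * (if y \<in> A then 1 else 0) \<le> ent (P s) x y * wt R x y * (R / \<rho>) powr gm"
    proof (cases "y \<in> A")
      case True
      have "1 = (\<rho> / R * (R / \<rho>)) powr gm" using R \<rho> by simp
      also have "\<dots> = (\<rho> / R) powr gm * (R / \<rho>) powr gm" by (rule powr_mult)
      also have "(\<rho> / R) powr gm \<le> wt R x y"
        unfolding wt_def
      proof (rule powr_mono2)
        have "\<rho> / R \<le> ldist x y / R" using A[OF True] R by (simp add: divide_right_mono)
        then show "\<rho> / R \<le> 1 + ldist x y / R" by simp
      qed (use R \<rho> gm in auto)
      finally have "1 \<le> wt R x y * (R / \<rho>) powr gm" by (simp add: mult_right_mono)
      then have "ent (P s) x y * 1 \<le> ent (P s) x y * (wt R x y * (R / \<rho>) powr gm)"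
        by (rule mult_left_mono[OF _ P_nonneg[OF T(2)]])
      then show ?thesis using True by (simp add: mult.assoc)
    qed (use P_nonneg[OF T(2), of x y] wt_ge_1[OF R, of x y] in simp)
  qed
  also have "\<dots> = (\<Sum>\<^sub>\<infinity>y. ent (P s) x y * wt R x y) * (R / \<rho>) powr gm" by (rule infsum_cmult_left')
  also have "\<dots> \<le> M * (R / \<rho>) powr gm" unfolding R_def by (rule mult_right_mono[OF M(2)[OF T]]) simp
  finally show ?thesis by (simp add: R_def)
qed

text \<open>Split at the first ring of a clock of rate \<open>l\<close> that triggers the split-off
  jumps. Until then each remaining process has left the neighbourhood with probability at most 1/24;
  at the ring the target rows of nearby points share mass 1/6. The difference is thus at most 5/6 +
  2/24 = 11/12 after a ring and 1 without one, and a ring by time T has probability at least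
  \<open>1 - exp (- a0)\<close>.\<close>

lemma overlap:
  obtains A e r0 where "0 < A" "A \<le> 1" "0 < e" "e < 1" "1 \<le> r0"
    "\<And>r. r0 \<le> r \<Longrightarrow> 1 \<le> A * r powr \<alpha>"
    "\<And>r x1 x2 f. r0 \<le> r \<Longrightarrow> ldist x1 x2 \<le> r \<Longrightarrow> (\<And>y. 0 \<le> f y) \<Longrightarrow> (\<And>y. f y \<le> 1) \<Longrightarrow>
      kapp (P (A * r powr \<alpha>)) f x1 - kapp (P (A * r powr \<alpha>)) f x2 \<le> 1 - e"
proof -
  obtain \<delta> where \<delta>: "0 < \<delta>" "\<delta> \<le> 1"
    and good: "\<And>R1. 1 \<le> R1 \<Longrightarrow> \<exists>R. R1 \<le> R \<and> R \<le> 2 * R1 \<and> lvol TYPE('d) ((1 + \<delta>) * R) \<le> 3/2 * lvol TYPE('d) R"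
    using good_radius[where ?'d = 'd] by blast
  obtain M where M1: "1 \<le> M" and M: "\<And>T s x. 1 \<le> T \<Longrightarrow> 0 \<le> s \<Longrightarrow> s \<le> T \<Longrightarrow>
      (\<lambda>y. ent (P s) x y * wt (T powr (1 / \<alpha>)) x y) summable_on UNIV"
    "\<And>T s x. 1 \<le> T \<Longrightarrow> 0 \<le> s \<Longrightarrow> s \<le> T \<Longrightarrow>
      (\<Sum>\<^sub>\<infinity>y. ent (P s) x y * wt (T powr (1 / \<alpha>)) x y) \<le> M"
    using moment by blast
  \<comment> \<open>The three demands are A \<le> 1, \<open>l * T \<le> 1\<close>, and an escape
    probability 3 M A^(gm/\<alpha>) of at most 1/24, where 3 bounds exp 1.\<close>
  define A where "A = min (min 1 (1 / (\<kappa>3 * 3 ^ CARD('d)))) ((1 / (72 * M)) powr (\<alpha> / gm))"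
  have A: "0 < A" "A \<le> 1" "A \<le> 1 / (\<kappa>3 * 3 ^ CARD('d))" "A \<le> (1 / (72 * M)) powr (\<alpha> / gm)"
    using kappa3 M1 by (auto simp: A_def)
  have A72: "3 * (M * A powr (gm / \<alpha>)) \<le> 1 / 24"
  proof -
    have "A powr (gm / \<alpha>) \<le> ((1 / (72 * M)) powr (\<alpha> / gm)) powr (gm / \<alpha>)"
      by (rule powr_mono2) (use A gm alpha in auto)
    also have "\<dots> = 1 / (72 * M)" using gm alpha M1 by (simp add: powr_powr)
    finally have "3 * (M * A powr (gm / \<alpha>)) \<le> 3 * (M * (1 / (72 * M)))"
      using M1 by (intro mult_left_mono) auto
    also have "\<dots> = 1 / 24" using M1 by simp
    finally show ?thesis .
  qed
  \<comment> \<open>A lower bound for \<open>l * T\<close>, from R \<le> (8/\<delta>) r and the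
    lower volume bound.\<close>
  define a0 where "a0 = \<kappa>3 / real CARD('d) ^ CARD('d) * (8 / \<delta>) powr (- \<alpha>) * A"
  have a0: "0 < a0" using kappa3 A \<delta> by (simp add: a0_def)
  define e where "e = (1 - exp (- a0)) / 12"
  have e: "0 < e" "e < 1" using a0 exp_gt_zero[of "- a0"] by (simp_all add: e_def) (smt (verit) exp_gt_zero)
  \<comment> \<open>Above \<open>r0\<close> the condition (A4) applies and the time A r^\<alpha> is
    at least 1, as the moment bound demands.\<close>
  define r0 where "r0 = max \<Theta>1 (max 1 (A powr (- 1 / \<alpha>)))"
  have Ar: "1 \<le> A * r powr \<alpha>" if "r0 \<le> r" for r
  proof -
    have "A powr (- 1 / \<alpha>) \<le> r" using that by (simp add: r0_def)
    then have "(A powr (- 1 / \<alpha>)) powr \<alpha> \<le> r powr \<alpha>" by (rule powr_mono2[rotated 2]) (use alpha in auto)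
    moreover have "(A powr (- 1 / \<alpha>)) powr \<alpha> = A powr (- 1)" unfolding powr_powr using alpha by simp
    moreover have "A powr (- 1) = 1 / A" using A by (simp add: powr_minus_divide)
    ultimately show ?thesis using A by (simp add: divide_le_eq mult.commute)
  qed
  show ?thesis
  proof (rule that[OF A(1,2) e _ Ar])
    show "1 \<le> r0" by (simp add: r0_def)
    fix r :: real and x1 x2 :: "int^'d" and f :: "int^'d \<Rightarrow> real"
    assume r: "r0 \<le> r" and x12: "ldist x1 x2 \<le> r" and f: "\<And>y. 0 \<le> f y" "\<And>y. f y \<le> 1"
    have r1: "1 \<le> r" "\<Theta>1 \<le> r" using r by (auto simp: r0_def)
    define T where "T = A * r powr \<alpha>"
    have T: "1 \<le> T" unfolding T_def by (rule Ar[OF r])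
    \<comment> \<open>Gives r \<le> \<delta> R / 4, so that both starting points are at distance at
      least \<delta> R / 4 from the complement of the ball \<open>N\<close> of radius \<delta> R /
      2.\<close>
    define R1 where "R1 = 4 * r / \<delta>"
    have R1: "r \<le> R1" using \<delta> r1 by (simp add: R1_def le_divide_eq)
    obtain R where R: "R1 \<le> R" "R \<le> 2 * R1" "lvol TYPE('d) ((1 + \<delta>) * R) \<le> 3/2 * lvol TYPE('d) R"
      using good[of R1] R1 r1 by auto
    have R': "1 \<le> R" "\<Theta>1 \<le> R" "r \<le> R" "r \<le> \<delta> * R / 4" "R \<le> 8 / \<delta> * r"
    proof -
      show "1 \<le> R" "\<Theta>1 \<le> R" "r \<le> R" using R(1) R1 r1 by linarith+
      show "r \<le> \<delta> * R / 4" "R \<le> 8 / \<delta> * r" using R(1,2) \<delta> by (simp_all add: R1_def field_simps)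
    qed
    define V where "V = lvol TYPE('d) R"
    have V: "0 < V" unfolding V_def by (rule lvol_pos) (use R' in simp)
    define \<kappa> where "\<kappa> = \<kappa>3 * R powr (- (D + \<alpha>))"
    have \<kappa>: "0 < \<kappa>" using kappa3 R' by (simp add: \<kappa>_def)
    define l where "l = \<kappa> * V"
    have l: "0 < l" using \<kappa> V by (simp add: l_def)
    have lT: "l * T \<le> 1" "a0 \<le> l * T"
    proof -
      have RR: "\<kappa> * R powr D = \<kappa>3 * R powr (- \<alpha>)"
        unfolding \<kappa>_def mult.assoc powr_add[symmetric] by simp
      have "l \<le> \<kappa> * (3 ^ CARD('d) * R powr D)"
        unfolding l_def V_def D_def using lvol_le_powr[OF R'(1), where ?'d = 'd] \<kappa> by (intro mult_left_mono) auto
      also have "\<dots> = \<kappa>3 * 3 ^ CARD('d) * R powr (- \<alpha>)" using RR by (simp add: mult_ac)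
      also have "\<dots> \<le> \<kappa>3 * 3 ^ CARD('d) * r powr (- \<alpha>)"
        using kappa3 R' r1 alpha by (intro mult_left_mono powr_mono2') auto
      finally have "l * T \<le> \<kappa>3 * 3 ^ CARD('d) * r powr (- \<alpha>) * T" using T by (intro mult_right_mono) auto
      also have "\<dots> = \<kappa>3 * 3 ^ CARD('d) * A" using r1 by (simp add: T_def powr_minus field_simps)
      also have "\<dots> \<le> 1" using A(3) kappa3 by (simp add: field_simps)
      finally show "l * T \<le> 1" .
      have "a0 = \<kappa>3 / real CARD('d) ^ CARD('d) * (8 / \<delta>) powr (- \<alpha>) * A" by (simp add: a0_def)
      also have "\<dots> = \<kappa>3 / real CARD('d) ^ CARD('d) * (8 / \<delta> * r) powr (- \<alpha>) * T"
        using r1 \<delta> powr_mult[of "8 / \<delta>" r "- \<alpha>"] by (simp add: T_def powr_minus field_simps)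
      also have "\<dots> \<le> \<kappa>3 / real CARD('d) ^ CARD('d) * R powr (- \<alpha>) * T"
        using kappa3 R' r1 alpha T by (intro mult_right_mono mult_left_mono powr_mono2') auto
      also have "\<dots> = \<kappa> * (R powr D / real CARD('d) ^ CARD('d)) * T" using RR by simp
      also have "\<dots> \<le> l * T"
        unfolding l_def V_def D_def using lvol_ge_powr[of R, where ?'d = 'd] R' \<kappa> T
        by (intro mult_right_mono mult_left_mono) auto
      finally show "a0 \<le> l * T" .
    qed
    \<comment> \<open>Capping at the common level \<open>\<kappa>\<close> makes the split-off jumps
      uniform over the good targets, where the rate is at least \<open>\<kappa>\<close>.\<close>
    define C2 where "C2 = (\<lambda>x y. if ldist x y < R then min (C x y) \<kappa> else 0)"
    define C1 where "C1 = (\<lambda>x y. C x y - C2 x y)"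
    have C2: "0 \<le> C2 x y" "C2 x y \<le> C x y" for x y using \<kappa> by (auto simp: C2_def C_nonneg)
    have C2F: "(\<Sum>y\<in>F. C2 x y) \<le> l" if "finite F" for x F
    proof -
      have "(\<Sum>y\<in>F. C2 x y) = (\<Sum>y\<in>{y\<in>F. ldist x y < R}. C2 x y)"
        by (rule sum.mono_neutral_right) (use that in \<open>auto simp: C2_def\<close>)
      also have "\<dots> \<le> (\<Sum>y\<in>{y\<in>F. ldist x y < R}. \<kappa>)" by (rule sum_mono) (simp add: C2_def)
      also have "\<dots> = \<kappa> * real (card {y\<in>F. ldist x y < R})" by simp
      also have "\<dots> \<le> \<kappa> * real (card {y. ldist x y < R})"
        using \<kappa> by (intro mult_left_mono) (auto intro!: card_mono finite_ball)
      finally show ?thesis by (simp add: card_ball l_def V_def)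
    qed
    interpret S: conductance C1 "K1 * shell_const TYPE('d) \<alpha>"
    proof
      fix x y :: "int^'d" and F :: "(int^'d) set"
      show "0 \<le> C1 x y" using C2 by (simp add: C1_def)
      show "C1 x y = C1 y x" using ldist_commute[of x y] C_sym[of x y] by (simp add: C1_def C2_def)
      show "C1 x x = 0" using \<kappa> by (simp add: C1_def C2_def C_diag)
      assume "finite F"
      have "(\<Sum>y\<in>F. C1 x y) \<le> (\<Sum>y\<in>F. C x y)" by (rule sum_mono) (simp add: C1_def C2)
      also have "\<dots> \<le> K1 * shell_const TYPE('d) \<alpha>" by (rule C_bound[OF \<open>finite F\<close>])
      finally show "(\<Sum>y\<in>F. C1 x y) \<le> K1 * shell_const TYPE('d) \<alpha>" .
    qed
    \<comment> \<open>The split-off jumps, padded with stays in place to total rate \<open>l\<close>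
      everywhere, so that one exponential clock serves all starting points.\<close>
    define J where "J = 1 + (1 / l) *\<^sub>R (gen - S.gen)"
    have genJ: "gen = S.gen + l *\<^sub>R (J - 1)" using l by (simp add: J_def)
    have C1C: "C x y - C1 x y = C2 x y" for x y by (simp add: C1_def)
    have J_off: "ent J x y = C2 x y / l" if "x \<noteq> y" for x y
      using that by (simp add: J_def ent_one ent_gen S.ent_gen C1C)
    have J_nonneg: "0 \<le> ent J x y" for x y
    proof (cases "x = y")
      case True
      have C2s: "C2 x summable_on UNIV" and C2l: "(\<Sum>\<^sub>\<infinity>y. C2 x y) \<le> l"
        using summable_on_realI[of "C2 x" l] C2F C2(1) by auto
      have "rate x - S.rate x = (\<Sum>\<^sub>\<infinity>y. C2 x y)"
        unfolding rate_def S.rate_def using infsum_diff_real(2)[OF C_summable S.C_summable, of x x] by (simp add: C1C)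
      then show ?thesis using C2l l True by (simp add: J_def ent_one ent_gen S.ent_gen field_simps)
    qed (use J_off C2 l in auto)
    have J_one: "kapp J (\<lambda>_. 1) x = 1" for x
    proof -
      have "kapp J (\<lambda>_. 1) x = kapp 1 (\<lambda>_. 1) x + (1 / l) * kapp (gen + (- 1) *\<^sub>R S.gen) (\<lambda>_. 1) x"
        by (simp add: J_def kapp_plus bfun_const kapp_scaleR)
      also have "kapp (gen + (- 1) *\<^sub>R S.gen) (\<lambda>_. 1) x = 0"
        by (simp only: kapp_plus[OF bfun_const] kapp_scaleR) (simp add: kapp_gen(1)[OF bfun_const] S.kapp_gen(1)[OF bfun_const])
      finally show ?thesis using infsum_single(3)[of x "\<lambda>_. 1"] by (simp add: kapp_def ent_one)
    qed
    have J_bounds: "0 \<le> kapp J g x" "kapp J g x \<le> 1" if "\<And>y. 0 \<le> g y" "\<And>y. g y \<le> 1" for g x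
    proof -
      have b: "bfun g" by (rule bfun_unit) (use that in auto)
      show "0 \<le> kapp J g x" by (rule kapp_nonneg[OF J_nonneg that(1)])
      have "kapp J g x \<le> kapp J (\<lambda>_. 1) x" by (rule kapp_mono[OF J_nonneg b bfun_const that(2)])
      then show "kapp J g x \<le> 1" by (simp add: J_one)
    qed
    define G where "G = (\<lambda>w. {y. ldist w y < R \<and> y \<noteq> w \<and> \<kappa>3 * ldist w y powr (- (real CARD('d) + \<alpha>)) \<le> C w y})"
    have GB: "G w \<subseteq> {y. ldist w y < R}" for w by (auto simp: G_def)
    have Gfin: "finite (G w)" for w by (rule finite_subset[OF GB finite_ball])
    have Gcard: "5/6 * V \<le> real (card (G w))" for w
      using good_card[OF R'(2), of w] by (simp add: card_ball V_def G_def)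
    have JG: "ent J w y = 1 / V" if "y \<in> G w" for w y
    proof -
      have y: "ldist w y < R" "w \<noteq> y" "\<kappa>3 * ldist w y powr (- (D + \<alpha>)) \<le> C w y"
        using that by (auto simp: G_def D_def)
      have "\<kappa> \<le> \<kappa>3 * ldist w y powr (- (D + \<alpha>))"
        unfolding \<kappa>_def using kappa3 y ldist_ge_1[OF y(2)] alpha D_ge_1 by (intro mult_left_mono powr_mono2') auto
      then have "C2 w y = \<kappa>" using y by (simp add: C2_def min_def)
      then show ?thesis using J_off[OF y(2)] \<kappa> V by (simp add: l_def)
    qed
    have JGsum: "(\<Sum>y\<in>H. g y) / V \<le> kapp J g w" if "H \<subseteq> G w" "\<And>y. 0 \<le> g y" "\<And>y. g y \<le> 1" for g w H
    proof -
      have b: "bfun g" by (rule bfun_unit) (use that in auto)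
      have "(\<Sum>y\<in>H. g y) / V = (\<Sum>y\<in>H. ent J w y * g y)"
        unfolding sum_divide_distrib by (rule sum.cong) (use JG that(1) in auto)
      also have "\<dots> \<le> kapp J g w"
        unfolding kapp_def
        by (rule finite_sum_le_infsum[OF kapp_summable[OF b] finite_subset[OF that(1) Gfin]]) (use J_nonneg that in auto)
      finally show ?thesis .
    qed
    define N where "N = {w. ldist x1 w < \<delta> * R / 2}"
    have finN: "finite N" unfolding N_def by (rule finite_ball)
    have x1N: "x1 \<in> N" using \<delta> R' by (simp add: N_def)
    \<comment> \<open>The good sets have at least 5V/6 points each and their union at most 3V/2,
      which leaves V/6 common points of mass 1/V in both rows of \<open>J\<close>.\<close>
    have Josc: "kapp J g w1 \<le> kapp J g w2 + 5/6"
      if g: "\<And>y. 0 \<le> g y" "\<And>y. g y \<le> 1" and w: "w1 \<in> N" "w2 \<in> N" for g w1 w2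
    proof -
      have b: "bfun g" by (rule bfun_unit) (use g in auto)
      have w12: "ldist w1 w2 < \<delta> * R"
        using w ldist_triangle[of w1 w2 x1] ldist_commute[of w1 x1] by (simp add: N_def)
      define H where "H = G w1 \<inter> G w2"
      have "G w1 \<union> G w2 \<subseteq> {y. ldist w1 y < (1 + \<delta>) * R}"
      proof
        fix y assume "y \<in> G w1 \<union> G w2"
        then have "ldist w1 y < R \<or> ldist w2 y < R" using GB by auto
        then show "y \<in> {y. ldist w1 y < (1 + \<delta>) * R}"
          using ldist_triangle[of w1 y w2] w12 \<delta> R' by (auto simp: distrib_right) (smt (verit) mult_nonneg_nonneg)
      qed
      then have "real (card (G w1 \<union> G w2)) \<le> lvol TYPE('d) ((1 + \<delta>) * R)"
        unfolding card_ball[of w1, symmetric] by (auto intro!: card_mono finite_ball)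
      then have "real (card (G w1 \<union> G w2)) \<le> 3/2 * V" using R(3) by (simp add: V_def)
      moreover have "card (G w1) + card (G w2) = card (G w1 \<union> G w2) + card H"
        unfolding H_def by (rule card_Un_Int[OF Gfin Gfin])
      ultimately have H: "V / 6 \<le> real (card H)" using Gcard[of w1] Gcard[of w2] by linarith
      have "(\<Sum>y\<in>H. 1 - g y) / V \<le> kapp J (\<lambda>y. 1 - g y) w1"
        by (rule JGsum) (use g in \<open>auto simp: H_def\<close>)
      moreover have "(\<Sum>y\<in>H. g y) / V \<le> kapp J g w2" by (rule JGsum) (use g in \<open>auto simp: H_def\<close>)
      moreover have "kapp J (\<lambda>y. 1 - g y) w1 = 1 - kapp J g w1" by (rule kapp_one_minus[OF J_one b])
      moreover have "(\<Sum>y\<in>H. 1 - g y) / V + (\<Sum>y\<in>H. g y) / V = real (card H) / V"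
        by (simp add: sum_subtractf diff_divide_distrib)
      moreover have "1/6 \<le> real (card H) / V" using H V by (simp add: field_simps)
      ultimately show ?thesis by linarith
    qed
    define I where "I = (\<lambda>y. if y \<in> - N then 1 else 0 :: real)"
    have bI: "bfun I" unfolding I_def by (rule bfun_indicator)
    have I01: "0 \<le> I y" "I y \<le> 1" for y by (auto simp: I_def)
    \<comment> \<open>By Duhamel, \<open>exp (- l * s)\<close> times the remaining semigroup is
      below the full one on nonnegative functions. The moment bound thus transfers at the cost of
      exp(l s) \<le> 3.\<close>
    have tail: "kapp (S.P s) I x \<le> 1/24" if s: "0 \<le> s" "s \<le> T" and x: "x = x1 \<or> x = x2" for s x
    proof -
      define \<rho> where "\<rho> = \<delta> * R / 4"
      have \<rho>: "r \<le> \<rho>" "0 < \<rho>" using R' r1 by (auto simp: \<rho>_def)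
      have far: "\<rho> \<le> ldist x y" if "y \<in> - N" for y
      proof -
        have "2 * \<rho> \<le> ldist x1 y" using that by (simp add: N_def \<rho>_def not_less mult.commute)
        then show ?thesis using x ldist_triangle[of x1 y x2] x12 \<rho> by auto
      qed
      have "kapp (P s) I x \<le> M * (T powr (1 / \<alpha>) / \<rho>) powr gm"
        unfolding I_def by (rule tail_prob[OF M T s \<rho>(2) far])
      also have "\<dots> \<le> M * (A powr (gm / \<alpha>))"
      proof (rule mult_left_mono)
        have "T powr (1 / \<alpha>) = A powr (1 / \<alpha>) * r" using A r1 alpha by (simp add: T_def powr_mult powr_powr)
        then have "T powr (1 / \<alpha>) / \<rho> \<le> A powr (1 / \<alpha>)" using \<rho> by (simp add: divide_le_eq mult_left_mono)
        then have "(T powr (1 / \<alpha>) / \<rho>) powr gm \<le> (A powr (1 / \<alpha>)) powr gm"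
          using gm \<rho> by (intro powr_mono2) auto
        then show "(T powr (1 / \<alpha>) / \<rho>) powr gm \<le> A powr (gm / \<alpha>)" by (simp add: powr_powr)
      qed (use M1 in simp)
      finally have Ps: "kapp (P s) I x \<le> M * A powr (gm / \<alpha>)" .
      have "exp (- l * s) * kapp (exp (s *\<^sub>R S.gen)) (kapp (exp ((s - s) *\<^sub>R gen)) I) x
         \<le> exp (- l * 0) * kapp (exp (0 *\<^sub>R S.gen)) (kapp (exp ((s - 0) *\<^sub>R gen)) I) x"
      proof (rule DERIV_nonpos_imp_nonincreasing[OF s(1)])
        fix u assume u: "0 \<le> u" "u \<le> s"
        have "0 \<le> kapp (S.P u) (kapp J (kapp (P (s - u)) I)) x"
          using u by (intro kapp_nonneg S.P_nonneg J_nonneg P_nonneg) (auto simp: I01)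
        then have "- l * exp (- l * u) * kapp (exp (u *\<^sub>R S.gen)) (kapp J (kapp (exp ((s - u) *\<^sub>R gen)) I)) x \<le> 0"
          using l by (simp add: S.P_def P_def mult_nonneg_nonneg)
        with duhamel_deriv[OF genJ bI, of s x u UNIV]
        show "\<exists>y. ((\<lambda>u. exp (- l * u) * kapp (exp (u *\<^sub>R S.gen)) (kapp (exp ((s - u) *\<^sub>R gen)) I) x) has_real_derivative y) (at u) \<and> y \<le> 0"
          by blast
      qed
      moreover have one: "kapp 1 g = g" for g :: "int^'d \<Rightarrow> real" by (rule ext) (simp add: kapp_def ent_one infsum_single)
      ultimately have "exp (- l * s) * kapp (S.P s) I x \<le> kapp (P s) I x"
        by (simp add: S.P_def P_def)
      then have "kapp (S.P s) I x \<le> exp (l * s) * kapp (P s) I x"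
        by (simp add: exp_minus field_simps)
      also have "\<dots> \<le> 3 * (M * A powr (gm / \<alpha>))"
      proof (rule mult_mono[OF _ Ps])
        have "l * s \<le> 1" using lT(1) s l by (smt (verit) mult_left_mono)
        then have "exp (l * s) \<le> exp 1" by simp
        then show "exp (l * s) \<le> 3" using exp_le by linarith
        show "0 \<le> kapp (P s) I x" by (rule P_bounds(1)[OF s(1) I01])
      qed simp
      also note A72
      finally show ?thesis .
    qed
    have bracket: "kapp (S.P s) (kapp J g) x1 - kapp (S.P s) (kapp J g) x2 \<le> 11/12"
      if s: "0 \<le> s" "s \<le> T" and g: "\<And>y. 0 \<le> g y" "\<And>y. g y \<le> 1" for s g
    proof -
      define h where "h = kapp J g"
      have h01: "0 \<le> h y" "h y \<le> 1" for y unfolding h_def by (rule J_bounds[OF g])+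
      have bh: "bfun h" by (rule bfun_unit) (use h01 in auto)
      define m where "m = Min (h ` N)"
      have "m \<in> h ` N" unfolding m_def by (rule Min_in) (use finN x1N in auto)
      then obtain w0 where w0: "w0 \<in> N" "m = h w0" by auto
      have m01: "0 \<le> m" "m \<le> 1" using w0 h01 by auto
      have mle: "m \<le> h y" if "y \<in> N" for y unfolding m_def using finN that by simp
      have leh: "h y \<le> m + 5/6" if "y \<in> N" for y
        unfolding w0(2) h_def by (rule Josc[OF g that w0(1)])
      have const: "kapp (S.P s) (\<lambda>_. c) x = c" for c x using kapp_cmult[of "S.P s" c "\<lambda>_. 1" x] by (simp add: S.P_one)
      have "kapp (S.P s) h x1 \<le> kapp (S.P s) (\<lambda>y. (m + 5/6) + I y) x1"
        by (rule kapp_mono[OF S.P_nonneg[OF s(1)] bh bfun_add[OF bfun_const bI]])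
           (use leh h01(2) m01 in \<open>auto simp: I_def intro: order_trans[of _ 1]\<close>)
      also have "\<dots> = (m + 5/6) + kapp (S.P s) I x1" by (simp add: kapp_add[OF bfun_const bI] const)
      also have "\<dots> \<le> (m + 5/6) + 1/24" using tail[OF s, of x1] by simp
      finally have 1: "kapp (S.P s) h x1 \<le> (m + 5/6) + 1/24" .
      have "kapp (S.P s) (\<lambda>y. m + (- 1) * I y) x2 \<le> kapp (S.P s) h x2"
        by (rule kapp_mono[OF S.P_nonneg[OF s(1)] bfun_add[OF bfun_const bfun_cmult[OF bI]] bh])
           (use mle h01(1) m01 in \<open>auto simp: I_def intro: order_trans[of _ 0]\<close>)
      moreover have "kapp (S.P s) (\<lambda>y. m + (- 1) * I y) x2 = m + (- 1) * kapp (S.P s) I x2"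
        by (simp only: kapp_add[OF bfun_const bfun_cmult[OF bI]] const kapp_cmult)
      ultimately have "m - 1/24 \<le> kapp (S.P s) h x2" using tail[OF s, of x2] by simp
      then show ?thesis using 1 unfolding h_def[symmetric] by linarith
    qed
    have bf: "bfun f" by (rule bfun_unit) (use f in auto)
    define F where "F = (\<lambda>x s. exp (- l * s) * kapp (exp (s *\<^sub>R S.gen)) (kapp (exp ((T - s) *\<^sub>R gen)) f) x)"
    \<comment> \<open>Nondecreasing because the difference after a ring is at most 11/12; comparing
      \<open>\<Psi>\<close> at 0 and at \<open>T\<close> stands for integrating Duhamel's
      formula.\<close>
    define \<Psi> where "\<Psi> = (\<lambda>s. F x1 s - F x2 s - 11/12 * exp (- l * s))"
    have one: "kapp 1 g = g" for g :: "int^'d \<Rightarrow> real" by (rule ext) (simp add: kapp_def ent_one infsum_single)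
    have "\<Psi> 0 \<le> \<Psi> T"
    proof (rule DERIV_nonneg_imp_nondecreasing[of 0 T \<Psi>])
      show "0 \<le> T" using T by simp
      fix s assume s: "0 \<le> s" "s \<le> T"
      define g where "g = kapp (P (T - s)) f"
      have g: "0 \<le> g y" "g y \<le> 1" for y unfolding g_def using P_bounds[OF _ f, of "T - s"] s by auto
      define b where "b = (\<lambda>x. kapp (S.P s) (kapp J g) x)"
      have dF: "(F x has_real_derivative - l * exp (- l * s) * b x) (at s)" for x
        using duhamel_deriv[OF genJ bf, of T x s UNIV] by (simp add: F_def b_def g_def S.P_def P_def)
      have dexp: "((\<lambda>s. exp (- l * s)) has_real_derivative - l * exp (- l * s)) (at s)"
        by (rule derivative_eq_intros refl | simp)+
      have "(\<Psi> has_real_derivative (- l * exp (- l * s) * b x1 - - l * exp (- l * s) * b x2) - 11/12 * (- l * exp (- l * s))) (at s)"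
        unfolding \<Psi>_def by (intro DERIV_diff dF DERIV_cmult dexp)
      moreover have "(- l * exp (- l * s) * b x1 - - l * exp (- l * s) * b x2) - 11/12 * (- l * exp (- l * s))
          = l * exp (- l * s) * (11/12 - (b x1 - b x2))" by (simp add: algebra_simps)
      moreover have "0 \<le> l * exp (- l * s) * (11/12 - (b x1 - b x2))"
        using bracket[OF s g] l by (simp add: b_def)
      ultimately show "\<exists>y. (\<Psi> has_real_derivative y) (at s) \<and> 0 \<le> y" by auto
    qed
    moreover have "\<Psi> 0 = kapp (P T) f x1 - kapp (P T) f x2 - 11/12"
      by (simp add: \<Psi>_def F_def P_def one)
    moreover have "\<Psi> T \<le> exp (- l * T) * (1/12)"
    proof -
      have "kapp (S.P T) f x1 - kapp (S.P T) f x2 \<le> 1"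
        using S.P_bounds(2)[OF _ f, of T "\<lambda>y. y" x1] S.P_bounds(1)[OF _ f, of T "\<lambda>y. y" x2] T by simp
      then have "exp (- l * T) * (kapp (S.P T) f x1 - kapp (S.P T) f x2) \<le> exp (- l * T) * 1"
        by (rule mult_left_mono) simp
      moreover have "\<Psi> T = exp (- l * T) * (kapp (S.P T) f x1 - kapp (S.P T) f x2) - 11/12 * exp (- l * T)"
        by (simp add: \<Psi>_def F_def S.P_def one right_diff_distrib)
      ultimately show ?thesis by linarith
    qed
    ultimately have "kapp (P T) f x1 - kapp (P T) f x2 \<le> 11/12 + exp (- l * T) * (1/12)" by linarith
    also have "\<dots> \<le> 11/12 + exp (- a0) * (1/12)" using lT(2) by simp
    also have "\<dots> = 1 - e" by (simp add: e_def field_simps)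
    finally show "kapp (P (A * r powr \<alpha>)) f x1 - kapp (P (A * r powr \<alpha>)) f x2 \<le> 1 - e" by (simp add: T_def)
  qed
qed

end

section \<open>Hoelder continuity of the semigroup\<close>

text \<open>Bernoulli. The m-th root exceeds 1 by at most w/m, so a spread of bounded mean costs
  little for large m.\<close>

lemma powr_inverse_nat_le:
  fixes w :: real
  assumes "0 \<le> w" "0 < m"
  shows "w powr (1 / real m) \<le> 1 + w / real m"
proof -
  have "w \<le> 1 + real m * (w / real m)" using assms by simp
  also have "\<dots> \<le> (1 + w / real m) ^ m" by (rule Bernoulli_inequality) (use assms in \<open>auto intro: order_trans[of _ 0]\<close>)
  finally have "w powr (1 / real m) \<le> ((1 + w / real m) ^ m) powr (1 / real m)"
    by (rule powr_mono2[rotated 2]) (use assms in auto)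
  also have "\<dots> = 1 + w / real m"
    using assms by (subst powr_realpow[symmetric]) (auto simp: powr_powr add_pos_nonneg)
  finally show ?thesis .
qed

context stable_rates
begin

text \<open>Removing a fixed fraction \<open>e\<close> of common mass from two rows of the transition matrix.\<close>

lemma coupled_difference:
  assumes t: "0 \<le> t" and e: "0 < e" "e < 1"
    and ov: "\<And>f. (\<And>y. 0 \<le> f y) \<Longrightarrow> (\<And>y. f y \<le> 1) \<Longrightarrow> kapp (P t) f x1 - kapp (P t) f x2 \<le> 1 - e"
    and W: "\<And>i z. 0 \<le> W i z" "\<And>i. i = x1 \<or> i = x2 \<Longrightarrow> (\<lambda>z. ent (P t) i z * W i z) summable_on UNIV"
      "\<And>i. i = x1 \<or> i = x2 \<Longrightarrow> (\<Sum>\<^sub>\<infinity>z. ent (P t) i z * W i z) \<le> M"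
    and g: "bfun g" and c: "0 \<le> c" "0 \<le> c'"
    and osc: "\<And>z1 z2. g z1 - g z2 \<le> c + c' * (W x1 z1 * W x2 z2)"
  shows "(1 - e) * (kapp (P t) g x1 - kapp (P t) g x2) \<le> c * (1 - e)\<^sup>2 + c' * M\<^sup>2"
proof -
  define p where "p = (\<lambda>i. ent (P t) i)"
  have p: "0 \<le> p i z" "p i summable_on UNIV" "(\<Sum>\<^sub>\<infinity>z. p i z) = 1" for i z
    by (simp_all add: p_def P_nonneg[OF t] ent_summable P_sum)
  define mn where "mn = (\<lambda>z. min (p x1 z) (p x2 z))"
  have mn: "0 \<le> mn z" "mn z \<le> p x1 z" "mn z \<le> p x2 z" for z using p(1) by (auto simp: mn_def)
  have mns: "mn summable_on UNIV"
    by (rule summable_on_real_bound[OF p(2)[of x1]]) (use mn in simp)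
  define em where "em = (\<Sum>\<^sub>\<infinity>z. mn z)"
  have em: "e \<le> em"
  proof -
    \<comment> \<open>Marking where the first row is larger turns the overlap hypothesis into a
      lower bound on the common mass.\<close>
    define f where "f = (\<lambda>z. if p x2 z < p x1 z then 1 else 0 :: real)"
    have bf: "bfun f" unfolding f_def by (rule bfun_indicator)
    have s1: "(\<lambda>z. p x1 z * f z) summable_on UNIV" "(\<lambda>z. p x2 z * f z) summable_on UNIV"
      using summable_mult_bfun[OF p(2) bf] by auto
    have "em = (\<Sum>\<^sub>\<infinity>z. p x1 z - (p x1 z * f z - p x2 z * f z))"
      unfolding em_def by (rule infsum_cong) (auto simp: mn_def f_def)
    also have "\<dots> = 1 - ((\<Sum>\<^sub>\<infinity>z. p x1 z * f z) - (\<Sum>\<^sub>\<infinity>z. p x2 z * f z))" (is "_ = 1 - ?d")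
      using infsum_diff_real(2)[OF p(2)[of x1] infsum_diff_real(1)[OF s1]] infsum_diff_real(2)[OF s1] p(3)[of x1] by simp
    finally have "em = 1 - ?d" .
    moreover have "kapp (P t) f x1 - kapp (P t) f x2 \<le> 1 - e" by (rule ov) (auto simp: f_def)
    then have "?d \<le> 1 - e" by (simp add: kapp_def p_def)
    ultimately show ?thesis by simp
  qed
  \<comment> \<open>Only the fraction \<open>e / em\<close> of the common part is removed, so both
    remainders have mass exactly 1 - e; the removed parts cancel in the difference.\<close>
  define \<nu> where "\<nu> = (\<lambda>i z. p i z - e / em * mn z)"
  have ee: "0 \<le> e / em" "e / em \<le> 1" "e / em * em = e" using e em by auto
  have emn: "0 \<le> e / em * mn z" "e / em * mn z \<le> mn z" for z
    using mult_nonneg_nonneg[OF ee(1) mn(1)[of z]] mult_right_mono[OF ee(2) mn(1)[of z]] by simp_all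
  have ems: "(\<lambda>z. e / em * mn z) summable_on UNIV" by (rule summable_on_cmult_right[OF mns])
  have \<nu>: "0 \<le> \<nu> i z" "\<nu> i z \<le> p i z" if "i = x1 \<or> i = x2" for i z
    using emn[of z] mn[of z] that by (auto simp: \<nu>_def)
  have \<nu>s: "\<nu> i summable_on UNIV" and \<nu>1: "(\<Sum>\<^sub>\<infinity>z. \<nu> i z) = 1 - e" for i
  proof -
    show "\<nu> i summable_on UNIV" unfolding \<nu>_def by (rule infsum_diff_real(1)[OF p(2) ems])
    have "(\<Sum>\<^sub>\<infinity>z. e / em * mn z) = e" using ee(3) by (simp only: infsum_cmult_right' em_def)
    then show "(\<Sum>\<^sub>\<infinity>z. \<nu> i z) = 1 - e"
      unfolding \<nu>_def using infsum_diff_real(2)[OF p(2)[of i] ems] p(3)[of i] by simp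
  qed
  have \<nu>W: "(\<lambda>z. \<nu> i z * W i z) summable_on UNIV" "(\<Sum>\<^sub>\<infinity>z. \<nu> i z * W i z) \<le> M" "0 \<le> (\<Sum>\<^sub>\<infinity>z. \<nu> i z * W i z)"
    if i: "i = x1 \<or> i = x2" for i
  proof -
    have le: "\<nu> i z * W i z \<le> ent (P t) i z * W i z" for z
      using mult_right_mono[OF \<nu>(2)[OF i] W(1)] by (simp add: p_def)
    show s: "(\<lambda>z. \<nu> i z * W i z) summable_on UNIV"
      by (rule summable_on_real_bound[OF W(2)[OF i]]) (use le \<nu>(1)[OF i] W(1) in \<open>simp add: abs_mult\<close>)
    show "(\<Sum>\<^sub>\<infinity>z. \<nu> i z * W i z) \<le> M"
      by (rule order_trans[OF infsum_mono[OF s W(2)[OF i] le] W(3)[OF i]])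
    show "0 \<le> (\<Sum>\<^sub>\<infinity>z. \<nu> i z * W i z)" by (rule infsum_nonneg) (use \<nu>(1)[OF i] W(1) in simp)
  qed
  have \<nu>g: "(\<lambda>z. \<nu> i z * g z) summable_on UNIV" for i by (rule summable_mult_bfun[OF \<nu>s g])
  have kg: "kapp (P t) g i = (\<Sum>\<^sub>\<infinity>z. \<nu> i z * g z) + (\<Sum>\<^sub>\<infinity>z. e / em * mn z * g z)" for i
  proof -
    have "kapp (P t) g i = (\<Sum>\<^sub>\<infinity>z. \<nu> i z * g z + e / em * mn z * g z)"
      unfolding kapp_def by (rule infsum_cong) (simp add: \<nu>_def p_def left_diff_distrib)
    also have "\<dots> = (\<Sum>\<^sub>\<infinity>z. \<nu> i z * g z) + (\<Sum>\<^sub>\<infinity>z. e / em * mn z * g z)"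
      by (rule infsum_add[OF \<nu>g summable_mult_bfun[OF ems g]])
    finally show ?thesis .
  qed
  define N1 where "N1 = (\<Sum>\<^sub>\<infinity>z. \<nu> x1 z * g z)"
  define N2 where "N2 = (\<Sum>\<^sub>\<infinity>z. \<nu> x2 z * g z)"
  define S1 where "S1 = (\<Sum>\<^sub>\<infinity>z. \<nu> x1 z * W x1 z)"
  define S2 where "S2 = (\<Sum>\<^sub>\<infinity>z. \<nu> x2 z * W x2 z)"
  \<comment> \<open>\<open>osc\<close> is averaged over the product of the two remainders, here in
    z1 and below in z2. The product has mass (1 - e)^2, whence the factor 1 - e in front of the
    difference.\<close>
  have step: "N1 \<le> (1 - e) * g z2 + ((1 - e) * c + S1 * (c' * W x2 z2))" for z2
  proof -
    have s: "(\<lambda>z1. \<nu> x1 z1 * (g z2 + c)) summable_on UNIV" "(\<lambda>z1. \<nu> x1 z1 * W x1 z1 * (c' * W x2 z2)) summable_on UNIV"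
      by (auto intro!: summable_on_cmult_left \<nu>s \<nu>W)
    have "N1 \<le> (\<Sum>\<^sub>\<infinity>z1. \<nu> x1 z1 * (g z2 + c) + \<nu> x1 z1 * W x1 z1 * (c' * W x2 z2))"
      unfolding N1_def
    proof (rule infsum_mono[OF \<nu>g summable_on_add[OF s]])
      fix z1
      have "\<nu> x1 z1 * g z1 \<le> \<nu> x1 z1 * (g z2 + (c + c' * (W x1 z1 * W x2 z2)))"
        by (rule mult_left_mono) (use osc[of z1 z2] \<nu>(1)[of x1] in auto)
      then show "\<nu> x1 z1 * g z1 \<le> \<nu> x1 z1 * (g z2 + c) + \<nu> x1 z1 * W x1 z1 * (c' * W x2 z2)"
        by (simp add: algebra_simps)
    qed
    also have "\<dots> = (1 - e) * (g z2 + c) + S1 * (c' * W x2 z2)"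
      by (simp only: infsum_add[OF s] infsum_cmult_left' \<nu>1 S1_def)
    finally show ?thesis by (simp add: algebra_simps)
  qed
  have "(1 - e) * N1 = (\<Sum>\<^sub>\<infinity>z2. \<nu> x2 z2 * N1)" by (simp add: infsum_cmult_left' \<nu>1)
  also have "\<dots> \<le> (\<Sum>\<^sub>\<infinity>z2. (\<nu> x2 z2 * g z2 * (1 - e) + \<nu> x2 z2 * ((1 - e) * c)) + \<nu> x2 z2 * W x2 z2 * (S1 * c'))"
  proof (rule infsum_mono)
    show "(\<lambda>z2. \<nu> x2 z2 * N1) summable_on UNIV" by (rule summable_on_cmult_left[OF \<nu>s])
    show "(\<lambda>z2. (\<nu> x2 z2 * g z2 * (1 - e) + \<nu> x2 z2 * ((1 - e) * c)) + \<nu> x2 z2 * W x2 z2 * (S1 * c')) summable_on UNIV"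
      by (intro summable_on_add summable_on_cmult_left \<nu>s \<nu>g \<nu>W(1)) simp
    fix z2
    have "\<nu> x2 z2 * N1 \<le> \<nu> x2 z2 * ((1 - e) * g z2 + ((1 - e) * c + S1 * (c' * W x2 z2)))"
      by (rule mult_left_mono[OF step]) (use \<nu>(1)[of x2] in auto)
    then show "\<nu> x2 z2 * N1 \<le> (\<nu> x2 z2 * g z2 * (1 - e) + \<nu> x2 z2 * ((1 - e) * c)) + \<nu> x2 z2 * W x2 z2 * (S1 * c')"
      by (simp add: algebra_simps)
  qed
  also have "\<dots> = (N2 * (1 - e) + (1 - e) * ((1 - e) * c)) + S2 * (S1 * c')"
  proof -
    have a: "(\<lambda>z2. \<nu> x2 z2 * g z2 * (1 - e)) summable_on UNIV" "(\<lambda>z2. \<nu> x2 z2 * ((1 - e) * c)) summable_on UNIV"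
      "(\<lambda>z2. \<nu> x2 z2 * W x2 z2 * (S1 * c')) summable_on UNIV"
      by (auto intro!: summable_on_cmult_left \<nu>s \<nu>g \<nu>W)
    show ?thesis
      by (simp only: infsum_add[OF summable_on_add[OF a(1,2)] a(3)] infsum_add[OF a(1,2)] infsum_cmult_left' \<nu>1 N2_def S2_def)
  qed
  finally have "(1 - e) * (N1 - N2) \<le> c * (1 - e)\<^sup>2 + c' * (S1 * S2)"
    by (simp add: power2_eq_square algebra_simps)
  also have "\<dots> \<le> c * (1 - e)\<^sup>2 + c' * M\<^sup>2"
    using \<nu>W(2,3)[of x1] \<nu>W(2,3)[of x2] c
    by (intro add_left_mono mult_left_mono) (auto simp: S1_def S2_def power2_eq_square intro!: mult_mono order_trans[of 0 "infsum _ _" M])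
  finally show ?thesis by (simp add: kg N1_def N2_def)
qed

text \<open>Up to time 2\<tau>, with \<tau> = A r^\<alpha>, the claimed bound is at least 1 and
  trivial. Later, a first step of length \<tau> is coupled and the induction hypothesis is used for
  the remaining time at the new distance, which is at most r (1 + a1)(1 + a2), with a1 and a2 the
  displacements over R. Its power \<beta> = gm/m involves only the m-th root of the weights, of
  bounded mean.\<close>

lemma semigroup_hoelder:
  obtains \<beta> N r0 where "0 < \<beta>" "\<beta> < 1" "\<beta> \<le> \<alpha>" "0 < N" "1 \<le> r0"
    "\<And>t x1 x2 f. 0 < t \<Longrightarrow> (\<And>y. 0 \<le> f y) \<Longrightarrow> (\<And>y. f y \<le> 1) \<Longrightarrow>
      kapp (P t) f x1 - kapp (P t) f x2 \<le> N * max (ldist x1 x2) r0 powr \<beta> * t powr (- \<beta> / \<alpha>)"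
proof -
  obtain A e r0 where A: "0 < A" "A \<le> 1" and e: "0 < e" "e < 1" and r0: "1 \<le> r0"
    and Ar: "\<And>r. r0 \<le> r \<Longrightarrow> 1 \<le> A * r powr \<alpha>"
    and ov: "\<And>r x1 x2 f. r0 \<le> r \<Longrightarrow> ldist x1 x2 \<le> r \<Longrightarrow> (\<And>y. 0 \<le> f y) \<Longrightarrow> (\<And>y. f y \<le> 1) \<Longrightarrow>
      kapp (P (A * r powr \<alpha>)) f x1 - kapp (P (A * r powr \<alpha>)) f x2 \<le> 1 - e"
    using overlap by blast
  obtain M where M1: "1 \<le> M" and M: "\<And>T s x. 1 \<le> T \<Longrightarrow> 0 \<le> s \<Longrightarrow> s \<le> T \<Longrightarrow>
      (\<lambda>y. ent (P s) x y * wt (T powr (1 / \<alpha>)) x y) summable_on UNIV"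
    "\<And>T s x. 1 \<le> T \<Longrightarrow> 0 \<le> s \<Longrightarrow> s \<le> T \<Longrightarrow>
      (\<Sum>\<^sub>\<infinity>y. ent (P s) x y * wt (T powr (1 / \<alpha>)) x y) \<le> M"
    using moment by blast
  \<comment> \<open>The first summand makes the spread cost M^2 / (m (1 - e)) at most e/4, the
    second makes 2^(\<beta>/\<alpha>) at most 1 + e/2; then (1 - 3e/4)(1 + e/2) \<le> 1.\<close>
  obtain m0 :: nat where m0: "4 * M\<^sup>2 / (e * (1 - e)) + 2 / e < real m0" using reals_Archimedean2 by blast
  define m where "m = m0 + 1"
  have m: "0 < m" "4 * M\<^sup>2 / (e * (1 - e)) \<le> real m" "2 / e \<le> real m"
  proof -
    have "0 \<le> 4 * M\<^sup>2 / (e * (1 - e))" "0 \<le> 2 / e" using e by auto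
    moreover have "real m = real m0 + 1" by (simp add: m_def)
    ultimately show "4 * M\<^sup>2 / (e * (1 - e)) \<le> real m" "2 / e \<le> real m" using m0 by linarith+
    show "0 < m" by (simp add: m_def)
  qed
  define \<beta> where "\<beta> = gm / real m"
  have \<beta>: "0 < \<beta>" using gm m by (simp add: \<beta>_def)
  have \<beta>gm: "\<beta> \<le> gm" using gm m by (simp add: \<beta>_def divide_le_eq) 
  \<comment> \<open>Coupling gain and spread cost together beat the factor 2^(\<beta>/\<alpha>) lost
    in replacing the remaining time s \<ge> t/2 by t.\<close>
  have small: "((1 - e) + M\<^sup>2 / (real m * (1 - e))) * 2 powr (\<beta> / \<alpha>) \<le> 1"
  proof -
    have "M\<^sup>2 / (real m * (1 - e)) \<le> e / 4"
    proof -
      have "4 * M\<^sup>2 \<le> real m * (e * (1 - e))" using m(2) e by (simp add: divide_le_eq)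
      then show ?thesis using m(1) e by (simp add: field_simps)
    qed
    then have "(1 - e) + M\<^sup>2 / (real m * (1 - e)) \<le> (1 - e) + e / 4" by (rule add_left_mono)
    also have "(1 - e) + e / 4 = 1 - 3 * e / 4" by simp
    finally have 1: "(1 - e) + M\<^sup>2 / (real m * (1 - e)) \<le> 1 - 3 * e / 4" .
    have "2 \<le> 1 + real m * (1 / real m)" using m by simp
    also have "\<dots> \<le> (1 + 1 / real m) ^ m" by (rule Bernoulli_inequality) (auto intro: order_trans[of _ 0])
    finally have "2 powr (\<beta> / \<alpha>) \<le> ((1 + 1 / real m) ^ m) powr (\<beta> / \<alpha>)"
      using \<beta> alpha by (intro powr_mono2) auto
    also have "\<dots> = ((1 + 1 / real m) powr real m) powr (\<beta> / \<alpha>)"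
      by (subst powr_realpow) (auto simp: add_pos_nonneg)
    also have "\<dots> = (1 + 1 / real m) powr (1 / 4)"
      using m alpha by (simp add: powr_powr \<beta>_def gm_def)
    also have "\<dots> \<le> (1 + 1 / real m) powr 1" by (rule powr_mono) auto
    also have "\<dots> = 1 + 1 / real m" by (simp add: add_nonneg_nonneg)
    also have "\<dots> \<le> 1 + e / 2" using m e by (simp add: field_simps)
    finally have 3: "2 powr (\<beta> / \<alpha>) \<le> 1 + e / 2" .
    have "((1 - e) + M\<^sup>2 / (real m * (1 - e))) * 2 powr (\<beta> / \<alpha>) \<le> (1 - 3 * e / 4) * (1 + e / 2)"
      by (rule mult_mono[OF 1 3]) (use e in auto)
    also have "\<dots> \<le> 1" using e by (simp add: algebra_simps)
    finally show ?thesis .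
  qed
  \<comment> \<open>Makes the bound equal to 1 at time 2\<tau>.\<close>
  define N where "N = (2 * A) powr (\<beta> / \<alpha>)"
  have N: "0 < N" using A by (simp add: N_def)
  \<comment> \<open>The shortest coupling step, so that every step lowers the induction index by
    one.\<close>
  define h where "h = A * r0 powr \<alpha>"
  have h: "0 < h" using A r0 by (simp add: h_def)
  have main: "kapp (P t) f x1 - kapp (P t) f x2 \<le> N * max (ldist x1 x2) r0 powr \<beta> * t powr (- \<beta> / \<alpha>)"
    if "0 < t" "t \<le> real n * h" and f: "\<And>y. 0 \<le> f y" "\<And>y. f y \<le> 1" for n t x1 x2 f
    using that(1,2)
  proof (induction n arbitrary: t x1 x2)
    case 0
    then show ?case by simp
  next
    case (Suc n)
    define r where "r = max (ldist x1 x2) r0"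
    have r: "r0 \<le> r" "ldist x1 x2 \<le> r" "1 \<le> r" using r0 by (auto simp: r_def)
    define \<tau> where "\<tau> = A * r powr \<alpha>"
    have \<tau>: "1 \<le> \<tau>" unfolding \<tau>_def by (rule Ar[OF r(1)])
    have h\<tau>: "h \<le> \<tau>" unfolding h_def \<tau>_def using A r r0 alpha by (intro mult_left_mono powr_mono2) auto
    have bf: "bfun f" by (rule bfun_unit) (use f in auto)
    show ?case
    proof (cases "t \<le> 2 * \<tau>")
      case True
      have "t powr (\<beta> / \<alpha>) \<le> (2 * \<tau>) powr (\<beta> / \<alpha>)" using True Suc.prems \<beta> alpha by (intro powr_mono2) auto
      also have "\<dots> = N * (r powr \<alpha>) powr (\<beta> / \<alpha>)" by (simp add: \<tau>_def N_def powr_mult mult_ac)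
      also have "(r powr \<alpha>) powr (\<beta> / \<alpha>) = r powr \<beta>" using alpha by (simp add: powr_powr)
      finally have "1 \<le> N * r powr \<beta> * t powr (- \<beta> / \<alpha>)"
        using Suc.prems by (simp add: powr_minus field_simps)
      moreover have "kapp (P t) f x1 - kapp (P t) f x2 \<le> 1"
        using P_bounds(2)[OF _ f, of t "\<lambda>y. y" x1] P_bounds(1)[OF _ f, of t "\<lambda>y. y" x2] Suc.prems by simp
      ultimately show ?thesis by (simp add: r_def)
    next
      case False
      define s where "s = t - \<tau>"
      have s: "0 < s" "t / 2 \<le> s" "s \<le> real n * h" using False \<tau> h\<tau> Suc.prems by (auto simp: s_def algebra_simps)
      define g where "g = kapp (P s) f"
      have bg: "bfun g" unfolding g_def by (rule bfun_kapp[OF bf])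
      have Pg: "kapp (P t) f x = kapp (P \<tau>) g x" for x
        using P_add[of \<tau> s] kapp_times[OF bf, of "P \<tau>" "P s" x] by (simp add: s_def g_def)
      define R where "R = \<tau> powr (1 / \<alpha>)"
      have R: "0 < R" "R \<le> r"
      proof -
        have "R = A powr (1 / \<alpha>) * r" using r alpha by (simp add: R_def \<tau>_def powr_mult powr_powr)
        moreover have "A powr (1 / \<alpha>) \<le> 1" using A alpha by (simp add: powr_le1)
        ultimately show "0 < R" "R \<le> r" using A r by (auto simp: mult_left_le_one_le)
      qed
      define c where "c = N * s powr (- \<beta> / \<alpha>) * r powr \<beta>"
      have c: "0 \<le> c" using N by (simp add: c_def)
      have osc: "g z1 - g z2 \<le> c + c / real m * (wt R x1 z1 * wt R x2 z2)" for z1 z2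
      proof -
        define a1 a2 where "a1 = ldist x1 z1 / R" and "a2 = ldist x2 z2 / R"
        have a: "0 \<le> a1" "0 \<le> a2" using R by (auto simp: a1_def a2_def)
        have l: "ldist x1 z1 \<le> r * a1" "ldist x2 z2 \<le> r * a2"
          using R mult_right_mono[OF R(2), of a1] mult_right_mono[OF R(2), of a2] a by (auto simp: a1_def a2_def)
        have "ldist z1 z2 \<le> ldist x1 z1 + ldist x1 x2 + ldist x2 z2"
          using ldist_triangle[of z1 z2 x1] ldist_triangle[of x1 z2 x2] ldist_commute[of z1 x1] by simp
        also have "\<dots> \<le> r * (1 + a1 + a2)" using l r by (simp add: algebra_simps)
        also have "\<dots> \<le> r * ((1 + a1) * (1 + a2))" using r a by (intro mult_left_mono) (auto simp: algebra_simps)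
        finally have "max (ldist z1 z2) r0 \<le> r * ((1 + a1) * (1 + a2))"
          using r a mult_mono[of r0 r 1 "(1 + a1) * (1 + a2)"] r0 by (auto simp: algebra_simps)
        then have "max (ldist z1 z2) r0 powr \<beta> \<le> (r * ((1 + a1) * (1 + a2))) powr \<beta>"
          using \<beta> r0 by (intro powr_mono2) auto
        also have "\<dots> = r powr \<beta> * ((1 + a1) powr \<beta> * (1 + a2) powr \<beta>)" by (simp add: powr_mult)
        also have "(1 + a1) powr \<beta> * (1 + a2) powr \<beta> = (wt R x1 z1 * wt R x2 z2) powr (1 / real m)"
          by (simp add: wt_def a1_def a2_def powr_mult powr_powr \<beta>_def)
        also have "r powr \<beta> * \<dots> \<le> r powr \<beta> * (1 + wt R x1 z1 * wt R x2 z2 / real m)"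
          by (intro mult_left_mono powr_inverse_nat_le) (use m in \<open>auto simp: wt_def\<close>)
        finally have mx: "max (ldist z1 z2) r0 powr \<beta> \<le> r powr \<beta> * (1 + wt R x1 z1 * wt R x2 z2 / real m)" .
        have "g z1 - g z2 \<le> N * max (ldist z1 z2) r0 powr \<beta> * s powr (- \<beta> / \<alpha>)"
          unfolding g_def by (rule Suc.IH[OF s(1,3)])
        also have "\<dots> = (N * s powr (- \<beta> / \<alpha>)) * max (ldist z1 z2) r0 powr \<beta>" by simp
        also have "\<dots> \<le> (N * s powr (- \<beta> / \<alpha>)) * (r powr \<beta> * (1 + wt R x1 z1 * wt R x2 z2 / real m))"
          by (rule mult_left_mono[OF mx]) (use N in simp)
        also have "\<dots> = c + c / real m * (wt R x1 z1 * wt R x2 z2)" by (simp add: c_def algebra_simps)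
        finally show ?thesis .
      qed
      have "(1 - e) * (kapp (P \<tau>) g x1 - kapp (P \<tau>) g x2) \<le> c * (1 - e)\<^sup>2 + c / real m * M\<^sup>2"
      proof (rule coupled_difference[where W = "wt R", OF _ e _ _ _ _ bg c _ osc])
        show "0 \<le> \<tau>" using \<tau> by simp
        show "kapp (P \<tau>) f x1 - kapp (P \<tau>) f x2 \<le> 1 - e" if "\<And>y. 0 \<le> f y" "\<And>y. f y \<le> 1" for f
          unfolding \<tau>_def by (rule ov[OF r(1,2) that])
        show "0 \<le> wt R i z" for i z by (simp add: wt_def)
        show "(\<lambda>z. ent (P \<tau>) i z * wt R i z) summable_on UNIV" for i
          unfolding R_def by (rule M(1)) (use \<tau> in auto)
        show "(\<Sum>\<^sub>\<infinity>z. ent (P \<tau>) i z * wt R i z) \<le> M" for i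
          unfolding R_def by (rule M(2)) (use \<tau> in auto)
        show "0 \<le> c / real m" using c by simp
      qed
      also have "\<dots> = (1 - e) * (c * ((1 - e) + M\<^sup>2 / (real m * (1 - e))))"
        using e m by (simp add: power2_eq_square field_simps)
      finally have "kapp (P \<tau>) g x1 - kapp (P \<tau>) g x2 \<le> c * ((1 - e) + M\<^sup>2 / (real m * (1 - e)))"
        using e by simp
      also have "\<dots> \<le> (N * r powr \<beta> * (t powr (- \<beta> / \<alpha>) * 2 powr (\<beta> / \<alpha>))) * ((1 - e) + M\<^sup>2 / (real m * (1 - e)))"
      proof (rule mult_right_mono)
        have "s powr (- \<beta> / \<alpha>) \<le> (t / 2) powr (- \<beta> / \<alpha>)"
          using s Suc.prems \<beta> alpha by (intro powr_mono2') auto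
        also have "\<dots> = t powr (- \<beta> / \<alpha>) * 2 powr (\<beta> / \<alpha>)" using Suc.prems by (simp add: powr_divide powr_minus_divide)
        finally have "N * r powr \<beta> * s powr (- \<beta> / \<alpha>) \<le> N * r powr \<beta> * (t powr (- \<beta> / \<alpha>) * 2 powr (\<beta> / \<alpha>))"
          using N by (intro mult_left_mono) auto
        then show "c \<le> N * r powr \<beta> * (t powr (- \<beta> / \<alpha>) * 2 powr (\<beta> / \<alpha>))" by (simp add: c_def mult_ac)
      qed (use e in simp)
      also have "\<dots> = (N * r powr \<beta> * t powr (- \<beta> / \<alpha>)) * (((1 - e) + M\<^sup>2 / (real m * (1 - e))) * 2 powr (\<beta> / \<alpha>))"
        by (simp only: mult_ac)
      also have "\<dots> \<le> (N * r powr \<beta> * t powr (- \<beta> / \<alpha>)) * 1"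
        by (rule mult_left_mono[OF small]) (use N in simp)
      finally show ?thesis by (simp add: Pg r_def)
    qed
  qed
  show ?thesis
  proof (rule that[OF \<beta> _ _ N r0])
    show "\<beta> < 1" using \<beta>gm gm by simp
    show "\<beta> \<le> \<alpha>" using \<beta>gm gm by simp
    fix t :: real and x1 x2 :: "int^'d" and f :: "int^'d \<Rightarrow> real"
    assume t: "0 < t" and f: "\<And>y. 0 \<le> f y" "\<And>y. f y \<le> 1"
    obtain n :: nat where "t / h < real n" using reals_Archimedean2 by blast
    then have n: "t \<le> real n * h" using h by (simp add: divide_less_eq)
    show "kapp (P t) f x1 - kapp (P t) f x2 \<le> N * max (ldist x1 x2) r0 powr \<beta> * t powr (- \<beta> / \<alpha>)"
      by (rule main[OF t n f])
  qed
qed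

end

section \<open>Hoelder continuity of the heat kernel\<close>

context stable_rates
begin

text \<open>Identifies the entrywise power series with the exponential in the Banach algebra;
  \<open>genQpow\<close> multiplies on the right, which the commutation of powers accounts
  for.\<close>

lemma transP_eq: "transP C t x y = ent (P t) x y"
proof -
  have g: "genQ C x y = ent gen x y" for x y by (simp add: genQ_def ent_gen rate_def)
  have "genQpow C n x y = ent (gen ^ n) x y" for n x y
  proof (induction n arbitrary: x y)
    case 0
    then show ?case by (simp add: ent_one)
  next
    case (Suc n)
    have "genQpow C (Suc n) x y = ent (gen ^ n * gen) x y" by (simp add: Suc g ent_times)
    then show ?case by (simp add: power_commutes)
  qed
  then show ?thesis
    unfolding transP_def P_def using sums_unique[OF ent_exp_sums[of t gen x y]] by simp
qed

text \<open>In space, the column of \<open>P (t / 2)\<close> divided by its upper bound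
  \<open>k\<close> takes values in [0, 1], so the semigroup estimate applies to it. In time, the
  derivative bound for |s1 - s2| \<le> t0 and the plain bound beyond merge into one power because
  \<beta> \<le> \<alpha>.\<close>

lemma heat_kernel_hoelder:
  obtains c \<beta> where "0 < c" "0 < \<beta>" "\<beta> < 1"
    "\<And>t0 s1 s2 x1 x2 y. 0 < t0 \<Longrightarrow> t0 \<le> s1 \<Longrightarrow> t0 \<le> s2 \<Longrightarrow>
      \<bar>ent (P s1) x1 y - ent (P s2) x2 y\<bar>
        \<le> c * t0 powr (- (D + \<beta>) / \<alpha>) * ((\<bar>s1 - s2\<bar> powr (1 / \<alpha>)) powr \<beta> + max (ldist x1 x2) \<Theta>1 powr \<beta>)"
proof -
  obtain \<beta> N r0 where \<beta>: "0 < \<beta>" "\<beta> < 1" "\<beta> \<le> \<alpha>" and N: "0 < N" and r0: "1 \<le> r0"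
    and H: "\<And>t x1 x2 f. 0 < t \<Longrightarrow> (\<And>y. 0 \<le> f y) \<Longrightarrow> (\<And>y. f y \<le> 1) \<Longrightarrow>
      kapp (P t) f x1 - kapp (P t) f x2 \<le> N * max (ldist x1 x2) r0 powr \<beta> * t powr (- \<beta> / \<alpha>)"
    using semigroup_hoelder by blast
  obtain K where K: "0 < K" and Pt: "\<And>t x y. 0 < t \<Longrightarrow> ent (P t) x y \<le> K * t powr (- D / \<alpha>)"
    using on_diagonal by blast
  obtain K' where K': "0 < K'" and Dt: "\<And>t0 s1 s2 x y. 0 < t0 \<Longrightarrow> t0 \<le> s1 \<Longrightarrow> t0 \<le> s2 \<Longrightarrow>
       \<bar>ent (P s1) x y - ent (P s2) x y\<bar> \<le> K' * t0 powr (- D / \<alpha> - 1) * \<bar>s1 - s2\<bar>"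
    using time_regularity by blast
  \<comment> \<open>Trades the coupling threshold \<open>r0\<close> for \<open>\<Theta>1\<close> at
    the cost of a constant.\<close>
  define b where "b = max 1 (r0 / \<Theta>1)"
  have b: "1 \<le> b" by (simp add: b_def)
  have rb: "max (ldist x1 x2) r0 \<le> b * max (ldist x1 x2) \<Theta>1" for x1 x2
  proof -
    have "ldist x1 x2 \<le> b * max (ldist x1 x2) \<Theta>1"
      using mult_mono[OF b, of "ldist x1 x2" "max (ldist x1 x2) \<Theta>1"] b by simp
    moreover have "r0 = r0 / \<Theta>1 * \<Theta>1" using Theta by simp
    then have "r0 \<le> b * max (ldist x1 x2) \<Theta>1"
      using mult_mono[of "r0 / \<Theta>1" b \<Theta>1 "max (ldist x1 x2) \<Theta>1"] b Theta by (simp add: b_def)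
    ultimately show ?thesis by simp
  qed
  define L where "L = K * N * b powr \<beta> * (1/2) powr (- (D + \<beta>) / \<alpha>)"
  have L: "0 < L" using K N b by (simp add: L_def)
  have Dba: "(- D - \<beta>) / \<alpha> \<le> 0" by (rule divide_nonpos_pos) (use D_ge_1 \<beta> alpha in auto)
  have space: "ent (P t) x1 y - ent (P t) x2 y \<le> L * t0 powr (- (D + \<beta>) / \<alpha>) * max (ldist x1 x2) \<Theta>1 powr \<beta>"
    if t: "0 < t0" "t0 \<le> t" for t0 t x1 x2 y
  proof -
    define k where "k = K * (t / 2) powr (- D / \<alpha>)"
    have k: "0 < k" using K t by (simp add: k_def)
    define f where "f = (\<lambda>z. (1 / k) * ent (P (t / 2)) z y)"
    have f: "0 \<le> f z" "f z \<le> 1" for z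
      using P_nonneg[of "t / 2" z y] Pt[of "t / 2" z y] t k by (auto simp: f_def k_def)
    have Pf: "ent (P t) x y = k * kapp (P (t / 2)) f x" for x
    proof -
      have "kapp (P (t / 2)) f x = (1 / k) * (\<Sum>\<^sub>\<infinity>z. ent (P (t / 2)) x z * ent (P (t / 2)) z y)"
        unfolding f_def kapp_cmult by (simp add: kapp_def)
      then show ?thesis using k P_add[of "t / 2" "t / 2"] by (simp add: ent_times)
    qed
    have "ent (P t) x1 y - ent (P t) x2 y = k * (kapp (P (t / 2)) f x1 - kapp (P (t / 2)) f x2)"
      by (simp add: Pf right_diff_distrib)
    also have "\<dots> \<le> k * (N * max (ldist x1 x2) r0 powr \<beta> * (t / 2) powr (- \<beta> / \<alpha>))"
      using k t by (intro mult_left_mono H f) auto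
    also have "\<dots> \<le> k * (N * (b powr \<beta> * max (ldist x1 x2) \<Theta>1 powr \<beta>) * (t / 2) powr (- \<beta> / \<alpha>))"
    proof -
      have "max (ldist x1 x2) r0 powr \<beta> \<le> (b * max (ldist x1 x2) \<Theta>1) powr \<beta>"
        using \<beta> r0 by (intro powr_mono2 rb) auto
      then have "max (ldist x1 x2) r0 powr \<beta> \<le> b powr \<beta> * max (ldist x1 x2) \<Theta>1 powr \<beta>" by (simp add: powr_mult)
      then show ?thesis using k N by (intro mult_left_mono mult_right_mono) auto
    qed
    also have "\<dots> = K * N * b powr \<beta> * ((t / 2) powr (- D / \<alpha>) * (t / 2) powr (- \<beta> / \<alpha>)) * max (ldist x1 x2) \<Theta>1 powr \<beta>"
      by (simp add: k_def)
    also have "(t / 2) powr (- D / \<alpha>) * (t / 2) powr (- \<beta> / \<alpha>) = (1/2) powr (- (D + \<beta>) / \<alpha>) * t powr (- (D + \<beta>) / \<alpha>)"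
    proof -
      have "(t / 2) powr (- D / \<alpha>) * (t / 2) powr (- \<beta> / \<alpha>) = (1/2 * t) powr (- (D + \<beta>) / \<alpha>)"
        unfolding powr_add[symmetric] by (simp add: add_divide_distrib diff_divide_distrib)
      also have "\<dots> = (1/2) powr (- (D + \<beta>) / \<alpha>) * t powr (- (D + \<beta>) / \<alpha>)" by (rule powr_mult)
      finally show ?thesis .
    qed
    also have "K * N * b powr \<beta> * \<dots> * max (ldist x1 x2) \<Theta>1 powr \<beta> = L * t powr (- (D + \<beta>) / \<alpha>) * max (ldist x1 x2) \<Theta>1 powr \<beta>"
      by (simp add: L_def)
    also have "\<dots> \<le> L * t0 powr (- (D + \<beta>) / \<alpha>) * max (ldist x1 x2) \<Theta>1 powr \<beta>"
      using t L Dba by (intro mult_right_mono mult_left_mono powr_mono2') auto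
    finally show ?thesis .
  qed
  define c where "c = L + (K + K')"
  have time: "\<bar>ent (P s1) x y - ent (P s2) x y\<bar> \<le> (K + K') * t0 powr (- (D + \<beta>) / \<alpha>) * (\<bar>s1 - s2\<bar> powr (1 / \<alpha>)) powr \<beta>"
    if s: "0 < t0" "t0 \<le> s1" "t0 \<le> s2" for t0 s1 s2 x y
  proof -
    define u where "u = \<bar>s1 - s2\<bar> / t0"
    have u: "0 \<le> u" using s by (simp add: u_def)
    have "\<bar>ent (P s1) x y - ent (P s2) x y\<bar> \<le> (K + K') * t0 powr (- D / \<alpha>) * u powr (\<beta> / \<alpha>)"
    proof (cases "u \<le> 1")
      case True
      have "\<bar>ent (P s1) x y - ent (P s2) x y\<bar> \<le> K' * t0 powr (- D / \<alpha> - 1) * \<bar>s1 - s2\<bar>" by (rule Dt[OF s])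
      also have "\<dots> = K' * t0 powr (- D / \<alpha>) * u" using s by (simp add: u_def powr_diff)
      also have "\<dots> \<le> (K + K') * t0 powr (- D / \<alpha>) * u powr (\<beta> / \<alpha>)"
      proof (rule mult_mono)
        show "K' * t0 powr (- D / \<alpha>) \<le> (K + K') * t0 powr (- D / \<alpha>)" using K by (intro mult_right_mono) auto
        show "u \<le> u powr (\<beta> / \<alpha>)"
          using powr_mono'[of "\<beta> / \<alpha>" 1 u] u True \<beta> alpha by simp
      qed (use K K' u in auto)
      finally show ?thesis .
    next
      case False
      have le: "ent (P s) x y \<le> K * t0 powr (- D / \<alpha>)" if "t0 \<le> s" for s
      proof -
        have "ent (P s) x y \<le> K * s powr (- D / \<alpha>)" using Pt that s(1) by simp
        also have "\<dots> \<le> K * t0 powr (- D / \<alpha>)"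
          using K that s(1) D_ge_1 alpha by (intro mult_left_mono powr_mono2') auto
        finally show ?thesis .
      qed
      have "\<bar>ent (P s1) x y - ent (P s2) x y\<bar> \<le> K * t0 powr (- D / \<alpha>)"
        using le[OF s(2)] le[OF s(3)] P_nonneg[of s1 x y] P_nonneg[of s2 x y] s by (simp add: abs_le_iff)
      also have "\<dots> = K * t0 powr (- D / \<alpha>) * 1" by simp
      also have "\<dots> \<le> (K + K') * t0 powr (- D / \<alpha>) * u powr (\<beta> / \<alpha>)"
      proof (rule mult_mono)
        show "K * t0 powr (- D / \<alpha>) \<le> (K + K') * t0 powr (- D / \<alpha>)" using K' by (intro mult_right_mono) auto
        show "1 \<le> u powr (\<beta> / \<alpha>)" by (rule ge_one_powr_ge_zero) (use False \<beta> alpha in auto)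
      qed (use K K' in auto)
      finally show ?thesis .
    qed
    also have "\<dots> = (K + K') * (t0 powr (- D / \<alpha>) * t0 powr (- \<beta> / \<alpha>)) * \<bar>s1 - s2\<bar> powr (\<beta> / \<alpha>)"
      using s by (simp add: u_def powr_divide powr_minus_divide)
    also have "t0 powr (- D / \<alpha>) * t0 powr (- \<beta> / \<alpha>) = t0 powr (- (D + \<beta>) / \<alpha>)"
      unfolding powr_add[symmetric] by (simp add: add_divide_distrib diff_divide_distrib)
    finally show ?thesis by (simp add: powr_powr)
  qed
  show ?thesis
  proof (rule that[of c \<beta>, OF _ \<beta>(1,2)])
    show "0 < c" using L K K' by (simp add: c_def)
    fix t0 s1 s2 :: real and x1 x2 y :: "int^'d"
    assume s: "0 < t0" "t0 \<le> s1" "t0 \<le> s2"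
    define q where "q = t0 powr (- (D + \<beta>) / \<alpha>)"
    define S where "S = (\<bar>s1 - s2\<bar> powr (1 / \<alpha>)) powr \<beta>"
    define X where "X = max (ldist x1 x2) \<Theta>1 powr \<beta>"
    have nn: "0 \<le> q" "0 \<le> S" "0 \<le> X" by (simp_all add: q_def S_def X_def)
    have a: "\<bar>ent (P s1) x1 y - ent (P s1) x2 y\<bar> \<le> L * q * X"
      using space[OF s(1,2), of x1 y x2] space[OF s(1,2), of x2 y x1]
      by (simp add: abs_le_iff q_def X_def ldist_commute[of x2 x1])
    have "\<bar>ent (P s1) x1 y - ent (P s2) x2 y\<bar> \<le> \<bar>ent (P s1) x1 y - ent (P s1) x2 y\<bar> + \<bar>ent (P s1) x2 y - ent (P s2) x2 y\<bar>"
      by linarith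
    also have "\<dots> \<le> L * q * X + (K + K') * q * S"
      by (rule add_mono[OF a]) (use time[OF s, of x2 y] in \<open>simp add: q_def S_def\<close>)
    also have "\<dots> \<le> c * q * X + c * q * S"
      using nn L K K' by (intro add_mono mult_right_mono) (auto simp: c_def)
    finally show "\<bar>ent (P s1) x1 y - ent (P s2) x2 y\<bar>
        \<le> c * t0 powr (- (D + \<beta>) / \<alpha>) * ((\<bar>s1 - s2\<bar> powr (1 / \<alpha>)) powr \<beta> + max (ldist x1 x2) \<Theta>1 powr \<beta>)"
      by (simp add: q_def S_def X_def distrib_left add.commute)
  qed
qed

section \<open>Scaling and symmetry\<close>

text \<open>The powers of \<rho> cancel: \<rho>^d from the density, \<rho>^(-d-\<beta>) from the
  time factor and \<rho>^\<beta> from the increments.\<close>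

lemma scaled_hoelder:
  obtains c \<beta> where "0 < c" "0 < \<beta>" "\<beta> < 1"
    "\<And>\<rho> t0 s1 s2 x1 x2 y. 1 \<le> \<rho> \<Longrightarrow> 0 < t0 \<Longrightarrow> t0 \<le> s1 \<Longrightarrow> t0 \<le> s2 \<Longrightarrow>
      \<bar>pY C \<alpha> \<rho> s1 x1 y - pY C \<alpha> \<rho> s2 x2 y\<bar>
        \<le> c * t0 powr (- (D + \<beta>) / \<alpha>) * ((\<bar>s1 - s2\<bar> powr (1 / \<alpha>)) powr \<beta> + max (ldist x1 x2 / \<rho>) (\<Theta>1 / \<rho>) powr \<beta>)"
proof -
  obtain c \<beta> where c: "0 < c" and \<beta>: "0 < \<beta>" "\<beta> < 1" and H:
    "\<And>t0 s1 s2 x1 x2 y. 0 < t0 \<Longrightarrow> t0 \<le> s1 \<Longrightarrow> t0 \<le> s2 \<Longrightarrow>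
      \<bar>ent (P s1) x1 y - ent (P s2) x2 y\<bar>
        \<le> c * t0 powr (- (D + \<beta>) / \<alpha>) * ((\<bar>s1 - s2\<bar> powr (1 / \<alpha>)) powr \<beta> + max (ldist x1 x2) \<Theta>1 powr \<beta>)"
    using heat_kernel_hoelder by blast
  show ?thesis
  proof (rule that[OF c \<beta>])
    fix \<rho> t0 s1 s2 :: real and x1 x2 y :: "int^'d"
    assume \<rho>: "1 \<le> \<rho>" and s: "0 < t0" "t0 \<le> s1" "t0 \<le> s2"
    define a where "a = \<rho> powr \<alpha>"
    have a: "0 < a" using \<rho> by (simp add: a_def)
    define Z where "Z = (\<bar>s1 - s2\<bar> powr (1 / \<alpha>)) powr \<beta>"
    define X where "X = max (ldist x1 x2 / \<rho>) (\<Theta>1 / \<rho>) powr \<beta>"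
    have "\<bar>pY C \<alpha> \<rho> s1 x1 y - pY C \<alpha> \<rho> s2 x2 y\<bar> = \<rho> powr D * \<bar>ent (P (a * s1)) x1 y - ent (P (a * s2)) x2 y\<bar>"
      using \<rho> by (simp add: pY_def transP_eq a_def D_def powr_realpow abs_mult flip: right_diff_distrib)
    also have "\<dots> \<le> \<rho> powr D * (c * (a * t0) powr (- (D + \<beta>) / \<alpha>) *
        ((\<bar>a * s1 - a * s2\<bar> powr (1 / \<alpha>)) powr \<beta> + max (ldist x1 x2) \<Theta>1 powr \<beta>))"
      by (rule mult_left_mono[OF H]) (use a s in auto)
    also have "(\<bar>a * s1 - a * s2\<bar> powr (1 / \<alpha>)) powr \<beta> = \<rho> powr \<beta> * Z"
    proof -
      have "\<bar>a * s1 - a * s2\<bar> = a * \<bar>s1 - s2\<bar>" using a by (simp add: abs_mult flip: right_diff_distrib)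
      moreover have "a powr (1 / \<alpha>) = \<rho>" using alpha \<rho> by (simp add: a_def powr_powr)
      ultimately show ?thesis by (simp add: Z_def powr_mult)
    qed
    also have "max (ldist x1 x2) \<Theta>1 powr \<beta> = \<rho> powr \<beta> * X"
    proof -
      have "max (ldist x1 x2) \<Theta>1 = \<rho> * max (ldist x1 x2 / \<rho>) (\<Theta>1 / \<rho>)"
        using \<rho> by (simp add: max_mult_distrib_left)
      then show ?thesis by (simp add: X_def powr_mult)
    qed
    also have "\<rho> powr D * (c * (a * t0) powr (- (D + \<beta>) / \<alpha>) * (\<rho> powr \<beta> * Z + \<rho> powr \<beta> * X))
       = c * t0 powr (- (D + \<beta>) / \<alpha>) * (Z + X) * (\<rho> powr D * \<rho> powr (- (D + \<beta>)) * \<rho> powr \<beta>)"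
    proof -
      have "(a * t0) powr (- (D + \<beta>) / \<alpha>) = a powr (- (D + \<beta>) / \<alpha>) * t0 powr (- (D + \<beta>) / \<alpha>)" by (rule powr_mult)
      also have "a powr (- (D + \<beta>) / \<alpha>) = \<rho> powr (- (D + \<beta>))" unfolding a_def powr_powr using alpha by simp
      finally show ?thesis by (simp only:) (simp only: distrib_left distrib_right mult_ac)
    qed
    also have "\<rho> powr D * \<rho> powr (- (D + \<beta>)) * \<rho> powr \<beta> = 1"
      unfolding powr_add[symmetric] using \<rho> by simp
    finally show "\<bar>pY C \<alpha> \<rho> s1 x1 y - pY C \<alpha> \<rho> s2 x2 y\<bar>
        \<le> c * t0 powr (- (D + \<beta>) / \<alpha>) * ((\<bar>s1 - s2\<bar> powr (1 / \<alpha>)) powr \<beta> + max (ldist x1 x2 / \<rho>) (\<Theta>1 / \<rho>) powr \<beta>)"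
      by (simp add: Z_def X_def)
  qed
qed

lemma pY_sym: "pY C \<alpha> \<rho> t x y = pY C \<alpha> \<rho> t y x"
  by (simp add: pY_def transP_eq P_sym[of _ x y])

text \<open>The bound u^\<beta> + v^\<beta> \<le> 2 (u + v)^\<beta> merges the terms. For two
  targets, time and starting point are changed at fixed y1, and then y1 becomes y2 at fixed time by
  symmetry of the kernel; using the first estimate twice doubles its constant to
  \<open>4 * c\<close>.\<close>

lemma hoelder_conclusion:
  "\<exists>c > 0. \<exists>\<beta>. 0 < \<beta> \<and> \<beta> < 1 \<and>
    (\<forall>\<rho> t0 s1 s2 x1 x2 y. 1 \<le> \<rho> \<longrightarrow> 0 < t0 \<longrightarrow> t0 \<le> s1 \<longrightarrow> t0 \<le> s2 \<longrightarrow>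
       \<bar>pY C \<alpha> \<rho> s1 x1 y - pY C \<alpha> \<rho> s2 x2 y\<bar>
         \<le> c * t0 powr (- (real CARD('d) + \<beta>) / \<alpha>) *
            (\<bar>s1 - s2\<bar> powr (1 / \<alpha>) + max (ldist x1 x2 / \<rho>) (\<Theta>1 / \<rho>)) powr \<beta>) \<and>
    (\<forall>\<rho> t0 s1 s2 x1 x2 y1 y2. 1 \<le> \<rho> \<longrightarrow> 0 < t0 \<longrightarrow> t0 \<le> s1 \<longrightarrow> t0 \<le> s2 \<longrightarrow>
       \<bar>pY C \<alpha> \<rho> s1 x1 y1 - pY C \<alpha> \<rho> s2 x2 y2\<bar>
         \<le> c * t0 powr (- (real CARD('d) + \<beta>) / \<alpha>) *
            (\<bar>s1 - s2\<bar> powr (1 / \<alpha>) + max (ldist x1 x2 / \<rho>) (\<Theta>1 / \<rho>)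
              + max (ldist y1 y2 / \<rho>) (\<Theta>1 / \<rho>)) powr \<beta>)"
proof -
  obtain c \<beta> where c: "0 < c" and \<beta>: "0 < \<beta>" "\<beta> < 1" and H:
    "\<And>\<rho> t0 s1 s2 x1 x2 y. 1 \<le> \<rho> \<Longrightarrow> 0 < t0 \<Longrightarrow> t0 \<le> s1 \<Longrightarrow> t0 \<le> s2 \<Longrightarrow>
      \<bar>pY C \<alpha> \<rho> s1 x1 y - pY C \<alpha> \<rho> s2 x2 y\<bar>
        \<le> c * t0 powr (- (D + \<beta>) / \<alpha>) * ((\<bar>s1 - s2\<bar> powr (1 / \<alpha>)) powr \<beta> + max (ldist x1 x2 / \<rho>) (\<Theta>1 / \<rho>) powr \<beta>)"
    using scaled_hoelder by blast
  have pm: "u powr \<beta> \<le> v powr \<beta>" if "0 \<le> u" "u \<le> v" for u v :: real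
    using that \<beta> by (intro powr_mono2) auto
  have first: "\<bar>pY C \<alpha> \<rho> s1 x1 y - pY C \<alpha> \<rho> s2 x2 y\<bar>
         \<le> 2 * c * t0 powr (- (D + \<beta>) / \<alpha>) *
            (\<bar>s1 - s2\<bar> powr (1 / \<alpha>) + max (ldist x1 x2 / \<rho>) (\<Theta>1 / \<rho>)) powr \<beta>"
    if \<rho>: "1 \<le> \<rho>" and s: "0 < t0" "t0 \<le> s1" "t0 \<le> s2" for \<rho> t0 s1 s2 x1 x2 y
  proof -
    define u v where "u = \<bar>s1 - s2\<bar> powr (1 / \<alpha>)" and "v = max (ldist x1 x2 / \<rho>) (\<Theta>1 / \<rho>)"
    have uv: "0 \<le> u" "0 \<le> v" using \<rho> Theta by (auto simp: u_def v_def le_max_iff_disj)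
    have "u powr \<beta> + v powr \<beta> \<le> 2 * (u + v) powr \<beta>" using pm[of u "u + v"] pm[of v "u + v"] uv by simp
    then have "c * t0 powr (- (D + \<beta>) / \<alpha>) * (u powr \<beta> + v powr \<beta>) \<le> c * t0 powr (- (D + \<beta>) / \<alpha>) * (2 * (u + v) powr \<beta>)"
      using c by (intro mult_left_mono) auto
    then show ?thesis using H[OF \<rho> s, of x1 y x2] by (simp add: u_def v_def)
  qed
  have second: "\<bar>pY C \<alpha> \<rho> s1 x1 y1 - pY C \<alpha> \<rho> s2 x2 y2\<bar>
         \<le> 4 * c * t0 powr (- (D + \<beta>) / \<alpha>) *
            (\<bar>s1 - s2\<bar> powr (1 / \<alpha>) + max (ldist x1 x2 / \<rho>) (\<Theta>1 / \<rho>) + max (ldist y1 y2 / \<rho>) (\<Theta>1 / \<rho>)) powr \<beta>"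
    if \<rho>: "1 \<le> \<rho>" and s: "0 < t0" "t0 \<le> s1" "t0 \<le> s2" for \<rho> t0 s1 s2 x1 x2 y1 y2
  proof -
    define u v w where "u = \<bar>s1 - s2\<bar> powr (1 / \<alpha>)" and "v = max (ldist x1 x2 / \<rho>) (\<Theta>1 / \<rho>)"
      and "w = max (ldist y1 y2 / \<rho>) (\<Theta>1 / \<rho>)"
    have uv: "0 \<le> u" "0 \<le> v" "0 \<le> w" using \<rho> Theta by (auto simp: u_def v_def w_def le_max_iff_disj)
    define q where "q = 2 * c * t0 powr (- (D + \<beta>) / \<alpha>)"
    have q: "0 \<le> q" using c by (simp add: q_def)
    have "\<bar>pY C \<alpha> \<rho> s1 x1 y1 - pY C \<alpha> \<rho> s2 x2 y1\<bar> \<le> q * (u + v) powr \<beta>"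
      using first[OF \<rho> s, of x1 y1 x2] by (simp add: q_def u_def v_def)
    also have "\<dots> \<le> q * (u + v + w) powr \<beta>" using uv q by (intro mult_left_mono pm) auto
    finally have 1: "\<bar>pY C \<alpha> \<rho> s1 x1 y1 - pY C \<alpha> \<rho> s2 x2 y1\<bar> \<le> q * (u + v + w) powr \<beta>" .
    have "\<bar>pY C \<alpha> \<rho> s2 y1 x2 - pY C \<alpha> \<rho> s2 y2 x2\<bar> \<le> q * (\<bar>s2 - s2\<bar> powr (1 / \<alpha>) + w) powr \<beta>"
      using first[OF \<rho> s(1,3,3), of y1 x2 y2] by (simp add: q_def w_def)
    also have "\<dots> \<le> q * (u + v + w) powr \<beta>" using uv q by (intro mult_left_mono pm) auto
    finally have 2: "\<bar>pY C \<alpha> \<rho> s2 x2 y1 - pY C \<alpha> \<rho> s2 x2 y2\<bar> \<le> q * (u + v + w) powr \<beta>"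
      by (simp add: pY_sym[of \<rho> s2 x2])
    have "\<bar>pY C \<alpha> \<rho> s1 x1 y1 - pY C \<alpha> \<rho> s2 x2 y2\<bar> \<le> q * (u + v + w) powr \<beta> + q * (u + v + w) powr \<beta>"
      using 1 2 by linarith
    then show ?thesis by (simp add: q_def u_def v_def w_def)
  qed
  have "\<bar>pY C \<alpha> \<rho> s1 x1 y - pY C \<alpha> \<rho> s2 x2 y\<bar>
         \<le> 4 * c * t0 powr (- (D + \<beta>) / \<alpha>) *
            (\<bar>s1 - s2\<bar> powr (1 / \<alpha>) + max (ldist x1 x2 / \<rho>) (\<Theta>1 / \<rho>)) powr \<beta>"
    if "1 \<le> \<rho>" "0 < t0" "t0 \<le> s1" "t0 \<le> s2" for \<rho> t0 s1 s2 x1 x2 y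
    by (rule order_trans[OF first[OF that]]) (use c in \<open>intro mult_right_mono, auto\<close>)
  with second c \<beta> show ?thesis
    unfolding D_def by (intro exI[of _ "4 * c"] conjI exI[of _ \<beta>]) auto
qed

end

theorem theorem4p6:
  fixes C :: "int^'d \<Rightarrow> int^'d \<Rightarrow> real"
    and \<alpha> \<kappa>1 \<kappa>2 \<kappa>3 \<Theta>1 :: real and N0 :: nat
  assumes alpha: "0 < \<alpha>" "\<alpha> < 2"
    and Cnonneg: "\<forall>x y. 0 \<le> C x y"
    and A1: "\<forall>x y. C x y = C y x" "\<forall>x. C x x = 0"
    and A2: "\<forall>x y. x \<noteq> y \<longrightarrow> C x y \<le> \<kappa>1 * ldist x y powr (- (real CARD('d) + \<alpha>))"
    and A3: "0 < \<kappa>2"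
      "\<exists>(len :: int^'d \<Rightarrow> int^'d \<Rightarrow> nat) (path :: int^'d \<Rightarrow> int^'d \<Rightarrow> nat \<Rightarrow> int^'d).
         (\<forall>x y. x \<noteq> y \<longrightarrow>
            len x y \<le> N0 \<and> path x y 0 = x \<and> path x y (len x y) = y \<and>
            (\<forall>i < len x y. \<kappa>2 * ldist x y powr (- (real CARD('d) + \<alpha>))
                              \<le> C (path x y i) (path x y (Suc i))))
       \<and> (\<forall>\<zeta> \<xi>. finite {(x, y). x \<noteq> y \<and> (\<exists>k < len x y. \<zeta> = path x y k \<and> \<xi> = path x y (Suc k))}
              \<and> card {(x, y). x \<noteq> y \<and> (\<exists>k < len x y. \<zeta> = path x y k \<and> \<xi> = path x y (Suc k))} \<le> N0)"
    and A4: "0 < \<Theta>1" "0 < \<kappa>3"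
      "\<forall>x r. \<Theta>1 \<le> r \<longrightarrow>
         real (card {y. ldist x y < r \<and> y \<noteq> x \<and> \<kappa>3 * ldist x y powr (- (real CARD('d) + \<alpha>)) \<le> C x y})
           \<ge> 5/6 * real (card {y. ldist x y < r})"
  shows "\<exists>c > 0. \<exists>\<beta>. 0 < \<beta> \<and> \<beta> < 1 \<and>
    (\<forall>\<rho> t0 s1 s2 x1 x2 y. 1 \<le> \<rho> \<longrightarrow> 0 < t0 \<longrightarrow> t0 \<le> s1 \<longrightarrow> t0 \<le> s2 \<longrightarrow>
       \<bar>pY C \<alpha> \<rho> s1 x1 y - pY C \<alpha> \<rho> s2 x2 y\<bar>
         \<le> c * t0 powr (- (real CARD('d) + \<beta>) / \<alpha>) *
            (\<bar>s1 - s2\<bar> powr (1 / \<alpha>) + max (ldist x1 x2 / \<rho>) (\<Theta>1 / \<rho>)) powr \<beta>) \<and>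
    (\<forall>\<rho> t0 s1 s2 x1 x2 y1 y2. 1 \<le> \<rho> \<longrightarrow> 0 < t0 \<longrightarrow> t0 \<le> s1 \<longrightarrow> t0 \<le> s2 \<longrightarrow>
       \<bar>pY C \<alpha> \<rho> s1 x1 y1 - pY C \<alpha> \<rho> s2 x2 y2\<bar>
         \<le> c * t0 powr (- (real CARD('d) + \<beta>) / \<alpha>) *
            (\<bar>s1 - s2\<bar> powr (1 / \<alpha>) + max (ldist x1 x2 / \<rho>) (\<Theta>1 / \<rho>)
              + max (ldist y1 y2 / \<rho>) (\<Theta>1 / \<rho>)) powr \<beta>)"
proof -
  obtain len path where paths:
    "\<And>x y. x \<noteq> y \<Longrightarrow> len x y \<le> N0 \<and> path x y 0 = x \<and> path x y (len x y) = y \<and>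
       (\<forall>i < len x y. \<kappa>2 * ldist x y powr (- (real CARD('d) + \<alpha>)) \<le> C (path x y i) (path x y (Suc i)))"
    and multiplicity:
    "\<And>\<zeta> \<xi>. finite {(x, y). x \<noteq> y \<and> (\<exists>k < len x y. \<zeta> = path x y k \<and> \<xi> = path x y (Suc k))}
       \<and> card {(x, y). x \<noteq> y \<and> (\<exists>k < len x y. \<zeta> = path x y k \<and> \<xi> = path x y (Suc k))} \<le> N0"
    using A3(2) by blast
  interpret stable_rates C \<alpha> \<kappa>1 \<kappa>2 \<kappa>3 \<Theta>1 N0 len path
    using alpha Cnonneg A1 A2 A3(1) A4 paths multiplicity by unfold_locales auto
  show ?thesis by (rule hoelder_conclusion)
qed

end
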